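(* Assume that $R$ is either a formal power series ring over $k$ (in finitely many variables) or a ring of convergent power series over $k=\mathbf C$ or $k=\mathbf R$. Let $\mathfrak g_R$ be a transitive Lie algebroid over $R$, i.e. $\alpha(\mathfrak g_R)=T_R$, put $\mathfrak g=\ker\alpha$, and let $M$ be a $\mathfrak g_R$-module of finite type over $R$. Then (1) $\mathfrak g_R\cong\mathfrak g\rtimes T_R$. (2) $M=RM^{T_R}=R\otimes_kM/\mathfrak m_RM$, where, after a choice of split $T_R\to\mathfrak g_R$ giving an isomorphism in (1), the subalgebroid $T_R$ acts trivially on $M/\mathfrak m_RM$. Hence $M$ is a local system over $\mathfrak g_R$.
   Context: $k$ has characteristic $0$ (and is algebraically closed in the formal case); $T_R$ is the $R$-module of $k$-linear derivations of $R$ and $\mathfrak m_R$ the maximal ideal. A Lie algebroid over $R$ is an $R$-module $\mathfrak g_R$ of finite type with a $k$-Lie algebra structure and a homomorphism of Lie algebras and $R$-modules $\alpha:\mathfrak g_R\to T_R$ with $[\delta,r\eta]=\alpha(\delta)(r)\eta+r[\delta,\eta]$. A $\mathfrak g_R$-module is an $R$-module $M$ with an $R$-linear homomorphism of $k$-Lie algebras $\rho:\mathfrak g_R\to\mathrm{End}_k(M)$ with $\rho(\delta)(rm)=\alpha(\delta)(r)m+r\rho(\delta)(m)$. $\mathfrak g_R\cong\mathfrak g\rtimes T_R$ means that $\mathfrak g_R$ is split: there is a homomorphism $\phi:T_R\to\mathfrak g_R$ of $R$-modules and Lie algebras with $\alpha\circ\phi=\mathrm{id}$ (a split, or integrable connection).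 Through a chosen $\phi$, $T_R$ acts on $M$, and $M^{T_R}=\{m\in M\mid\phi(\delta)m=0\ \forall\delta\in T_R\}$. The fibre Lie algebra is $\mathfrak g_k=k\otimes_R\mathfrak g$, where $k=R/\mathfrak m_R$, and $M$ is a local system over $\mathfrak g_R$ if it is of finite type over $R$ and $\ell_{\mathfrak g_R}(M)=\ell_{\mathfrak g_k}(k\otimes_RM)$, where $\ell$ denotes length. *)

theory Defs
  imports
    "HOL-Analysis.Infinite_Sum"
    "HOL-Computational_Algebra.Polynomial"
    "HOL-Library.Poly_Mapping"
    "HOL-Library.Extended_Nat"
    "HOL-Algebra.Module"
    "HOL-Algebra.QuotRing"
begin

section \<open>Rings of power series in finitely many variables\<close>

text \<open>A multi-index is a finitely supported function on the naturals; a series in the variables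
  \<open>x\<^sub>0, \<dots>, x\<^sub>n\<^sub>-\<^sub>1\<close> is a family of coefficients vanishing at every multi-index that involves
  another variable. The case \<open>n = 0\<close> is allowed.\<close>

type_synonym 'k mseries = "(nat \<Rightarrow>\<^sub>0 nat) \<Rightarrow> 'k"

definition mi_degree :: "(nat \<Rightarrow>\<^sub>0 nat) \<Rightarrow> nat" where
  "mi_degree a = (\<Sum>i\<in>Poly_Mapping.keys a. Poly_Mapping.lookup a i)"

definition const_series :: "'k::zero \<Rightarrow> 'k mseries" where
  "const_series c = (\<lambda>a. if a = 0 then c else 0)"

definition formal_series_ring :: "nat \<Rightarrow> 'k::field mseries ring" where
  "formal_series_ring n =
    \<lparr> carrier = {f. \<forall>a. \<not> Poly_Mapping.keys a \<subseteq> {..<n} \<longrightarrow> f a = 0},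
      mult = (\<lambda>f g a. \<Sum>(b, c)\<in>{(b, c). b + c = a}. f b * g c),
      one = const_series 1,
      ring.zero = const_series 0,
      add = (\<lambda>f g a. f a + g a) \<rparr>"

definition field_embedding :: "('k::field \<Rightarrow> complex) \<Rightarrow> bool" where
  "field_embedding \<iota> \<longleftrightarrow>
    \<iota> 1 = 1 \<and> (\<forall>x y. \<iota> (x + y) = \<iota> x + \<iota> y) \<and> (\<forall>x y. \<iota> (x * y) = \<iota> x * \<iota> y)"

text \<open>Here \<open>\<iota>\<close> identifies the coefficient field with \<open>\<complex>\<close> (range \<open>UNIV\<close>) or with \<open>\<real>\<close> (range \<open>\<real>\<close>).
  A series is convergent if it converges absolutely at some \<open>(r, \<dots>, r)\<close> with \<open>r > 0\<close>, that is,
  absolutely and uniformly on the closed polydisc of radius \<open>r\<close> about the origin.\<close>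

definition convergent_series_ring :: "('k::field \<Rightarrow> complex) \<Rightarrow> nat \<Rightarrow> 'k mseries ring" where
  "convergent_series_ring \<iota> n = (formal_series_ring n)
    \<lparr> carrier := {f \<in> carrier (formal_series_ring n).
        \<exists>r::real. r > 0 \<and> (\<lambda>a. norm (\<iota> (f a)) * r ^ mi_degree a) summable_on UNIV} \<rparr>"

text \<open>Below, \<open>k\<close> is a subset \<open>K\<close> of \<open>carrier R\<close> (for series rings, the constant series), and the
  ring \<open>k\<close> is \<^term>\<open>R\<lparr>carrier := K\<rparr>\<close>. An \<open>R\<close>-module is thus also a module over \<open>k\<close>.\<close>

abbreviation scalars :: "'r ring \<Rightarrow> 'r set \<Rightarrow> 'r ring" where
  "scalars R K \<equiv> R\<lparr>carrier := K\<rparr>"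


section \<open>Modules\<close>

definition self_module :: "'r ring \<Rightarrow> ('r, 'r) module" where
  "self_module R = ring.extend R (module.fields (mult R))"

definition lin_maps ::
  "'s ring \<Rightarrow> ('s, 'a, 'x) module_scheme \<Rightarrow> ('s, 'b, 'y) module_scheme \<Rightarrow> ('a \<Rightarrow> 'b) set" where
  "lin_maps S A B = {h \<in> carrier A \<rightarrow> carrier B.
    (\<forall>x\<in>carrier A. \<forall>y\<in>carrier A. h (x \<oplus>\<^bsub>A\<^esub> y) = h x \<oplus>\<^bsub>B\<^esub> h y) \<and>
    (\<forall>s\<in>carrier S. \<forall>x\<in>carrier A. h (s \<odot>\<^bsub>A\<^esub> x) = s \<odot>\<^bsub>B\<^esub> h x)}"

definition bilin_maps ::
  "'s ring \<Rightarrow> ('s, 'a, 'x) module_scheme \<Rightarrow> ('s, 'b, 'y) module_scheme \<Rightarrow>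
    ('s, 'c, 'z) module_scheme \<Rightarrow> ('a \<Rightarrow> 'b \<Rightarrow> 'c) set" where
  "bilin_maps S A B C = {h \<in> carrier A \<rightarrow>\<^sub>E carrier B \<rightarrow>\<^sub>E carrier C.
    (\<forall>x\<in>carrier A. h x \<in> lin_maps S B C) \<and>
    (\<forall>y\<in>carrier B. (\<lambda>x. h x y) \<in> lin_maps S A C)}"

definition span_mod :: "'s ring \<Rightarrow> ('s, 'a, 'x) module_scheme \<Rightarrow> 'a set \<Rightarrow> 'a set" where
  "span_mod S A Y = \<Inter>{N. submodule N S A \<and> Y \<subseteq> N}"

definition finite_type :: "'s ring \<Rightarrow> ('s, 'a, 'x) module_scheme \<Rightarrow> bool" where
  "finite_type S A \<longleftrightarrow> (\<exists>Y \<subseteq> carrier A. finite Y \<and> span_mod S A Y = carrier A)"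

definition ideal_times :: "'s ring \<Rightarrow> 's set \<Rightarrow> ('s, 'a, 'x) module_scheme \<Rightarrow> 'a set" where
  "ideal_times S I A = span_mod S A {s \<odot>\<^bsub>A\<^esub> x | s x. s \<in> I \<and> x \<in> carrier A}"

text \<open>The ring-theoretic fields of the module record are irrelevant for a module and are left
  unspecified.\<close>

definition quot_module :: "('s, 'a, 'x) module_scheme \<Rightarrow> 'a set \<Rightarrow> ('s, 'a set) module" where
  "quot_module A N =
    \<lparr> carrier = a_rcosets\<^bsub>A\<^esub> N, mult = undefined, one = undefined,
      ring.zero = N, add = set_add A,
      smult = (\<lambda>s Y. \<Union>x\<in>Y. N +>\<^bsub>A\<^esub> (s \<odot>\<^bsub>A\<^esub> x)) \<rparr>"

definition free_module :: "'s ring \<Rightarrow> 'i set \<Rightarrow> ('s, 'i \<Rightarrow> 's) module" where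
  "free_module S I =
    \<lparr> carrier = {f. (\<forall>i. f i \<in> carrier S) \<and> (\<forall>i. i \<notin> I \<longrightarrow> f i = \<zero>\<^bsub>S\<^esub>) \<and>
        finite {i. f i \<noteq> \<zero>\<^bsub>S\<^esub>}},
      mult = undefined, one = undefined,
      ring.zero = (\<lambda>i. \<zero>\<^bsub>S\<^esub>), add = (\<lambda>f g i. f i \<oplus>\<^bsub>S\<^esub> g i),
      smult = (\<lambda>s f i. s \<otimes>\<^bsub>S\<^esub> f i) \<rparr>"

definition free_gen :: "'s ring \<Rightarrow> 'i \<Rightarrow> 'i \<Rightarrow> 's" where
  "free_gen S i = (\<lambda>j. if j = i then \<one>\<^bsub>S\<^esub> else \<zero>\<^bsub>S\<^esub>)"

text \<open>The tensor product of two modules over a commutative ring \<open>S\<close>: the free module on the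
  pairs, modulo the bilinearity relations.\<close>

definition tensor_relations ::
  "'s ring \<Rightarrow> ('s, 'a, 'x) module_scheme \<Rightarrow> ('s, 'b, 'y) module_scheme \<Rightarrow> ('a \<times> 'b \<Rightarrow> 's) set" where
  "tensor_relations S A B =
    (let F = free_module S (carrier A \<times> carrier B); e = (\<lambda>a b. free_gen S (a, b)) in
      {e (a \<oplus>\<^bsub>A\<^esub> a') b \<ominus>\<^bsub>F\<^esub> (e a b \<oplus>\<^bsub>F\<^esub> e a' b) | a a' b.
        a \<in> carrier A \<and> a' \<in> carrier A \<and> b \<in> carrier B} \<union>
      {e a (b \<oplus>\<^bsub>B\<^esub> b') \<ominus>\<^bsub>F\<^esub> (e a b \<oplus>\<^bsub>F\<^esub> e a b') | a b b'.
        a \<in> carrier A \<and> b \<in> carrier B \<and> b' \<in> carrier B} \<union>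
      {e (s \<odot>\<^bsub>A\<^esub> a) b \<ominus>\<^bsub>F\<^esub> s \<odot>\<^bsub>F\<^esub> e a b | s a b.
        s \<in> carrier S \<and> a \<in> carrier A \<and> b \<in> carrier B} \<union>
      {e a (s \<odot>\<^bsub>B\<^esub> b) \<ominus>\<^bsub>F\<^esub> s \<odot>\<^bsub>F\<^esub> e a b | s a b.
        s \<in> carrier S \<and> a \<in> carrier A \<and> b \<in> carrier B})"

definition tensor_kernel ::
  "'s ring \<Rightarrow> ('s, 'a, 'x) module_scheme \<Rightarrow> ('s, 'b, 'y) module_scheme \<Rightarrow> ('a \<times> 'b \<Rightarrow> 's) set" where
  "tensor_kernel S A B =
    span_mod S (free_module S (carrier A \<times> carrier B)) (tensor_relations S A B)"

definition tensor ::
  "'s ring \<Rightarrow> ('s, 'a, 'x) module_scheme \<Rightarrow> ('s, 'b, 'y) module_scheme \<Rightarrow>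
    ('s, ('a \<times> 'b \<Rightarrow> 's) set) module" where
  "tensor S A B = quot_module (free_module S (carrier A \<times> carrier B)) (tensor_kernel S A B)"

definition pure_tensor ::
  "'s ring \<Rightarrow> ('s, 'a, 'x) module_scheme \<Rightarrow> ('s, 'b, 'y) module_scheme \<Rightarrow>
    'a \<Rightarrow> 'b \<Rightarrow> ('a \<times> 'b \<Rightarrow> 's) set" where
  "pure_tensor S A B a b =
    tensor_kernel S A B +>\<^bsub>free_module S (carrier A \<times> carrier B)\<^esub> free_gen S (a, b)"


section \<open>Lie algebras and Lie algebroids\<close>

record ('r, 'g) lie_module = "('r, 'g) module" +
  lie_bracket :: "'g \<Rightarrow> 'g \<Rightarrow> 'g"

locale lie_algebra = module K L
  for K (structure) and L :: "('r, 'g, 'x) lie_module_scheme" (structure) +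
  assumes bracket_closed:
      "\<lbrakk>x \<in> carrier L; y \<in> carrier L\<rbrakk> \<Longrightarrow> lie_bracket L x y \<in> carrier L"
    and bracket_add_left:
      "\<lbrakk>x \<in> carrier L; y \<in> carrier L; z \<in> carrier L\<rbrakk> \<Longrightarrow>
        lie_bracket L (x \<oplus>\<^bsub>L\<^esub> y) z = lie_bracket L x z \<oplus>\<^bsub>L\<^esub> lie_bracket L y z"
    and bracket_add_right:
      "\<lbrakk>x \<in> carrier L; y \<in> carrier L; z \<in> carrier L\<rbrakk> \<Longrightarrow>
        lie_bracket L x (y \<oplus>\<^bsub>L\<^esub> z) = lie_bracket L x y \<oplus>\<^bsub>L\<^esub> lie_bracket L x z"
    and bracket_smult_left:
      "\<lbrakk>c \<in> carrier K; x \<in> carrier L; y \<in> carrier L\<rbrakk> \<Longrightarrow>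
        lie_bracket L (c \<odot>\<^bsub>L\<^esub> x) y = c \<odot>\<^bsub>L\<^esub> lie_bracket L x y"
    and bracket_smult_right:
      "\<lbrakk>c \<in> carrier K; x \<in> carrier L; y \<in> carrier L\<rbrakk> \<Longrightarrow>
        lie_bracket L x (c \<odot>\<^bsub>L\<^esub> y) = c \<odot>\<^bsub>L\<^esub> lie_bracket L x y"
    and bracket_alternating: "x \<in> carrier L \<Longrightarrow> lie_bracket L x x = \<zero>\<^bsub>L\<^esub>"
    and jacobi:
      "\<lbrakk>x \<in> carrier L; y \<in> carrier L; z \<in> carrier L\<rbrakk> \<Longrightarrow>
        lie_bracket L x (lie_bracket L y z) \<oplus>\<^bsub>L\<^esub> lie_bracket L y (lie_bracket L z x)
          \<oplus>\<^bsub>L\<^esub> lie_bracket L z (lie_bracket L x y) = \<zero>\<^bsub>L\<^esub>"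

definition lie_homs ::
  "('r, 'g, 'x) lie_module_scheme \<Rightarrow> ('r, 'h, 'y) lie_module_scheme \<Rightarrow> ('g \<Rightarrow> 'h) set" where
  "lie_homs L L' = {h \<in> carrier L \<rightarrow> carrier L'.
    \<forall>x\<in>carrier L. \<forall>y\<in>carrier L. h (lie_bracket L x y) = lie_bracket L' (h x) (h y)}"

text \<open>\<open>End\<^sub>k(M)\<close>, with the commutator bracket and the \<open>R\<close>-module structure \<open>(r f)(m) = r f(m)\<close>.
  Endomorphisms are represented by functions that are undefined outside the carrier.\<close>

definition endo_lie ::
  "'r ring \<Rightarrow> 'r set \<Rightarrow> ('r, 'm) module \<Rightarrow> ('r, 'm \<Rightarrow> 'm) lie_module" where
  "endo_lie R K M =
    \<lparr> carrier = (carrier M \<rightarrow>\<^sub>E carrier M) \<inter> lin_maps (scalars R K) M M,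
      mult = undefined, one = undefined,
      ring.zero = (\<lambda>m\<in>carrier M. \<zero>\<^bsub>M\<^esub>),
      add = (\<lambda>f g. \<lambda>m\<in>carrier M. f m \<oplus>\<^bsub>M\<^esub> g m),
      smult = (\<lambda>r f. \<lambda>m\<in>carrier M. r \<odot>\<^bsub>M\<^esub> f m),
      lie_bracket = (\<lambda>f g. \<lambda>m\<in>carrier M. f (g m) \<ominus>\<^bsub>M\<^esub> g (f m)) \<rparr>"

definition derivations :: "'r ring \<Rightarrow> 'r set \<Rightarrow> ('r, 'r \<Rightarrow> 'r) lie_module" where
  "derivations R K = (endo_lie R K (self_module R))
    \<lparr> carrier := {D \<in> carrier (endo_lie R K (self_module R)).
        \<forall>r\<in>carrier R. \<forall>s\<in>carrier R. D (r \<otimes>\<^bsub>R\<^esub> s) = D r \<otimes>\<^bsub>R\<^esub> s \<oplus>\<^bsub>R\<^esub> r \<otimes>\<^bsub>R\<^esub> D s} \<rparr>"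

locale lie_algebroid =
  fixes R :: "'r ring" and K :: "'r set" and G :: "('r, 'g) lie_module" and \<alpha> :: "'g \<Rightarrow> 'r \<Rightarrow> 'r"
  assumes module: "module R G"
    and finite_type: "finite_type R G"
    and lie_algebra: "lie_algebra (scalars R K) G"
    and anchor_linear: "\<alpha> \<in> lin_maps R G (derivations R K)"
    and anchor_lie: "\<alpha> \<in> lie_homs G (derivations R K)"
    and leibniz: "\<lbrakk>\<delta> \<in> carrier G; \<eta> \<in> carrier G; r \<in> carrier R\<rbrakk> \<Longrightarrow>
      lie_bracket G \<delta> (r \<odot>\<^bsub>G\<^esub> \<eta>) = \<alpha> \<delta> r \<odot>\<^bsub>G\<^esub> \<eta> \<oplus>\<^bsub>G\<^esub> r \<odot>\<^bsub>G\<^esub> lie_bracket G \<delta> \<eta>"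

definition transitive ::
  "'r ring \<Rightarrow> 'r set \<Rightarrow> ('r, 'g) lie_module \<Rightarrow> ('g \<Rightarrow> 'r \<Rightarrow> 'r) \<Rightarrow> bool" where
  "transitive R K G \<alpha> \<longleftrightarrow> \<alpha> ` carrier G = carrier (derivations R K)"

definition anchor_kernel ::
  "'r ring \<Rightarrow> 'r set \<Rightarrow> ('r, 'g) lie_module \<Rightarrow> ('g \<Rightarrow> 'r \<Rightarrow> 'r) \<Rightarrow> ('r, 'g) lie_module" where
  "anchor_kernel R K G \<alpha> =
    G\<lparr>carrier := {x \<in> carrier G. \<alpha> x = \<zero>\<^bsub>derivations R K\<^esub>}\<rparr>"

locale lie_algebroid_module = lie_algebroid R K G \<alpha>
  for R :: "'r ring" and K :: "'r set" and G :: "('r, 'g) lie_module" and \<alpha> :: "'g \<Rightarrow> 'r \<Rightarrow> 'r" +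
  fixes M :: "('r, 'm) module" and \<rho> :: "'g \<Rightarrow> 'm \<Rightarrow> 'm"
  assumes module_M: "module R M"
    and action_linear: "\<rho> \<in> lin_maps R G (endo_lie R K M)"
    and action_lie: "\<rho> \<in> lie_homs G (endo_lie R K M)"
    and action_leibniz: "\<lbrakk>\<delta> \<in> carrier G; r \<in> carrier R; m \<in> carrier M\<rbrakk> \<Longrightarrow>
      \<rho> \<delta> (r \<odot>\<^bsub>M\<^esub> m) = \<alpha> \<delta> r \<odot>\<^bsub>M\<^esub> m \<oplus>\<^bsub>M\<^esub> r \<odot>\<^bsub>M\<^esub> \<rho> \<delta> m"

definition splitting ::
  "'r ring \<Rightarrow> 'r set \<Rightarrow> ('r, 'g) lie_module \<Rightarrow> ('g \<Rightarrow> 'r \<Rightarrow> 'r) \<Rightarrow> (('r \<Rightarrow> 'r) \<Rightarrow> 'g) \<Rightarrow> bool" where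
  "splitting R K G \<alpha> \<phi> \<longleftrightarrow>
    \<phi> \<in> lin_maps R (derivations R K) G \<and> \<phi> \<in> lie_homs (derivations R K) G \<and>
    (\<forall>\<delta>\<in>carrier (derivations R K). \<alpha> (\<phi> \<delta>) = \<delta>)"

definition is_split ::
  "'r ring \<Rightarrow> 'r set \<Rightarrow> ('r, 'g) lie_module \<Rightarrow> ('g \<Rightarrow> 'r \<Rightarrow> 'r) \<Rightarrow> bool" where
  "is_split R K G \<alpha> \<longleftrightarrow> (\<exists>\<phi>. splitting R K G \<alpha> \<phi>)"

definition invariants ::
  "'r ring \<Rightarrow> 'r set \<Rightarrow> ('r, 'm) module \<Rightarrow> ('g \<Rightarrow> 'm \<Rightarrow> 'm) \<Rightarrow> (('r \<Rightarrow> 'r) \<Rightarrow> 'g) \<Rightarrow> 'm set" where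
  "invariants R K M \<rho> \<phi> =
    {m \<in> carrier M. \<forall>\<delta>\<in>carrier (derivations R K). \<rho> (\<phi> \<delta>) m = \<zero>\<^bsub>M\<^esub>}"


section \<open>Fibres, length and local systems\<close>

definition max_ideal :: "'r ring \<Rightarrow> 'r set" where
  "max_ideal R = (THE I. maximalideal I R)"

definition reduction :: "'r ring \<Rightarrow> ('r, 'a, 'x) module_scheme \<Rightarrow> ('r, 'a set) module" where
  "reduction R A = quot_module A (ideal_times R (max_ideal R) A)"

text \<open>\<open>k = R/\<mm>\<^sub>R\<close> as an \<open>R\<close>-module; its multiplication is that of the ring
  \<^term>\<open>R Quot max_ideal R\<close>, which has the same carrier.\<close>

definition residue_module :: "'r ring \<Rightarrow> ('r, 'r set) module" where
  "residue_module R = quot_module (self_module R) (max_ideal R)"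

definition fibre ::
  "'r ring \<Rightarrow> ('r, 'a, 'x) module_scheme \<Rightarrow> ('r, ('r set \<times> 'a \<Rightarrow> 'r) set) module" where
  "fibre R A = tensor R (residue_module R) A"

text \<open>The base change to \<open>k\<close> of an \<open>R\<close>-bilinear map \<open>p : A \<times> B \<rightarrow> C\<close>:
  \<open>(a \<otimes> x, b \<otimes> y) \<mapsto> ab \<otimes> p(x, y)\<close>.\<close>

definition fibre_bilin ::
  "'r ring \<Rightarrow> ('r, 'a, 'x) module_scheme \<Rightarrow> ('r, 'b, 'y) module_scheme \<Rightarrow>
    ('r, 'c, 'z) module_scheme \<Rightarrow> ('a \<Rightarrow> 'b \<Rightarrow> 'c) \<Rightarrow>
    ('r set \<times> 'a \<Rightarrow> 'r) set \<Rightarrow> ('r set \<times> 'b \<Rightarrow> 'r) set \<Rightarrow> ('r set \<times> 'c \<Rightarrow> 'r) set" where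
  "fibre_bilin R A B C p = (THE h. h \<in> bilin_maps R (fibre R A) (fibre R B) (fibre R C) \<and>
    (\<forall>a\<in>carrier (R Quot max_ideal R). \<forall>b\<in>carrier (R Quot max_ideal R).
      \<forall>x\<in>carrier A. \<forall>y\<in>carrier B.
        h (pure_tensor R (residue_module R) A a x) (pure_tensor R (residue_module R) B b y) =
          pure_tensor R (residue_module R) C (a \<otimes>\<^bsub>R Quot max_ideal R\<^esub> b) (p x y)))"

definition fibre_lie ::
  "'r ring \<Rightarrow> ('r, 'g) lie_module \<Rightarrow> ('r, ('r set \<times> 'g \<Rightarrow> 'r) set) lie_module" where
  "fibre_lie R L =
    module.extend (fibre R L) (lie_module.fields (fibre_bilin R L L L (lie_bracket L)))"

text \<open>The length of a module \<open>M\<close> with scalars \<open>S\<close> on which \<open>L\<close> acts by \<open>\<rho>\<close>: the supremum of the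
  lengths of chains of \<open>L\<close>-stable \<open>S\<close>-submodules.\<close>

definition stable_submodule ::
  "'s ring \<Rightarrow> ('r, 'g) lie_module \<Rightarrow> ('s, 'm) module \<Rightarrow> ('g \<Rightarrow> 'm \<Rightarrow> 'm) \<Rightarrow> 'm set \<Rightarrow> bool" where
  "stable_submodule S L M \<rho> N \<longleftrightarrow>
    submodule N S M \<and> (\<forall>x\<in>carrier L. \<forall>m\<in>N. \<rho> x m \<in> N)"

definition rep_length ::
  "'s ring \<Rightarrow> ('r, 'g) lie_module \<Rightarrow> ('s, 'm) module \<Rightarrow> ('g \<Rightarrow> 'm \<Rightarrow> 'm) \<Rightarrow> enat" where
  "rep_length S L M \<rho> = Sup {enat l | l. \<exists>N :: nat \<Rightarrow> 'm set.
    (\<forall>i\<le>l. stable_submodule S L M \<rho> (N i)) \<and> (\<forall>i<l. N i \<subset> N (Suc i))}"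

text \<open>The fibre Lie algebra is \<open>k \<otimes>\<^sub>R ker \<alpha>\<close>; it acts \<open>k\<close>-linearly on \<open>k \<otimes>\<^sub>R M\<close>, because
  \<open>ker \<alpha>\<close> acts \<open>R\<close>-linearly on \<open>M\<close>.\<close>

definition local_system ::
  "'r ring \<Rightarrow> 'r set \<Rightarrow> ('r, 'g) lie_module \<Rightarrow> ('g \<Rightarrow> 'r \<Rightarrow> 'r) \<Rightarrow>
    ('r, 'm) module \<Rightarrow> ('g \<Rightarrow> 'm \<Rightarrow> 'm) \<Rightarrow> bool" where
  "local_system R K G \<alpha> M \<rho> \<longleftrightarrow>
    finite_type R M \<and>
    rep_length R G M \<rho> =
      rep_length (scalars R K) (fibre_lie R (anchor_kernel R K G \<alpha>)) (fibre R M)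
        (fibre_bilin R (anchor_kernel R K G \<alpha>) M M \<rho>)"

end

theory Submission
  imports Defs
begin

text \<open>
  Write \<open>\<partial>\<^sub>1, \<dots>, \<partial>\<^sub>n\<close> for the partial derivatives. They form a basis of \<open>T\<^sub>R\<close>, because a derivation is
  determined by its values on the variables (\<open>derivation_expand\<close>). Everything rests on one linear
  differential equation. Let \<open>N\<close> be a module of finite type with operators \<open>\<nabla>\<^sub>i\<close> that satisfy the
  Leibniz rule over \<open>\<partial>\<^sub>i\<close>; they need not commute. Since the characteristic is \<open>0\<close>, differentiating a
  relation of order \<open>d + 1\<close> between generators gives one of order \<open>d\<close>, so a minimal system of
  generators is a basis (\<open>basis_exists\<close>). The radial operator \<open>E = \<Sum>\<^sub>i x\<^sub>i \<nabla>\<^sub>i\<close> maps \<open>N\<close> into \<open>\<mm> N\<close> and, in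
  a basis, has the form \<open>\<Sum>\<^sub>i x\<^sub>i \<partial>\<^sub>i + A\<close> with a matrix \<open>A\<close> over \<open>\<mm>\<close>. The equation \<open>(E + c) v = w\<close> is
  therefore triangular with respect to the degree, with diagonal entry \<open>d + c\<close> in degree \<open>d\<close>: the
  operator \<open>E + c\<close> is bijective on \<open>N\<close> for \<open>c = 1, 2, \<dots>\<close>, and \<open>E u = - E x\<close> has a unique
  solution \<open>u\<close> in \<open>\<mm> N\<close> for each \<open>x\<close> in \<open>N\<close>
  (\<open>radial_shift_surj\<close>, \<open>radial_shift_inj\<close>, \<open>radial_lift\<close>). For convergent series the formal solution
  converges, by the estimate \<open>\<parallel>v\<parallel> \<le> \<parallel>w\<parallel> + \<parallel>v\<parallel> \<parallel>A\<parallel>\<close> on small polydiscs (\<open>solution_convergent\<close>).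

  (1) Choose lifts \<open>\<delta>\<^sub>i\<close> of \<open>\<partial>\<^sub>i\<close> to \<open>\<gg>\<^sub>R\<close> and put \<open>E = \<Sum>\<^sub>i x\<^sub>i \<delta>\<^sub>i\<close>. On \<open>\<gg>\<close> the operator \<open>ad E\<close> is the radial
  operator of \<open>\<nabla>\<^sub>i = ad \<delta>\<^sub>i\<close>. Solving \<open>(ad E + 1) u = - \<Sum>\<^sub>i x\<^sub>i [\<delta>\<^sub>i, \<delta>\<^sub>j]\<close> in \<open>\<gg>\<close> corrects \<open>\<delta>\<^sub>j\<close> to an
  eigenvector \<open>\<delta>\<^sub>j + u\<close> of \<open>ad E\<close> with eigenvalue \<open>-1\<close>. The bracket of two of these eigenvectors
  lies in \<open>\<gg>\<close> and has eigenvalue \<open>-2\<close>, so it is \<open>0\<close> as \<open>ad E + 2\<close> is injective there. The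
  corrected lifts commute, and \<open>\<partial>\<^sub>i \<mapsto> \<delta>\<^sub>i + u\<^sub>i\<close> defines a splitting (\<open>transitive_split\<close>).

  (2) A splitting makes \<open>M\<close> a module with commuting \<open>\<nabla>\<^sub>i\<close>. From \<open>E \<nabla>\<^sub>i = \<nabla>\<^sub>i E - \<nabla>\<^sub>i\<close> and the injectivity of
  \<open>E + 1\<close> the kernel of \<open>E\<close> is the space \<open>H\<close> of horizontal elements, and as \<open>E u = - E x\<close> is uniquely
  solvable in \<open>\<mm> M\<close>, each class in \<open>M / \<mm> M\<close> has exactly one horizontal representative. The representatives of a
  basis form a basis of \<open>M\<close> (\<open>hor_basis_exists\<close>), which gives \<open>M = R H\<close> and \<open>M = R \<otimes>\<^sub>k M / \<mm> M\<close>
  (\<open>trivialisation\<close>).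

  For the lengths, a submodule stable under \<open>T\<^sub>R\<close> is generated by its horizontal elements
  (\<open>stable_submodule_span_hor\<close>): an element with the least number of nonzero coordinates,
  normalised to have a coordinate \<open>1\<close>, is horizontal. Since \<open>\<gg>\<close> is itself generated by its horizontal
  elements, \<open>L \<mapsto> 1 \<otimes> L\<close> and \<open>U \<mapsto> R {h \<in> H. 1 \<otimes> h \<in> U}\<close> are strictly monotone maps between the stable
  submodules of \<open>M\<close> and those of its fibre, so the lengths agree (\<open>is_local_system\<close>).
\<close>

section \<open>Multi-indices and the convolution product\<close>

lemma mi_degree_superset:
  assumes "finite S" "Poly_Mapping.keys a \<subseteq> S"
  shows "mi_degree a = (\<Sum>i\<in>S. Poly_Mapping.lookup a i)"
  unfolding mi_degree_def
  by (rule sum.mono_neutral_left) (use assms in \<open>auto simp: in_keys_iff\<close>)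

lemma keys_add_nat: "Poly_Mapping.keys (a + b) = Poly_Mapping.keys a \<union> Poly_Mapping.keys b"
  for a b :: "nat \<Rightarrow>\<^sub>0 nat"
  by (auto simp: in_keys_iff lookup_add)

lemma mi_degree_add: "mi_degree (a + b) = mi_degree a + mi_degree b"
proof -
  let ?S = "Poly_Mapping.keys a \<union> Poly_Mapping.keys b"
  have "mi_degree c = (\<Sum>i\<in>?S. Poly_Mapping.lookup c i)" if "c \<in> {a, b, a + b}" for c
    using that by (intro mi_degree_superset) (auto simp: keys_add_nat)
  then show ?thesis by (simp add: lookup_add sum.distrib)
qed

lemma mi_degree_zero [simp]: "mi_degree 0 = 0"
  by (simp add: mi_degree_def)

lemma mi_degree_eq_0_iff: "mi_degree a = 0 \<longleftrightarrow> a = 0"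
proof
  assume "mi_degree a = 0"
  then have "Poly_Mapping.lookup a i = 0" for i
    by (cases "i \<in> Poly_Mapping.keys a") (auto simp: mi_degree_def in_keys_iff)
  then show "a = 0" by (intro poly_mapping_eqI) simp
qed simp

text \<open>The exponent of the variable \<open>x\<^sub>i\<close>.\<close>

definition mi_unit :: "nat \<Rightarrow> nat \<Rightarrow>\<^sub>0 nat" where
  "mi_unit i = Poly_Mapping.single i 1"

lemma lookup_mi_unit: "Poly_Mapping.lookup (mi_unit i) j = (if i = j then 1 else 0)"
  by (simp add: mi_unit_def lookup_single when_def)

lemma keys_mi_unit [simp]: "Poly_Mapping.keys (mi_unit i) = {i}"
  by (simp add: mi_unit_def)

lemma mi_degree_unit [simp]: "mi_degree (mi_unit i) = 1"
  by (simp add: mi_degree_def lookup_mi_unit)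

lemma mi_unit_nonzero [simp]: "mi_unit i \<noteq> 0" "0 \<noteq> mi_unit i"
  using mi_degree_unit[of i] by (metis mi_degree_zero zero_neq_one)+

lemma finite_mi_below: "finite {b :: nat \<Rightarrow>\<^sub>0 nat. \<exists>c. b + c = a}"
proof -
  let ?K = "Poly_Mapping.keys a"
  have "Poly_Mapping.lookup ` {b. \<exists>c. b + c = a} \<subseteq>
      {f. \<forall>i. (i \<in> ?K \<longrightarrow> f i \<in> {..mi_degree a}) \<and> (i \<notin> ?K \<longrightarrow> f i = 0)}"
  proof clarsimp
    fix b c i assume a: "a = b + c"
    have "Poly_Mapping.lookup a i \<le> mi_degree a"
      by (cases "i \<in> Poly_Mapping.keys a")
        (auto simp: mi_degree_def in_keys_iff intro: member_le_sum)
    then show "(i \<in> Poly_Mapping.keys (b + c) \<longrightarrow> Poly_Mapping.lookup b i \<le> mi_degree (b + c)) \<and>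
        (i \<notin> Poly_Mapping.keys (b + c) \<longrightarrow> Poly_Mapping.lookup b i = 0)"
      by (auto simp: a in_keys_iff lookup_add)
  qed
  moreover have "finite {f. \<forall>i. (i \<in> ?K \<longrightarrow> f i \<in> {..mi_degree a}) \<and> (i \<notin> ?K \<longrightarrow> f i = 0)}"
    by (rule finite_set_of_finite_funs) auto
  ultimately have "finite (Poly_Mapping.lookup ` {b. \<exists>c. b + c = a})"
    by (rule finite_subset)
  then show ?thesis
    by (rule finite_imageD) (simp add: inj_on_def lookup_inject)
qed

text \<open>The decompositions of a multi-index, over which a coefficient of a product is summed.\<close>

abbreviation antidiag :: "(nat \<Rightarrow>\<^sub>0 nat) \<Rightarrow> ((nat \<Rightarrow>\<^sub>0 nat) \<times> (nat \<Rightarrow>\<^sub>0 nat)) set" where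
  "antidiag a \<equiv> {(b, c). b + c = a}"

lemma finite_antidiag [simp]: "finite (antidiag a)"
proof -
  let ?B = "{b :: nat \<Rightarrow>\<^sub>0 nat. \<exists>c. b + c = a}"
  have "antidiag a \<subseteq> ?B \<times> ?B" by (auto, metis add.commute)
  then show ?thesis by (rule finite_subset) (simp add: finite_mi_below)
qed

lemma finite_antidiag' [simp]: "finite {p. fst p + snd p = (a :: nat \<Rightarrow>\<^sub>0 nat)}"
  by (rule finite_subset[OF _ finite_antidiag[of a]]) auto

lemma antidiag_zero [simp]: "antidiag 0 = {(0, 0)}"
proof -
  have *: "b = 0 \<and> c = 0" if "b + c = 0" for b c :: "nat \<Rightarrow>\<^sub>0 nat"
    using arg_cong[OF that, of mi_degree] by (simp add: mi_degree_add mi_degree_eq_0_iff)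
  show ?thesis
  proof (intro equalityI subsetI)
    fix p assume "p \<in> antidiag 0"
    then obtain b c where p: "p = (b, c)" "b + c = 0" by blast
    then show "p \<in> {(0, 0)}" using *[OF p(2)] by simp
  qed simp
qed

text \<open>The product of series in any number of variables. A multi-index has finitely many
  decompositions, so this is defined for all families of coefficients.\<close>

definition series_mult :: "'k::comm_semiring_1 mseries \<Rightarrow> 'k mseries \<Rightarrow> 'k mseries" where
  "series_mult f g = (\<lambda>a. \<Sum>(b, c)\<in>antidiag a. f b * g c)"

lemma series_mult_commute: "series_mult f g = series_mult g f"
  unfolding series_mult_def
  by (intro ext sum.reindex_bij_witness[where i = prod.swap and j = prod.swap])
    (auto simp: add.commute mult.commute)

lemma series_mult_assoc: "series_mult (series_mult f g) h = series_mult f (series_mult g h)"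
proof
  fix a
  have "series_mult (series_mult f g) h a =
      (\<Sum>(p, q)\<in>(SIGMA p:antidiag a. antidiag (fst p)). f (fst q) * g (snd q) * h (snd p))"
    by (subst sum.Sigma[symmetric])
      (auto simp: series_mult_def sum_distrib_right case_prod_beta)
  also have "\<dots> = (\<Sum>(p, q)\<in>(SIGMA p:antidiag a. antidiag (snd p)). f (fst p) * (g (fst q) * h (snd q)))"
    by (rule sum.reindex_bij_witness[where
        i = "\<lambda>(p, q). ((fst p + fst q, snd q), (fst p, fst q))" and
        j = "\<lambda>(p, q). ((fst q, snd q + snd p), (snd q, snd p))"])
      (auto simp: ac_simps)
  also have "\<dots> = series_mult f (series_mult g h) a"
    by (subst sum.Sigma[symmetric])
      (auto simp: series_mult_def sum_distrib_left case_prod_beta)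
  finally show "series_mult (series_mult f g) h a = series_mult f (series_mult g h) a" .
qed

lemma series_mult_distrib_left:
  "series_mult f (\<lambda>a. g a + h a) = (\<lambda>a. series_mult f g a + series_mult f h a)"
  by (rule ext) (simp add: series_mult_def distrib_left sum.distrib case_prod_beta)

lemma series_mult_zero_coeff [simp]: "series_mult f g 0 = f 0 * g 0"
  by (simp add: series_mult_def)

lemma series_mult_const: "series_mult (const_series c) f = (\<lambda>a. c * f a)"
proof
  fix a
  have "series_mult (const_series c) f a = (\<Sum>p\<in>{(0, a)}. const_series c (fst p) * f (snd p))"
    unfolding series_mult_def case_prod_beta
    by (rule sum.mono_neutral_right) (auto simp: const_series_def)
  then show "series_mult (const_series c) f a = c * f a" by (simp add: const_series_def)
qed

text \<open>Multiplying by a series without constant term raises the order: the coefficient of the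
  product only depends on the coefficients of smaller degree.\<close>

lemma series_mult_cong_degree:
  assumes "B 0 = 0" and "\<And>b. mi_degree b < mi_degree a \<Longrightarrow> f b = g b"
  shows "series_mult f B a = series_mult g B a"
  unfolding series_mult_def
proof (rule sum.cong, simp, clarsimp)
  fix b c assume "a = b + c"
  then have "c = 0 \<or> mi_degree b < mi_degree a"
    by (auto simp: mi_degree_add mi_degree_eq_0_iff intro: neq0_conv[THEN iffD1])
  then show "f b * B c = g b * B c" using assms by auto
qed

lemma series_mult_eq_0_degree:
  assumes "\<And>b. mi_degree b \<le> mi_degree a \<Longrightarrow> f b = 0"
  shows "series_mult f g a = 0"
  unfolding series_mult_def
  by (rule sum.neutral) (use assms in \<open>auto simp: mi_degree_add\<close>)

text \<open>The variable \<open>x\<^sub>i\<close>.\<close>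

definition series_var :: "nat \<Rightarrow> 'k::zero_neq_one mseries" where
  "series_var i = (\<lambda>a. if a = mi_unit i then 1 else 0)"

lemma add_unit_minus: "Poly_Mapping.lookup a i > 0 \<Longrightarrow> (a - mi_unit i) + mi_unit i = a"
  by (rule poly_mapping_eqI) (auto simp: lookup_add lookup_minus lookup_mi_unit)

lemma series_mult_var:
  "series_mult (series_var i) f a = (if Poly_Mapping.lookup a i > 0 then f (a - mi_unit i) else 0)"
proof (cases "Poly_Mapping.lookup a i > 0")
  case True
  have "series_mult (series_var i) f a =
      (\<Sum>p\<in>{(mi_unit i, a - mi_unit i)}. series_var i (fst p) * f (snd p))"
    unfolding series_mult_def case_prod_beta
    using add_unit_minus[OF True]
    by (intro sum.mono_neutral_right) (auto simp: series_var_def add.commute)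
  then show ?thesis using True by (simp add: series_var_def)
next
  case False
  then show ?thesis
    by (auto simp: series_mult_def series_var_def lookup_add lookup_mi_unit intro!: sum.neutral)
qed

text \<open>The partial derivative with respect to \<open>x\<^sub>i\<close>.\<close>

definition series_deriv :: "nat \<Rightarrow> 'k::comm_semiring_1 mseries \<Rightarrow> 'k mseries" where
  "series_deriv i f = (\<lambda>a. of_nat (Suc (Poly_Mapping.lookup a i)) * f (a + mi_unit i))"

lemma series_deriv_add: "series_deriv i (\<lambda>a. f a + g a) = (\<lambda>a. series_deriv i f a + series_deriv i g a)"
  by (rule ext) (simp add: series_deriv_def distrib_left)

lemma series_deriv_mult:
  "series_deriv i (series_mult f g) =
    (\<lambda>a. series_mult (series_deriv i f) g a + series_mult f (series_deriv i g) a)"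
proof
  fix a
  let ?A = "antidiag (a + mi_unit i)"
  have *: "(\<Sum>(b, c)\<in>?A. of_nat (Poly_Mapping.lookup b i) * f b * g c) = series_mult (series_deriv i f) g a"
    for f g :: "'a mseries"
  proof -
    have "(\<Sum>(b, c)\<in>?A. of_nat (Poly_Mapping.lookup b i) * f b * g c) =
        (\<Sum>(b, c)\<in>{(b, c). b + c = a + mi_unit i \<and> Poly_Mapping.lookup b i > 0}.
          of_nat (Poly_Mapping.lookup b i) * f b * g c)"
      by (rule sum.mono_neutral_right) (auto intro!: Nat.gr0I)
    also have "\<dots> = (\<Sum>(b, c)\<in>antidiag a. series_deriv i f b * g c)"
    proof (rule sum.reindex_bij_witness[where
          i = "\<lambda>(b, c). (b + mi_unit i, c)" and j = "\<lambda>(b, c). (b - mi_unit i, c)"], goal_cases)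
      case (1 p)
      then show ?case using add_unit_minus by (auto split: prod.splits)
    next
      case (2 p)
      obtain b c where p: "p = (b, c)" by (cases p)
      from 2 have "(b - mi_unit i) + mi_unit i + c = a + mi_unit i"
        using add_unit_minus by (auto simp: p)
      then have "(b - mi_unit i) + c = a"
        by (metis (no_types, lifting) add.assoc add.commute add_right_cancel)
      then show ?case by (simp add: p)
    next
      case (3 p)
      then show ?case by auto
    next
      case (4 p)
      then show ?case by (auto simp: ac_simps lookup_add lookup_mi_unit)
    next
      case (5 p)
      obtain b c where p: "p = (b, c)" by (cases p)
      from 5 have pos: "Poly_Mapping.lookup b i > 0" by (auto simp: p)
      then show ?case
        using add_unit_minus[OF pos] by (simp add: p series_deriv_def lookup_minus lookup_mi_unit del: of_nat_add of_nat_Suc)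
    qed
    finally show ?thesis by (simp add: series_mult_def)
  qed
  have "series_deriv i (series_mult f g) a =
      (\<Sum>(b, c)\<in>?A. of_nat (Poly_Mapping.lookup (b + c) i) * (f b * g c))"
    unfolding series_deriv_def series_mult_def sum_distrib_left
  proof (rule sum.cong, simp, clarify)
    fix b c assume "b + c = a + mi_unit i"
    then have "Suc (Poly_Mapping.lookup a i) = Poly_Mapping.lookup (b + c) i"
      by (simp add: lookup_add lookup_mi_unit)
    then show "of_nat (Suc (Poly_Mapping.lookup a i)) * (f b * g c) =
        of_nat (Poly_Mapping.lookup (b + c) i) * (f b * g c)" by simp
  qed
  also have "\<dots> = (\<Sum>(b, c)\<in>?A. of_nat (Poly_Mapping.lookup b i) * f b * g c) +
      (\<Sum>(b, c)\<in>?A. of_nat (Poly_Mapping.lookup c i) * g c * f b)"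
    by (simp add: sum.distrib[symmetric] case_prod_beta lookup_add algebra_simps)
  also have "(\<Sum>(b, c)\<in>?A. of_nat (Poly_Mapping.lookup c i) * g c * f b) =
      (\<Sum>(b, c)\<in>?A. of_nat (Poly_Mapping.lookup b i) * g b * f c)"
    by (rule sum.reindex_bij_witness[where i = prod.swap and j = prod.swap]) (auto simp: add.commute)
  finally show "series_deriv i (series_mult f g) a =
      series_mult (series_deriv i f) g a + series_mult f (series_deriv i g) a"
    by (simp add: * series_mult_commute[of f])
qed

lemma series_deriv_commute: "series_deriv i (series_deriv j f) = series_deriv j (series_deriv i f)"
  by (rule ext) (simp add: series_deriv_def lookup_add lookup_mi_unit ac_simps)

lemma add_unit_neq_zero [simp]: "a + mi_unit i \<noteq> 0"
  by (metis mi_degree_add mi_degree_unit mi_degree_zero add_is_0 zero_neq_one)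

lemma series_deriv_const: "series_deriv i (const_series c) = (\<lambda>a. 0)"
  by (rule ext) (simp add: series_deriv_def const_series_def)

lemma series_deriv_var:
  "series_deriv i (series_var j) = (const_series (if i = j then 1 else 0) :: 'k::comm_semiring_1 mseries)"
proof
  fix a
  have "a + mi_unit i = mi_unit j \<longleftrightarrow> a = 0 \<and> i = j"
  proof
    assume *: "a + mi_unit i = mi_unit j"
    from arg_cong[OF this, of mi_degree] have "a = 0" by (simp add: mi_degree_add mi_degree_eq_0_iff)
    moreover from this * have "Poly_Mapping.lookup (mi_unit i) j = Poly_Mapping.lookup (mi_unit j) j" by simp
    ultimately show "a = 0 \<and> i = j" by (auto simp: lookup_mi_unit split: if_splits)
  qed simp
  then show "series_deriv i (series_var j) a = (const_series (if i = j then 1 else 0) :: 'k mseries) a"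
    by (auto simp: series_deriv_def series_var_def const_series_def)
qed

text \<open>Euler's formula \<open>\<Sum>\<^sub>i x\<^sub>i \<partial>\<^sub>i f = d f\<close> for homogeneous \<open>f\<close>, in terms of coefficients.\<close>

lemma series_euler:
  assumes "Poly_Mapping.keys a \<subseteq> {..<n}"
  shows "(\<Sum>i<n. series_mult (series_var i) (series_deriv i f) a) = of_nat (mi_degree a) * f a"
proof -
  have "series_mult (series_var i) (series_deriv i f) a = of_nat (Poly_Mapping.lookup a i) * f a" for i
    using add_unit_minus[of a i]
    by (auto simp: series_mult_var series_deriv_def lookup_minus lookup_mi_unit simp del: of_nat_add of_nat_Suc)
  then show ?thesis
    by (simp add: mi_degree_superset[OF _ assms] sum_distrib_right)
qed

text \<open>A decomposition \<open>f = f(0) + \<Sum>\<^sub>i x\<^sub>i f\<^sub>i\<close>: a monomial goes to \<open>f\<^sub>i\<close> if \<open>i\<close> is the first variable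
  in it.\<close>

definition series_tail :: "nat \<Rightarrow> 'k::zero mseries \<Rightarrow> 'k mseries" where
  "series_tail i f = (\<lambda>a. if Poly_Mapping.keys a \<subseteq> {i..} then f (a + mi_unit i) else 0)"

lemma series_decomp:
  assumes a: "Poly_Mapping.keys a \<subseteq> {..<n}"
  shows "f a = const_series (f 0) a + (\<Sum>i<n. series_mult (series_var i) (series_tail i f) a)"
proof (cases "a = 0")
  case True
  then show ?thesis by (simp add: const_series_def series_var_def)
next
  case False
  define m where "m = Min (Poly_Mapping.keys a)"
  have ne: "Poly_Mapping.keys a \<noteq> {}" using False by simp
  have m: "m \<in> Poly_Mapping.keys a" "\<And>i. i \<in> Poly_Mapping.keys a \<Longrightarrow> m \<le> i"
    using ne by (auto simp: m_def)
  have sub: "Poly_Mapping.keys (a - mi_unit i) \<subseteq> {i..} \<longleftrightarrow> i = m"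
    if "Poly_Mapping.lookup a i > 0" for i
  proof
    assume *: "Poly_Mapping.keys (a - mi_unit i) \<subseteq> {i..}"
    have "m \<le> i" using that m by (auto simp: in_keys_iff)
    moreover have "i \<le> m"
    proof (rule ccontr)
      assume "\<not> i \<le> m"
      then have "m \<in> Poly_Mapping.keys (a - mi_unit i)"
        using m(1) by (auto simp: in_keys_iff lookup_minus lookup_mi_unit)
      then show False using * \<open>\<not> i \<le> m\<close> by auto
    qed
    ultimately show "i = m" by simp
  next
    assume "i = m"
    then show "Poly_Mapping.keys (a - mi_unit i) \<subseteq> {i..}"
      using m(2) by (auto simp: in_keys_iff lookup_minus)
  qed
  have "series_mult (series_var i) (series_tail i f) a = (if i = m then f a else 0)" for i
    using sub[of i] m(1) add_unit_minus[of a i]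
    by (auto simp: series_mult_var series_tail_def in_keys_iff)
  then show ?thesis using False a m(1) by (auto simp: const_series_def)
qed

section \<open>Solving triangular systems of equations\<close>

text \<open>The system \<open>\<lambda>\<^sub>d v + v B = w\<close>, where \<open>B\<close> has no constant term and \<open>\<lambda>\<^sub>d\<close> scales the homogeneous
  part of degree \<open>d\<close>, is solved degree by degree.\<close>

definition solves_system ::
  "(nat \<Rightarrow> 'k::comm_semiring_1) \<Rightarrow> 'i set \<Rightarrow> ('i \<Rightarrow> 'i \<Rightarrow> 'k mseries) \<Rightarrow> ('i \<Rightarrow> 'k mseries) \<Rightarrow>
    ('i \<Rightarrow> 'k mseries) \<Rightarrow> bool" where
  "solves_system l I B w v \<longleftrightarrow>
    (\<forall>i\<in>I. \<forall>a. l (mi_degree a) * v i a + (\<Sum>j\<in>I. series_mult (v j) (B j i) a) = w i a)"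

text \<open>The iteration \<open>V\<close> fixes the coefficients of degree below \<open>d\<close> after \<open>d\<close> steps. The predicate \<open>P\<close>
  marks multi-indices where \<open>w\<close> and \<open>B\<close> vanish, for example those that involve a variable \<open>x\<^sub>i\<close> with
  \<open>i \<ge> n\<close>; the solution vanishes there too.\<close>

lemma solves_system_exists:
  fixes w :: "'i \<Rightarrow> 'k::field mseries"
  assumes B: "\<And>i j. i \<in> I \<Longrightarrow> j \<in> I \<Longrightarrow> B i j 0 = 0" and l: "\<And>d. l d \<noteq> 0"
    and van: "\<And>i a. i \<in> I \<Longrightarrow> P a \<Longrightarrow> w i a = 0"
      "\<And>i j a. i \<in> I \<Longrightarrow> j \<in> I \<Longrightarrow> P a \<Longrightarrow> B i j a = 0"
    and P: "\<And>a b. P (a + b) \<Longrightarrow> P a \<or> P b"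
  obtains v where "solves_system l I B w v" "\<And>i a. i \<in> I \<Longrightarrow> P a \<Longrightarrow> v i a = 0"
proof -
  define step where "step V = (\<lambda>i a. (w i a - (\<Sum>j\<in>I. series_mult (V j) (B j i) a)) / l (mi_degree a))" for V
  define V where "V d = (step ^^ d) (\<lambda>i a. 0)" for d
  have VS: "V (Suc d) = step (V d)" for d by (simp add: V_def)
  have stable: "V (Suc d) i a = V d i a" if "i \<in> I" "mi_degree a < d" for d i a
    using that
  proof (induction d arbitrary: i a)
    case (Suc d)
    have "series_mult (V (Suc d) j) (B j i) a = series_mult (V d j) (B j i) a" if "j \<in> I" for j
      by (rule series_mult_cong_degree) (use B Suc that in auto)
    then show ?case by (simp add: VS step_def)
  qed simp
  have stable': "V (d + k) i a = V d i a" if "i \<in> I" "mi_degree a < d" for d k i a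
    using that by (induction k) (auto simp: stable)
  define v where "v i a = V (Suc (mi_degree a)) i a" for i a
  have vV: "v i a = V d i a" if "i \<in> I" "mi_degree a < d" for i a d
    using stable'[of i a "Suc (mi_degree a)" "d - Suc (mi_degree a)"] that by (simp add: v_def)
  have "solves_system l I B w v"
    unfolding solves_system_def
  proof (intro ballI allI)
    fix i a assume i: "i \<in> I"
    have "series_mult (v j) (B j i) a = series_mult (V (mi_degree a) j) (B j i) a" if "j \<in> I" for j
      by (rule series_mult_cong_degree) (use B i that vV in auto)
    then have "v i a = (w i a - (\<Sum>j\<in>I. series_mult (v j) (B j i) a)) / l (mi_degree a)"
      by (simp add: v_def VS step_def)
    then show "l (mi_degree a) * v i a + (\<Sum>j\<in>I. series_mult (v j) (B j i) a) = w i a"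
      using l by simp
  qed
  moreover have "V d i a = 0" if "i \<in> I" "P a" for d i a
    using that
  proof (induction d arbitrary: i a)
    case (Suc d)
    have "series_mult (V d j) (B j i) a = 0" if "j \<in> I" for j
      unfolding series_mult_def using P Suc.IH[OF that] van(2)[OF that Suc.prems(1)] Suc.prems
      by (intro sum.neutral) fastforce
    then show ?case using Suc.prems van by (simp add: VS step_def)
  qed (simp add: V_def)
  ultimately show thesis by (intro that[of v]) (auto simp: v_def)
qed

lemma solves_system_zero:
  fixes v :: "'i \<Rightarrow> 'k::field mseries"
  assumes B: "\<And>i j. i \<in> I \<Longrightarrow> j \<in> I \<Longrightarrow> B i j 0 = 0" and l: "\<And>d. l d \<noteq> 0"
    and v: "solves_system l I B (\<lambda>i a. 0) v" and i: "i \<in> I"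
  shows "v i a = 0"
  using i
proof (induction "mi_degree a" arbitrary: i a rule: less_induct)
  case less
  have "series_mult (v j) (B j i) a = 0" if "j \<in> I" for j
  proof -
    have "series_mult (v j) (B j i) a = series_mult (\<lambda>a. 0) (B j i) a"
      by (rule series_mult_cong_degree) (use B less that in auto)
    then show ?thesis by (simp add: series_mult_def)
  qed
  moreover have "l (mi_degree a) * v i a + (\<Sum>j\<in>I. series_mult (v j) (B j i) a) = 0"
    using v less.prems by (simp add: solves_system_def)
  ultimately show ?case using l[of "mi_degree a"] by simp
qed

section \<open>Formal and convergent power series rings\<close>

lemma formal_series_ring_simps [simp]:
  "mult (formal_series_ring n) = series_mult"
  "one (formal_series_ring n) = const_series 1"
  "ring.zero (formal_series_ring n) = const_series 0"
  "add (formal_series_ring n) = (\<lambda>f g a. f a + g a)"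
  by (auto simp: formal_series_ring_def series_mult_def fun_eq_iff)

lemma convergent_series_ring_simps [simp]:
  "mult (convergent_series_ring \<iota> n) = series_mult"
  "one (convergent_series_ring \<iota> n) = const_series 1"
  "ring.zero (convergent_series_ring \<iota> n) = const_series 0"
  "add (convergent_series_ring \<iota> n) = (\<lambda>f g a. f a + g a)"
  by (simp_all add: convergent_series_ring_def)

lemma in_formal_iff:
  "f \<in> carrier (formal_series_ring n) \<longleftrightarrow> (\<forall>a. \<not> Poly_Mapping.keys a \<subseteq> {..<n} \<longrightarrow> f a = 0)"
  by (simp add: formal_series_ring_def)

lemma formal_const: "const_series c \<in> carrier (formal_series_ring n)"
  by (auto simp: in_formal_iff const_series_def)

lemma formal_var: "i < n \<Longrightarrow> series_var i \<in> carrier (formal_series_ring n)"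
  by (auto simp: in_formal_iff series_var_def)

lemma formal_add:
  "f \<in> carrier (formal_series_ring n) \<Longrightarrow> g \<in> carrier (formal_series_ring n) \<Longrightarrow>
    (\<lambda>a. f a + g a) \<in> carrier (formal_series_ring n)"
  by (auto simp: in_formal_iff)

lemma formal_mult:
  assumes "f \<in> carrier (formal_series_ring n)" "g \<in> carrier (formal_series_ring n)"
  shows "series_mult f g \<in> carrier (formal_series_ring n)"
  unfolding in_formal_iff
proof (intro allI impI)
  fix a :: "nat \<Rightarrow>\<^sub>0 nat" assume a: "\<not> Poly_Mapping.keys a \<subseteq> {..<n}"
  show "series_mult f g a = 0"
    unfolding series_mult_def
  proof (rule sum.neutral, clarify)
    fix b c assume "a = b + c"
    with a have "\<not> Poly_Mapping.keys b \<subseteq> {..<n} \<or> \<not> Poly_Mapping.keys c \<subseteq> {..<n}"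
      by (simp add: keys_add_nat)
    with assms show "f b * g c = 0" by (auto simp: in_formal_iff)
  qed
qed

lemma formal_deriv:
  "f \<in> carrier (formal_series_ring n) \<Longrightarrow> series_deriv i f \<in> carrier (formal_series_ring n)"
  by (auto simp: in_formal_iff series_deriv_def keys_add_nat)

lemma formal_tail:
  "f \<in> carrier (formal_series_ring n) \<Longrightarrow> series_tail i f \<in> carrier (formal_series_ring n)"
  by (auto simp: in_formal_iff series_tail_def keys_add_nat)

text \<open>The closure properties shared by the rings of formal and of convergent power series. The last
  one says that the formal solution of a triangular system with coefficients in the ring lies in
  the ring; for convergent series this is where estimates enter.\<close>

locale power_series_ring =
  fixes R :: "'k::field_char_0 mseries ring" (structure) and n :: nat
  assumes mult_eq: "mult R = series_mult"
    and one_eq: "one R = const_series 1"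
    and zero_eq: "ring.zero R = const_series 0"
    and add_eq: "add R = (\<lambda>f g a. f a + g a)"
    and carrier_formal: "carrier R \<subseteq> carrier (formal_series_ring n)"
    and const_closed [simp, intro]: "const_series c \<in> carrier R"
    and var_closed [simp, intro]: "i < n \<Longrightarrow> series_var i \<in> carrier R"
    and plus_closed: "f \<in> carrier R \<Longrightarrow> g \<in> carrier R \<Longrightarrow> (\<lambda>a. f a + g a) \<in> carrier R"
    and times_closed: "f \<in> carrier R \<Longrightarrow> g \<in> carrier R \<Longrightarrow> series_mult f g \<in> carrier R"
    and deriv_closed [simp, intro]: "f \<in> carrier R \<Longrightarrow> series_deriv i f \<in> carrier R"
    and tail_closed [simp, intro]: "f \<in> carrier R \<Longrightarrow> series_tail i f \<in> carrier R"
    and solution_closed: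
      "\<lbrakk>\<And>i. i < s \<Longrightarrow> w i \<in> carrier R;
        \<And>i j. i < s \<Longrightarrow> j < s \<Longrightarrow> B i j \<in> carrier R \<and> B i j 0 = 0;
        \<And>d. l d \<ge> 1;
        solves_system (\<lambda>d. of_nat (l d)) {..<s::nat} B w v;
        \<And>i. i < s \<Longrightarrow> v i \<in> carrier (formal_series_ring n); i < s\<rbrakk>
        \<Longrightarrow> v i \<in> carrier R"

theorem formal_power_series_ring: "power_series_ring (formal_series_ring n)  n"
  by unfold_locales (auto intro: formal_const formal_var formal_add formal_mult formal_deriv formal_tail)

text \<open>The majorant \<open>\<parallel>f\<parallel>\<^sub>r \<le> C\<close>, where \<open>\<parallel>f\<parallel>\<^sub>r = \<Sum>\<^sub>a |f\<^sub>a| r\<^sup>|\<^sup>a\<^sup>|\<close>, in terms of finite partial sums.\<close>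

definition series_bound :: "('k \<Rightarrow> complex) \<Rightarrow> 'k mseries \<Rightarrow> real \<Rightarrow> real \<Rightarrow> bool" where
  "series_bound \<iota> f r C \<longleftrightarrow> (\<forall>F. finite F \<longrightarrow> (\<Sum>a\<in>F. norm (\<iota> (f a)) * r ^ mi_degree a) \<le> C)"

lemma series_boundD: "series_bound \<iota> f r C \<Longrightarrow> finite F \<Longrightarrow> (\<Sum>a\<in>F. norm (\<iota> (f a)) * r ^ mi_degree a) \<le> C"
  by (simp add: series_bound_def)

lemma series_bound_nonneg: "series_bound \<iota> f r C \<Longrightarrow> 0 \<le> C"
  using series_boundD[of \<iota> f r C "{}"] by simp

lemma summable_iff_series_bound:
  assumes "r > 0"
  shows "(\<lambda>a. norm (\<iota> (f a)) * r ^ mi_degree a) summable_on UNIV \<longleftrightarrow> (\<exists>C. series_bound \<iota> f r C)"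
proof
  assume *: "(\<lambda>a. norm (\<iota> (f a)) * r ^ mi_degree a) summable_on UNIV"
  then show "\<exists>C. series_bound \<iota> f r C"
    unfolding series_bound_def using assms finite_sum_le_infsum[OF *]
    by (intro exI[of _ "infsum (\<lambda>a. norm (\<iota> (f a)) * r ^ mi_degree a) UNIV"]) auto
next
  assume "\<exists>C. series_bound \<iota> f r C"
  then obtain C where C: "series_bound \<iota> f r C" by blast
  show "(\<lambda>a. norm (\<iota> (f a)) * r ^ mi_degree a) summable_on UNIV"
    by (rule nonneg_bdd_above_summable_on)
      (use assms series_boundD[OF C] in \<open>auto intro!: bdd_aboveI2[where M = C]\<close>)
qed

lemma in_convergent_iff:
  "f \<in> carrier (convergent_series_ring \<iota> n) \<longleftrightarrow>
    f \<in> carrier (formal_series_ring n) \<and> (\<exists>r>0. \<exists>C. series_bound \<iota> f r C)"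
proof -
  have "(\<exists>r>0. (\<lambda>a. norm (\<iota> (f a)) * r ^ mi_degree a) summable_on UNIV) \<longleftrightarrow> (\<exists>r>0. \<exists>C. series_bound \<iota> f r C)"
    using summable_iff_series_bound[of _ \<iota> f] by blast
  then show ?thesis by (simp add: convergent_series_ring_def)
qed

lemma series_bound_mono:
  assumes "series_bound \<iota> f r C" "0 \<le> r'" "r' \<le> r" "C \<le> C'"
  shows "series_bound \<iota> f r' C'"
  unfolding series_bound_def
proof (intro allI impI)
  fix F :: "(nat \<Rightarrow>\<^sub>0 nat) set" assume "finite F"
  have "(\<Sum>a\<in>F. norm (\<iota> (f a)) * r' ^ mi_degree a) \<le> (\<Sum>a\<in>F. norm (\<iota> (f a)) * r ^ mi_degree a)"
    using assms by (intro sum_mono mult_left_mono power_mono) auto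
  also have "\<dots> \<le> C" by (rule series_boundD) fact+
  finally show "(\<Sum>a\<in>F. norm (\<iota> (f a)) * r' ^ mi_degree a) \<le> C'" using assms by simp
qed

lemma series_bound_finite_support:
  assumes "finite S" and "\<And>a. a \<notin> S \<Longrightarrow> \<iota> (f a) = 0" and "0 \<le> r"
  shows "series_bound \<iota> f r (\<Sum>a\<in>S. norm (\<iota> (f a)) * r ^ mi_degree a)"
  unfolding series_bound_def
proof (intro allI impI)
  fix F :: "(nat \<Rightarrow>\<^sub>0 nat) set" assume "finite F"
  have "(\<Sum>a\<in>F. norm (\<iota> (f a)) * r ^ mi_degree a) = (\<Sum>a\<in>F \<inter> S. norm (\<iota> (f a)) * r ^ mi_degree a)"
    by (rule sum.mono_neutral_right) (use assms \<open>finite F\<close> in auto)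
  also have "\<dots> \<le> (\<Sum>a\<in>S. norm (\<iota> (f a)) * r ^ mi_degree a)"
    by (rule sum_mono2) (use assms in auto)
  finally show "(\<Sum>a\<in>F. norm (\<iota> (f a)) * r ^ mi_degree a) \<le> (\<Sum>a\<in>S. norm (\<iota> (f a)) * r ^ mi_degree a)" .
qed

context
  fixes \<iota> :: "'k::field_char_0 \<Rightarrow> complex"
  assumes emb: "field_embedding \<iota>"
begin

lemma emb_add: "\<iota> (x + y) = \<iota> x + \<iota> y"
  and emb_mult: "\<iota> (x * y) = \<iota> x * \<iota> y"
  and emb_one: "\<iota> 1 = 1"
  using emb by (auto simp: field_embedding_def)

lemma emb_zero: "\<iota> 0 = 0"
  using emb_add[of 0 0] by simp

lemma emb_of_nat: "\<iota> (of_nat m) = of_nat m"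
  by (induction m) (auto simp: emb_zero emb_add emb_one)

lemma emb_sum: "\<iota> (sum g A) = (\<Sum>x\<in>A. \<iota> (g x))"
  by (induction A rule: infinite_finite_induct) (auto simp: emb_zero emb_add)

lemma emb_diff: "\<iota> (x - y) = \<iota> x - \<iota> y"
  using emb_add[of "x - y" y] by simp

lemma series_bound_add:
  assumes "series_bound \<iota> f r C" "series_bound \<iota> g r D" "0 \<le> r"
  shows "series_bound \<iota> (\<lambda>a. f a + g a) r (C + D)"
  unfolding series_bound_def
proof (intro allI impI)
  fix F :: "(nat \<Rightarrow>\<^sub>0 nat) set" assume F: "finite F"
  have "(\<Sum>a\<in>F. norm (\<iota> (f a + g a)) * r ^ mi_degree a) \<le>
      (\<Sum>a\<in>F. norm (\<iota> (f a)) * r ^ mi_degree a + norm (\<iota> (g a)) * r ^ mi_degree a)"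
    using assms(3) by (intro sum_mono) (auto simp: emb_add distrib_right[symmetric] intro!: mult_right_mono norm_triangle_ineq)
  also have "\<dots> \<le> C + D"
    using series_boundD[OF assms(1) F] series_boundD[OF assms(2) F] by (simp add: sum.distrib)
  finally show "(\<Sum>a\<in>F. norm (\<iota> (f a + g a)) * r ^ mi_degree a) \<le> C + D" .
qed

text \<open>The finite form of \<open>\<parallel>f g\<parallel>\<^sub>r \<le> \<parallel>f\<parallel>\<^sub>r \<parallel>g\<parallel>\<^sub>r\<close>: only coefficients of \<open>f\<close> below those in \<open>F\<close> enter.\<close>

lemma series_mult_partial_bound:
  assumes F: "finite F" and D: "finite D" "\<And>b c. b + c \<in> F \<Longrightarrow> b \<in> D"
    and g: "series_bound \<iota> g r C" and r: "0 \<le> r"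
  shows "(\<Sum>a\<in>F. norm (\<iota> (series_mult f g a)) * r ^ mi_degree a) \<le>
    (\<Sum>b\<in>D. norm (\<iota> (f b)) * r ^ mi_degree b) * C"
proof -
  define \<phi> where "\<phi> b = norm (\<iota> (f b)) * r ^ mi_degree b" for b
  define \<gamma> where "\<gamma> c = norm (\<iota> (g c)) * r ^ mi_degree c" for c
  define E where "E = {c. \<exists>b. b + c \<in> F}"
  have "E = (\<Union>a\<in>F. {c. \<exists>b. c + b = a})" by (auto simp: E_def add.commute)
  then have E: "finite E" using F finite_mi_below by simp
  have nn: "\<phi> b \<ge> 0" "\<gamma> b \<ge> 0" for b using r by (auto simp: \<phi>_def \<gamma>_def)
  have "norm (\<iota> (series_mult f g a)) * r ^ mi_degree a \<le> (\<Sum>p\<in>antidiag a. \<phi> (fst p) * \<gamma> (snd p))" for a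
  proof -
    have "norm (\<iota> (series_mult f g a)) \<le> (\<Sum>p\<in>antidiag a. norm (\<iota> (f (fst p))) * norm (\<iota> (g (snd p))))"
      unfolding series_mult_def emb_sum case_prod_unfold emb_mult
      by (rule order_trans[OF norm_sum]) (simp add: norm_mult)
    then have "norm (\<iota> (series_mult f g a)) * r ^ mi_degree a \<le>
        (\<Sum>p\<in>antidiag a. norm (\<iota> (f (fst p))) * norm (\<iota> (g (snd p)))) * r ^ mi_degree a"
      using r by (intro mult_right_mono) auto
    also have "\<dots> = (\<Sum>p\<in>antidiag a. \<phi> (fst p) * \<gamma> (snd p))"
      unfolding sum_distrib_right
      by (rule sum.cong) (auto simp: \<phi>_def \<gamma>_def mi_degree_add power_add ac_simps)
    finally show ?thesis .
  qed
  then have "(\<Sum>a\<in>F. norm (\<iota> (series_mult f g a)) * r ^ mi_degree a) \<le>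
      (\<Sum>a\<in>F. \<Sum>p\<in>antidiag a. \<phi> (fst p) * \<gamma> (snd p))"
    by (rule sum_mono)
  also have "\<dots> = (\<Sum>q\<in>(SIGMA a:F. antidiag a). \<phi> (fst (snd q)) * \<gamma> (snd (snd q)))"
    by (subst sum.Sigma) (use F in \<open>auto simp: case_prod_unfold\<close>)
  also have "\<dots> = (\<Sum>p\<in>snd ` (SIGMA a:F. antidiag a). \<phi> (fst p) * \<gamma> (snd p))"
    by (subst sum.reindex) (auto simp: inj_on_def)
  also have "\<dots> \<le> (\<Sum>p\<in>D \<times> E. \<phi> (fst p) * \<gamma> (snd p))"
    by (rule sum_mono2) (use D E nn in \<open>auto simp: E_def\<close>)
  also have "\<dots> = (\<Sum>b\<in>D. \<phi> b) * (\<Sum>c\<in>E. \<gamma> c)"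
    by (simp add: sum_product sum.cartesian_product case_prod_unfold)
  also have "\<dots> \<le> (\<Sum>b\<in>D. \<phi> b) * C"
    using series_boundD[OF g E] nn by (intro mult_left_mono) (auto simp: \<gamma>_def intro: sum_nonneg)
  finally show ?thesis by (simp add: \<phi>_def)
qed

lemma series_bound_mult:
  assumes f: "series_bound \<iota> f r C" and g: "series_bound \<iota> g r D" and r: "0 \<le> r"
  shows "series_bound \<iota> (series_mult f g) r (C * D)"
  unfolding series_bound_def
proof (intro allI impI)
  fix F :: "(nat \<Rightarrow>\<^sub>0 nat) set" assume F: "finite F"
  define B where "B = {b. \<exists>c. b + c \<in> F}"
  have "B = (\<Union>a\<in>F. {b. \<exists>c. b + c = a})" by (auto simp: B_def)
  then have B: "finite B" using F finite_mi_below by simp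
  have "(\<Sum>a\<in>F. norm (\<iota> (series_mult f g a)) * r ^ mi_degree a) \<le>
      (\<Sum>b\<in>B. norm (\<iota> (f b)) * r ^ mi_degree b) * D"
    by (rule series_mult_partial_bound) (use F B g r in \<open>auto simp: B_def\<close>)
  also have "\<dots> \<le> C * D"
    using series_boundD[OF f B] series_bound_nonneg[OF g] by (rule mult_right_mono)
  finally show "(\<Sum>a\<in>F. norm (\<iota> (series_mult f g a)) * r ^ mi_degree a) \<le> C * D" .
qed

text \<open>Both the derivative and the parts \<open>f\<^sub>i\<close> of a series are dominated by a shift of it.\<close>

lemma series_bound_shift:
  assumes f: "series_bound \<iota> f r C" and r: "0 < r"
    and g: "\<And>a. norm (\<iota> (g a)) \<le> real (Suc (mi_degree a)) * norm (\<iota> (f (a + mi_unit i)))"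
  shows "series_bound \<iota> g (r / 2) (C / r)"
  unfolding series_bound_def
proof (intro allI impI)
  fix F :: "(nat \<Rightarrow>\<^sub>0 nat) set" assume F: "finite F"
  have "(\<Sum>a\<in>F. norm (\<iota> (g a)) * (r / 2) ^ mi_degree a) \<le>
      (\<Sum>a\<in>F. norm (\<iota> (f (a + mi_unit i))) * r ^ mi_degree (a + mi_unit i) / r)"
  proof (rule sum_mono)
    fix a
    let ?d = "mi_degree a"
    have "real (Suc ?d) \<le> 2 ^ ?d" by (metis Suc_leI less_exp of_nat_le_iff of_nat_numeral of_nat_power)
    then have "real (Suc ?d) * r ^ ?d \<le> 2 ^ ?d * r ^ ?d"
      using r by (intro mult_right_mono) auto
    then have *: "real (Suc ?d) * (r / 2) ^ ?d \<le> r ^ ?d"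
      by (simp add: power_divide divide_le_eq mult.commute del: of_nat_Suc)
    have "norm (\<iota> (g a)) * (r / 2) ^ ?d \<le>
        (real (Suc ?d) * norm (\<iota> (f (a + mi_unit i)))) * (r / 2) ^ ?d"
      using g r by (intro mult_right_mono) auto
    also have "\<dots> = norm (\<iota> (f (a + mi_unit i))) * (real (Suc ?d) * (r / 2) ^ ?d)"
      by simp
    also have "\<dots> \<le> norm (\<iota> (f (a + mi_unit i))) * r ^ ?d"
      using * by (intro mult_left_mono) auto
    finally show "norm (\<iota> (g a)) * (r / 2) ^ ?d \<le>
        norm (\<iota> (f (a + mi_unit i))) * r ^ mi_degree (a + mi_unit i) / r"
      using r by (simp add: mi_degree_add)
  qed
  also have "\<dots> = (\<Sum>a\<in>(\<lambda>a. a + mi_unit i) ` F. norm (\<iota> (f a)) * r ^ mi_degree a) / r"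
    by (subst sum.reindex) (auto simp: sum_divide_distrib inj_on_def)
  also have "\<dots> \<le> C / r"
    using series_boundD[OF f, of "(\<lambda>a. a + mi_unit i) ` F"] F r by (intro divide_right_mono) auto
  finally show "(\<Sum>a\<in>F. norm (\<iota> (g a)) * (r / 2) ^ mi_degree a) \<le> C / r" .
qed

lemma lookup_le_mi_degree: "Poly_Mapping.lookup a i \<le> mi_degree a"
  by (cases "i \<in> Poly_Mapping.keys a") (auto simp: mi_degree_def in_keys_iff intro: member_le_sum)

lemma series_bound_deriv:
  assumes "series_bound \<iota> f r C" "0 < r"
  shows "series_bound \<iota> (series_deriv i f) (r / 2) (C / r)"
proof (rule series_bound_shift[OF assms])
  fix a
  show "norm (\<iota> (series_deriv i f a)) \<le> real (Suc (mi_degree a)) * norm (\<iota> (f (a + mi_unit i)))"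
    using lookup_le_mi_degree[of a i]
    unfolding series_deriv_def emb_mult emb_of_nat norm_mult norm_of_nat
    by (intro mult_right_mono) auto
qed

lemma series_bound_tail:
  assumes "series_bound \<iota> f r C" "0 < r"
  shows "series_bound \<iota> (series_tail i f) (r / 2) (C / r)"
proof (rule series_bound_shift[OF assms])
  fix a
  have "1 * norm (\<iota> (f (a + mi_unit i))) \<le> real (Suc (mi_degree a)) * norm (\<iota> (f (a + mi_unit i)))"
    by (intro mult_right_mono) auto
  then show "norm (\<iota> (series_tail i f a)) \<le> real (Suc (mi_degree a)) * norm (\<iota> (f (a + mi_unit i)))"
    by (auto simp: series_tail_def emb_zero)
qed

text \<open>A series without constant term becomes small on small polydiscs.\<close>

lemma series_bound_shrink:
  assumes f: "series_bound \<iota> f r C" and r: "0 \<le> r" and f0: "f 0 = 0" and t: "0 \<le> t" "t \<le> 1"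
  shows "series_bound \<iota> f (t * r) (t * C)"
  unfolding series_bound_def
proof (intro allI impI)
  fix F :: "(nat \<Rightarrow>\<^sub>0 nat) set" assume F: "finite F"
  have "(\<Sum>a\<in>F. norm (\<iota> (f a)) * (t * r) ^ mi_degree a) \<le>
      (\<Sum>a\<in>F. t * (norm (\<iota> (f a)) * r ^ mi_degree a))"
  proof (rule sum_mono)
    fix a
    show "norm (\<iota> (f a)) * (t * r) ^ mi_degree a \<le> t * (norm (\<iota> (f a)) * r ^ mi_degree a)"
    proof (cases "a = 0")
      case False
      then obtain d where d: "mi_degree a = Suc d"
        by (metis mi_degree_eq_0_iff not0_implies_Suc)
      have "t ^ mi_degree a \<le> t"
        using t by (simp add: d power_le_one mult_left_le)
      then have "t ^ mi_degree a * (norm (\<iota> (f a)) * r ^ mi_degree a) \<le>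
          t * (norm (\<iota> (f a)) * r ^ mi_degree a)"
        using r by (intro mult_right_mono) auto
      then show ?thesis by (simp add: power_mult_distrib ac_simps)
    qed (simp add: f0 emb_zero)
  qed
  also have "\<dots> \<le> t * C"
    unfolding sum_distrib_left[symmetric] using series_boundD[OF f F] t by (intro mult_left_mono)
  finally show "(\<Sum>a\<in>F. norm (\<iota> (f a)) * (t * r) ^ mi_degree a) \<le> t * C" .
qed

text \<open>The solution of a triangular system satisfies \<open>\<parallel>v\<parallel> \<le> \<parallel>w\<parallel> + \<parallel>v\<parallel> / 2\<close> on a polydisc so small
  that the coefficients \<open>B\<close> have norm at most \<open>1 / (2 s)\<close>; with partial sums over sets closed under
  taking smaller multi-indices the norms are finite and the inequality can be solved for \<open>\<parallel>v\<parallel>\<close>.\<close>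

lemma solves_system_bound:
  fixes s :: nat
  assumes w: "\<And>i. i < s \<Longrightarrow> series_bound \<iota> (w i) r C"
    and B: "\<And>i j. i < s \<Longrightarrow> j < s \<Longrightarrow> series_bound \<iota> (B i j) r (1 / (2 * real s))"
    and l: "\<And>d. l d \<ge> (1::nat)"
    and v: "solves_system (\<lambda>d. of_nat (l d)) {..<s} B w v"
    and r: "0 \<le> r" and i: "i < s"
  shows "series_bound \<iota> (v i) r (2 * (real s * C))"
  unfolding series_bound_def
proof (intro allI impI)
  fix F :: "(nat \<Rightarrow>\<^sub>0 nat) set" assume F: "finite F"
  define D where "D = {b. \<exists>c. b + c \<in> F}"
  have "D = (\<Union>a\<in>F. {b. \<exists>c. b + c = a})" by (auto simp: D_def)
  then have D: "finite D" using F finite_mi_below by simp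
  have FD: "F \<subseteq> D" unfolding D_def by clarsimp (metis add_0_right)
  have Dsub: "b \<in> D" if "b + c \<in> D" for b c
    using that by (auto simp: D_def add.assoc)
  define V where "V i = (\<Sum>a\<in>D. norm (\<iota> (v i a)) * r ^ mi_degree a)" for i
  have V0: "V i \<ge> 0" for i unfolding V_def using r by (intro sum_nonneg) auto
  have "norm (\<iota> (v i a)) \<le> norm (\<iota> (w i a)) + (\<Sum>j<s. norm (\<iota> (series_mult (v j) (B j i) a)))"
    if "i < s" for i a
  proof -
    have "of_nat (l (mi_degree a)) * v i a = w i a - (\<Sum>j<s. series_mult (v j) (B j i) a)"
      using v that unfolding solves_system_def by (simp add: eq_diff_eq)
    then have "of_nat (l (mi_degree a)) * \<iota> (v i a) = \<iota> (w i a) - (\<Sum>j<s. \<iota> (series_mult (v j) (B j i) a))"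
      by (metis emb_mult emb_of_nat emb_diff emb_sum)
    then have "real (l (mi_degree a)) * norm (\<iota> (v i a)) =
        norm (\<iota> (w i a) - (\<Sum>j<s. \<iota> (series_mult (v j) (B j i) a)))"
      by (metis norm_mult norm_of_nat)
    also have "\<dots> \<le> norm (\<iota> (w i a)) + (\<Sum>j<s. norm (\<iota> (series_mult (v j) (B j i) a)))"
      by (rule order_trans[OF norm_triangle_ineq4]) (simp add: norm_sum)
    finally have "real (l (mi_degree a)) * norm (\<iota> (v i a)) \<le>
        norm (\<iota> (w i a)) + (\<Sum>j<s. norm (\<iota> (series_mult (v j) (B j i) a)))" .
    moreover have "1 * norm (\<iota> (v i a)) \<le> real (l (mi_degree a)) * norm (\<iota> (v i a))"
      using l[of "mi_degree a"] by (intro mult_right_mono) auto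
    ultimately show ?thesis by linarith
  qed note step = this
  have VW: "V i \<le> C + (\<Sum>j<s. V j * (1 / (2 * real s)))" if i: "i < s" for i
  proof -
    have "V i \<le> (\<Sum>a\<in>D. norm (\<iota> (w i a)) * r ^ mi_degree a +
        (\<Sum>j<s. norm (\<iota> (series_mult (v j) (B j i) a)) * r ^ mi_degree a))"
      unfolding V_def
    proof (rule sum_mono)
      fix a
      have "norm (\<iota> (v i a)) * r ^ mi_degree a \<le>
          (norm (\<iota> (w i a)) + (\<Sum>j<s. norm (\<iota> (series_mult (v j) (B j i) a)))) * r ^ mi_degree a"
        using step[OF i] r by (intro mult_right_mono) auto
      then show "norm (\<iota> (v i a)) * r ^ mi_degree a \<le> norm (\<iota> (w i a)) * r ^ mi_degree a +
          (\<Sum>j<s. norm (\<iota> (series_mult (v j) (B j i) a)) * r ^ mi_degree a)"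
        by (simp add: distrib_right sum_distrib_right)
    qed
    also have "\<dots> = (\<Sum>a\<in>D. norm (\<iota> (w i a)) * r ^ mi_degree a) +
        (\<Sum>j<s. \<Sum>a\<in>D. norm (\<iota> (series_mult (v j) (B j i) a)) * r ^ mi_degree a)"
      by (simp add: sum.distrib) (rule sum.swap)
    also have "\<dots> \<le> C + (\<Sum>j<s. V j * (1 / (2 * real s)))"
      unfolding V_def using w[OF i] B i r D Dsub
      by (intro add_mono sum_mono series_boundD series_mult_partial_bound) auto
    finally show ?thesis .
  qed
  have "(\<Sum>i<s. V i) \<le> (\<Sum>i<s. C + (\<Sum>j<s. V j * (1 / (2 * real s))))"
    using VW by (intro sum_mono) auto
  also have "\<dots> = real s * C + (\<Sum>j<s. V j) / 2"
    using i by (simp add: sum_divide_distrib[symmetric] distrib_left)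
  finally have "(\<Sum>i<s. V i) \<le> 2 * (real s * C)" by simp
  moreover have "V i \<le> (\<Sum>i<s. V i)" using i V0 by (intro member_le_sum) auto
  moreover have "(\<Sum>a\<in>F. norm (\<iota> (v i a)) * r ^ mi_degree a) \<le> V i"
    unfolding V_def by (rule sum_mono2) (use D FD r in auto)
  ultimately show "(\<Sum>a\<in>F. norm (\<iota> (v i a)) * r ^ mi_degree a) \<le> 2 * (real s * C)" by linarith
qed

text \<open>Finitely many convergent series converge on a common polydisc.\<close>

lemma common_series_bound:
  assumes "finite A" "\<And>f. f \<in> A \<Longrightarrow> \<exists>r>0. \<exists>C. series_bound \<iota> f r C"
  shows "\<exists>r>0. \<exists>C>0. \<forall>f\<in>A. series_bound \<iota> f r C"
  using assms
proof (induction A)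
  case empty
  then show ?case by (auto intro: exI[of _ 1])
next
  case (insert f A)
  then obtain r C where 1: "r > 0" "C > 0" "\<forall>g\<in>A. series_bound \<iota> g r C" by auto
  obtain r' C' where 2: "r' > 0" "series_bound \<iota> f r' C'" using insert.prems[of f] by blast
  have "\<forall>g\<in>insert f A. series_bound \<iota> g (min r r') (max C C')"
    using 1 2 by (auto intro: series_bound_mono)
  then show ?case using 1 2 by (intro exI[of _ "min r r'"] conjI exI[of _ "max C C'"]) auto
qed

lemma solution_convergent:
  fixes s :: nat
  assumes w: "\<And>i. i < s \<Longrightarrow> w i \<in> carrier (convergent_series_ring \<iota> n)"
    and B: "\<And>i j. i < s \<Longrightarrow> j < s \<Longrightarrow> B i j \<in> carrier (convergent_series_ring \<iota> n) \<and> B i j 0 = 0"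
    and l: "\<And>d. l d \<ge> (1::nat)"
    and v: "solves_system (\<lambda>d. of_nat (l d)) {..<s} B w v"
    and vf: "\<And>i. i < s \<Longrightarrow> v i \<in> carrier (formal_series_ring n)" and i: "i < s"
  shows "v i \<in> carrier (convergent_series_ring \<iota> n)"
proof -
  let ?A = "w ` {..<s} \<union> (\<Union>i<s. B i ` {..<s})"
  have "\<exists>r>0. \<exists>C>0. \<forall>f\<in>?A. series_bound \<iota> f r C"
    by (rule common_series_bound) (use w B in \<open>auto simp: in_convergent_iff\<close>)
  then obtain r C where r: "r > 0" "C > 0" and bd: "\<forall>f\<in>?A. series_bound \<iota> f r C" by blast
  have s: "real s > 0" using i by simp
  define t where "t = min 1 (1 / (2 * real s) / C)"
  have t: "0 < t" "t \<le> 1" "t * C \<le> 1 / (2 * real s)"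
    using r s by (auto simp: t_def min_def field_simps)
  have w': "series_bound \<iota> (w i) (t * r) C" if "i < s" for i
  proof (rule series_bound_mono)
    show "series_bound \<iota> (w i) r C" using that bd by blast
  qed (use r t in \<open>auto simp: mult_left_le_one_le\<close>)
  have B': "series_bound \<iota> (B i j) (t * r) (1 / (2 * real s))" if "i < s" "j < s" for i j
  proof -
    have "series_bound \<iota> (B i j) r C" using bd that by blast
    then have "series_bound \<iota> (B i j) (t * r) (t * C)"
      by (rule series_bound_shrink) (use B[OF that] r t in simp_all)
    then show ?thesis by (rule series_bound_mono) (use r t in simp_all)
  qed
  have "series_bound \<iota> (v i) (t * r) (2 * (real s * C))"
    by (rule solves_system_bound[OF w' B' l v _ i]) (use r t in auto)
  moreover have "t * r > 0" using r t by simp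
  ultimately show ?thesis unfolding in_convergent_iff using vf[OF i] by blast
qed

theorem convergent_power_series_ring: "power_series_ring (convergent_series_ring \<iota> n) n"
proof unfold_locales
  fix f g assume f: "f \<in> carrier (convergent_series_ring \<iota> n)" and g: "g \<in> carrier (convergent_series_ring \<iota> n)"
  have "\<exists>r>0. \<exists>C>0. \<forall>h\<in>{f, g}. series_bound \<iota> h r C"
    by (rule common_series_bound) (use f g in \<open>auto simp: in_convergent_iff\<close>)
  then obtain r C where r: "r > 0" and bd: "series_bound \<iota> f r C" "series_bound \<iota> g r C" by auto
  show "(\<lambda>a. f a + g a) \<in> carrier (convergent_series_ring \<iota> n)"
    using f g r series_bound_add[OF bd] by (auto simp: in_convergent_iff formal_add)
  show "series_mult f g \<in> carrier (convergent_series_ring \<iota> n)"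
    using f g r series_bound_mult[OF bd] by (auto simp: in_convergent_iff formal_mult)
next
  fix f i assume f: "f \<in> carrier (convergent_series_ring \<iota> n)"
  then obtain r C where r: "r > 0" and bd: "series_bound \<iota> f r C" by (auto simp: in_convergent_iff)
  show "series_deriv i f \<in> carrier (convergent_series_ring \<iota> n)"
    using f r series_bound_deriv[OF bd r] half_gt_zero[OF r] unfolding in_convergent_iff by (blast intro: formal_deriv)
  show "series_tail i f \<in> carrier (convergent_series_ring \<iota> n)"
    using f r series_bound_tail[OF bd r] half_gt_zero[OF r] unfolding in_convergent_iff by (blast intro: formal_tail)
next
  fix c :: 'k
  have "series_bound \<iota> (const_series c) 1 (\<Sum>a\<in>{0}. norm (\<iota> (const_series c a)) * 1 ^ mi_degree a)"
    by (rule series_bound_finite_support) (auto simp: const_series_def emb_zero)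
  then show "const_series c \<in> carrier (convergent_series_ring \<iota> n)"
    unfolding in_convergent_iff using formal_const zero_less_one by blast
next
  fix i assume "i < n"
  have "series_bound \<iota> (series_var i) 1 (\<Sum>a\<in>{mi_unit i}. norm (\<iota> (series_var i a)) * 1 ^ mi_degree a)"
    by (rule series_bound_finite_support) (auto simp: series_var_def emb_zero)
  then show "series_var i \<in> carrier (convergent_series_ring \<iota> n)"
    unfolding in_convergent_iff using formal_var[OF \<open>i < n\<close>] zero_less_one by blast
next
  fix s :: nat and w B and l :: "nat \<Rightarrow> nat" and v i
  assume "\<And>i. i < s \<Longrightarrow> w i \<in> carrier (convergent_series_ring \<iota> n)"
    "\<And>i j. i < s \<Longrightarrow> j < s \<Longrightarrow> B i j \<in> carrier (convergent_series_ring \<iota> n) \<and> B i j 0 = 0"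
    "\<And>d. 1 \<le> l d" "solves_system (\<lambda>d. of_nat (l d)) {..<s} B w v"
    "\<And>i. i < s \<Longrightarrow> v i \<in> carrier (formal_series_ring n)" "i < s"
  then show "v i \<in> carrier (convergent_series_ring \<iota> n)" by (rule solution_convergent)
qed (auto simp: convergent_series_ring_def)

end

section \<open>The local ring of power series and its derivations\<close>

lemma const_coeff: "const_series c a = (if a = 0 then c else 0)"
  by (simp add: const_series_def)

context power_series_ring
begin

lemma coeff_outside: "f \<in> carrier R \<Longrightarrow> \<not> Poly_Mapping.keys a \<subseteq> {..<n} \<Longrightarrow> f a = 0"
  using carrier_formal in_formal_iff by blast

lemma plus_coeff [simp]: "(f \<oplus> g) a = f a + g a"
  by (simp add: add_eq)

lemma zero_coeff [simp]: "\<zero> a = 0"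
  by (simp add: zero_eq const_series_def)

lemma one_coeff: "\<one> a = (if a = 0 then 1 else 0)"
  by (simp add: one_eq const_series_def)

lemma cring: "cring R"
proof (rule cringI)
  show "abelian_group R"
  proof (rule abelian_groupI)
    fix f assume f: "f \<in> carrier R"
    have "series_mult (const_series (- 1)) f \<in> carrier R" using f by (intro times_closed) auto
    moreover have "series_mult (const_series (- 1)) f \<oplus> f = \<zero>"
      by (rule ext) (simp add: series_mult_const)
    ultimately show "\<exists>g\<in>carrier R. g \<oplus> f = \<zero>" by blast
  next
    show "\<zero> \<in> carrier R" unfolding zero_eq by (rule const_closed)
  qed (auto simp: add_eq plus_closed ac_simps)
  show "Group.comm_monoid R"
    by (rule comm_monoidI)
      (simp_all add: mult_eq one_eq times_closed series_mult_assoc series_mult_const,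
        rule series_mult_commute)
  show "(f \<oplus> g) \<otimes> h = f \<otimes> h \<oplus> g \<otimes> h" for f g h
    unfolding mult_eq add_eq by (simp add: series_mult_commute[of _ h] series_mult_distrib_left)
qed

sublocale cring R by (rule cring)

lemma const_mult_coeff [simp]: "(const_series c \<otimes> f) a = c * f a"
  by (simp add: mult_eq series_mult_const)

lemma mult_coeff_0 [simp]: "(f \<otimes> g) 0 = f 0 * g 0"
  by (simp add: mult_eq)

lemma minus_coeff [simp]: "f \<in> carrier R \<Longrightarrow> (\<ominus> f) a = - f a"
  using fun_cong[OF l_neg[of f], of a] by (simp add: eq_neg_iff_add_eq_0)

lemma diff_coeff [simp]: "g \<in> carrier R \<Longrightarrow> (f \<ominus> g) a = f a - g a"
  by (simp add: a_minus_def)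

lemma finsum_coeff:
  assumes "finite A" "F \<in> A \<rightarrow> carrier R"
  shows "(\<Oplus>i\<in>A. F i) a = (\<Sum>i\<in>A. F i a)"
  using assms by (induction A) (auto simp: finsum_insert Pi_iff)

lemma const_add: "const_series b \<oplus> const_series c = const_series (b + c)"
  by (rule ext) (simp add: const_series_def)

lemma const_mult: "const_series b \<otimes> const_series c = const_series (b * c)"
  by (rule ext) (simp add: const_coeff)

lemma const_minus: "\<ominus> const_series c = const_series (- c)"
  by (rule ext) (simp, simp add: const_coeff)

text \<open>Enumerating the index set, systems indexed by any finite set can be solved in \<open>R\<close>.\<close>

lemma solve_system:
  assumes I: "finite I" and w: "w \<in> I \<rightarrow> carrier R"
    and B: "\<And>i j. i \<in> I \<Longrightarrow> j \<in> I \<Longrightarrow> B i j \<in> carrier R \<and> B i j 0 = 0"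
    and l: "\<And>d. l d \<ge> (1::nat)"
  obtains v where "v \<in> I \<rightarrow> carrier R" "solves_system (\<lambda>d. of_nat (l d)) I B w v"
proof -
  have l0: "of_nat (l d) \<noteq> (0::'k)" for d using l[of d] unfolding of_nat_eq_0_iff by linarith
  obtain v where v: "solves_system (\<lambda>d. of_nat (l d)) I B w v"
      and van: "\<And>i a. i \<in> I \<Longrightarrow> \<not> Poly_Mapping.keys a \<subseteq> {..<n} \<Longrightarrow> v i a = 0"
    by (rule solves_system_exists[of I B "\<lambda>d. of_nat (l d)" "\<lambda>a. \<not> Poly_Mapping.keys a \<subseteq> {..<n}" w])
      (use w B l0 coeff_outside in \<open>auto simp: keys_add_nat Pi_iff\<close>)
  obtain h where h: "bij_betw h {..<card I} I"
    using ex_bij_betw_nat_finite[OF I] by (metis atLeast0LessThan)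
  have hI: "h i \<in> I" if "i < card I" for i using h that by (auto simp: bij_betw_def)
  have v': "solves_system (\<lambda>d. of_nat (l d)) {..<card I} (\<lambda>i j. B (h i) (h j)) (\<lambda>i. w (h i)) (\<lambda>i. v (h i))"
    unfolding solves_system_def
  proof (intro ballI allI)
    fix i a assume i: "i \<in> {..<card I}"
    have "(\<Sum>j<card I. series_mult (v (h j)) (B (h j) (h i)) a) = (\<Sum>j\<in>I. series_mult (v j) (B j (h i)) a)"
      by (rule sum.reindex_bij_betw[OF h])
    then show "of_nat (l (mi_degree a)) * v (h i) a +
        (\<Sum>j<card I. series_mult (v (h j)) (B (h j) (h i)) a) = w (h i) a"
      using v hI i by (simp add: solves_system_def)
  qed
  have "v (h i) \<in> carrier R" if "i < card I" for i
  proof (rule solution_closed[OF _ _ l v' _ that])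
    fix i assume "i < card I"
    then show "w (h i) \<in> carrier R" "v (h i) \<in> carrier (formal_series_ring n)"
      using w hI van by (auto simp: in_formal_iff)
  next
    fix i j assume "i < card I" "j < card I"
    then show "B (h i) (h j) \<in> carrier R \<and> B (h i) (h j) 0 = 0" using B hI by blast
  qed
  then have "v i \<in> carrier R" if "i \<in> I" for i
    using bij_betw_imp_surj_on[OF h] that by (metis imageE lessThan_iff)
  then have "v \<in> I \<rightarrow> carrier R" by blast
  then show thesis using v that by blast
qed

text \<open>If \<open>c f(0) = 1\<close>, the inverse of \<open>f\<close> solves \<open>v + v (c f - 1) = c\<close>, a system with one unknown.\<close>

lemma inverse_exists:
  assumes f: "f \<in> carrier R" and f0: "f 0 \<noteq> 0"
  obtains g where "g \<in> carrier R" "f \<otimes> g = \<one>"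
proof -
  define c where "c = inverse (f 0)"
  define B where "B = const_series c \<otimes> f \<oplus> const_series (- 1)"
  have B: "B \<in> carrier R" "B 0 = 0" using f f0 by (auto simp: B_def c_def const_coeff)
  obtain v where v: "v \<in> {()} \<rightarrow> carrier R"
      "solves_system (\<lambda>d. of_nat 1) {()} (\<lambda>_ _. B) (\<lambda>_. const_series c) v"
    using B by (rule_tac solve_system[of "{()}" "\<lambda>_. const_series c" "\<lambda>_ _. B" "\<lambda>_. 1"]) auto
  let ?g = "v ()"
  have g: "?g \<in> carrier R" using v by auto
  have "?g \<oplus> ?g \<otimes> B = const_series c"
    using v(2) by (intro ext) (simp add: solves_system_def mult_eq)
  moreover have "?g \<oplus> ?g \<otimes> B = const_series c \<otimes> (f \<otimes> ?g)"
  proof -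
    have "const_series (- 1) = \<ominus> \<one>" by (simp add: one_eq const_minus)
    then have "?g \<oplus> ?g \<otimes> B = const_series c \<otimes> (f \<otimes> ?g)"
      using f g by (simp add: B_def r_distr r_minus m_comm m_lcomm) (simp add: a_ac l_neg r_neg r_neg2)
    then show ?thesis .
  qed
  ultimately have "const_series c \<otimes> (f \<otimes> ?g) = const_series c" by simp
  then have "const_series (f 0) \<otimes> (const_series c \<otimes> (f \<otimes> ?g)) = const_series (f 0) \<otimes> const_series c" by simp
  moreover have "const_series (f 0) \<otimes> const_series c = \<one>"
    using f0 by (simp add: const_mult one_eq c_def)
  ultimately have "f \<otimes> ?g = \<one>" using f g by (simp add: m_assoc[symmetric])
  then show thesis using g that by blast
qed

text \<open>The ideal of series without constant term, which is the only maximal ideal.\<close>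

definition max_id :: "'k mseries set" where
  "max_id = {f \<in> carrier R. f 0 = 0}"

lemma max_id_ideal: "ideal max_id R"
proof (rule idealI)
  show "subgroup max_id (add_monoid R)"
    by (rule add.subgroupI) (auto simp: max_id_def simp flip: a_inv_def intro!: exI[of _ \<zero>])
qed (auto simp: max_id_def ring_axioms)

lemma ideal_proper_subset:
  assumes I: "ideal I R" and ne: "I \<noteq> carrier R"
  shows "I \<subseteq> max_id"
proof
  fix f assume f: "f \<in> I"
  then have fR: "f \<in> carrier R" using I by (meson additive_subgroup.a_Hcarr ideal.axioms(1))
  have "f 0 = 0"
  proof (rule ccontr)
    assume "f 0 \<noteq> 0"
    then obtain g where "g \<in> carrier R" "f \<otimes> g = \<one>" using inverse_exists fR by blast
    then have "\<one> \<in> I" using ideal.I_r_closed[OF I f, of g] by simp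
    then show False using ideal.one_imp_carrier[OF I] ne by simp
  qed
  then show "f \<in> max_id" using fR by (simp add: max_id_def)
qed

lemma max_id_maximal: "maximalideal max_id R"
proof (rule maximalidealI[OF max_id_ideal])
  show "carrier R \<noteq> max_id" 
  proof
    assume "carrier R = max_id"
    then have "\<one> \<in> max_id" using one_closed by simp
    then show False by (simp add: max_id_def one_coeff)
  qed
next
  fix J assume "ideal J R" "max_id \<subseteq> J" "J \<subseteq> carrier R"
  then show "J = max_id \<or> J = carrier R" using ideal_proper_subset by blast
qed

lemma max_ideal_eq: "max_ideal R = max_id"
  unfolding max_ideal_def
proof (rule the_equality, rule max_id_maximal)
  fix I assume I: "maximalideal I R"
  then have "ideal I R" "I \<noteq> carrier R"
    by (auto simp: maximalideal_def maximalideal_axioms_def)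
  then have "I \<subseteq> max_id" by (rule ideal_proper_subset)
  moreover have "max_id \<noteq> carrier R" "max_id \<subseteq> carrier R"
    using max_id_maximal by (auto simp: maximalideal_def maximalideal_axioms_def max_id_def)
  ultimately show "I = max_id"
    using maximalideal.I_maximal[OF I max_id_ideal] by blast
qed

lemma deriv_plus: "series_deriv i (f \<oplus> g) = series_deriv i f \<oplus> series_deriv i g"
  by (simp add: add_eq series_deriv_add)

lemma deriv_times: "series_deriv i (f \<otimes> g) = series_deriv i f \<otimes> g \<oplus> f \<otimes> series_deriv i g"
  by (simp add: mult_eq add_eq series_deriv_mult)

lemma deriv_const [simp]: "series_deriv i (const_series c) = \<zero>"
  by (simp add: series_deriv_const fun_eq_iff)

lemma deriv_var: "series_deriv i (series_var j) = (if i = j then \<one> else \<zero>)"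
  by (simp add: series_deriv_var one_eq zero_eq)

text \<open>The Euler derivation \<open>\<Sum>\<^sub>i x\<^sub>i \<partial>\<^sub>i\<close>, which multiplies the homogeneous part of degree \<open>d\<close> by \<open>d\<close>.\<close>

definition euler :: "'k mseries \<Rightarrow> 'k mseries" where
  "euler f = (\<Oplus>i\<in>{..<n}. series_var i \<otimes> series_deriv i f)"

lemma euler_closed [simp, intro]: "f \<in> carrier R \<Longrightarrow> euler f \<in> carrier R"
  by (auto simp: euler_def intro!: finsum_closed)

lemma euler_coeff: "f \<in> carrier R \<Longrightarrow> euler f a = of_nat (mi_degree a) * f a"
  using series_euler[of a n f] coeff_outside[of "euler f" a] coeff_outside[of f a]
  by (cases "Poly_Mapping.keys a \<subseteq> {..<n}") (auto simp: euler_def finsum_coeff mult_eq times_closed Pi_iff)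

lemma decomp:
  assumes "f \<in> carrier R"
  shows "f = const_series (f 0) \<oplus> (\<Oplus>i\<in>{..<n}. series_var i \<otimes> series_tail i f)"
proof
  fix a
  let ?g = "const_series (f 0) \<oplus> (\<Oplus>i\<in>{..<n}. series_var i \<otimes> series_tail i f)"
  have g: "?g \<in> carrier R" using assms by (auto intro!: finsum_closed)
  show "f a = ?g a"
    using series_decomp[of a n f] coeff_outside[OF assms] coeff_outside[OF g] assms
    by (cases "Poly_Mapping.keys a \<subseteq> {..<n}") (auto simp: finsum_coeff mult_eq times_closed Pi_iff)
qed

end

subsection \<open>Derivations\<close>

lemma self_module_simps [simp]:
  "carrier (self_module R) = carrier R" "mult (self_module R) = mult R" "one (self_module R) = one R"
  "ring.zero (self_module R) = ring.zero R" "add (self_module R) = add R" "smult (self_module R) = mult R"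
  by (simp_all add: self_module_def ring.defs module.defs)

lemma derivations_simps [simp]:
  "ring.zero (derivations R K) = (\<lambda>m\<in>carrier R. \<zero>\<^bsub>R\<^esub>)"
  "add (derivations R K) = (\<lambda>f g. \<lambda>m\<in>carrier R. f m \<oplus>\<^bsub>R\<^esub> g m)"
  "smult (derivations R K) = (\<lambda>r f. \<lambda>m\<in>carrier R. r \<otimes>\<^bsub>R\<^esub> f m)"
  "lie_bracket (derivations R K) = (\<lambda>f g. \<lambda>m\<in>carrier R. f (g m) \<ominus>\<^bsub>R\<^esub> g (f m))"
  by (simp_all add: derivations_def endo_lie_def a_minus_def a_inv_def m_inv_def)

lemma in_derivations_iff:
  "D \<in> carrier (derivations R K) \<longleftrightarrow>
    D \<in> carrier R \<rightarrow>\<^sub>E carrier R \<and>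
    (\<forall>x\<in>carrier R. \<forall>y\<in>carrier R. D (x \<oplus>\<^bsub>R\<^esub> y) = D x \<oplus>\<^bsub>R\<^esub> D y) \<and>
    (\<forall>c\<in>K. \<forall>x\<in>carrier R. D (c \<otimes>\<^bsub>R\<^esub> x) = c \<otimes>\<^bsub>R\<^esub> D x) \<and>
    (\<forall>r\<in>carrier R. \<forall>s\<in>carrier R. D (r \<otimes>\<^bsub>R\<^esub> s) = D r \<otimes>\<^bsub>R\<^esub> s \<oplus>\<^bsub>R\<^esub> r \<otimes>\<^bsub>R\<^esub> D s)"
  by (auto simp: derivations_def endo_lie_def lin_maps_def)

context power_series_ring
begin

abbreviation constants :: "'k mseries set" where
  "constants \<equiv> range const_series"

lemma derivation_closed: "D \<in> carrier (derivations R K) \<Longrightarrow> f \<in> carrier R \<Longrightarrow> D f \<in> carrier R"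
  by (auto simp: in_derivations_iff)

text \<open>\<open>\<partial>\<^sub>i\<close> as an element of \<open>T\<^sub>R\<close>, that is, undefined outside \<open>R\<close>.\<close>

definition pderiv :: "nat \<Rightarrow> 'k mseries \<Rightarrow> 'k mseries" where
  "pderiv i = (\<lambda>f\<in>carrier R. series_deriv i f)"

lemma pderiv_derivation: "pderiv i \<in> carrier (derivations R constants)"
  unfolding in_derivations_iff
  by (auto simp: pderiv_def deriv_plus deriv_times)

lemma derivation_const:
  assumes D: "D \<in> carrier (derivations R constants)"
  shows "D (const_series c) = \<zero>"
proof -
  have D1: "D \<one> \<in> carrier R" using D by (auto simp: derivation_closed)
  have "D (\<one> \<otimes> \<one>) = D \<one> \<otimes> \<one> \<oplus> \<one> \<otimes> D \<one>"
    using D one_closed unfolding in_derivations_iff by blast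
  then have "D \<one> \<oplus> D \<one> = D \<one>" using D1 by simp
  then have "D \<one> = \<zero>" using D1 by (metis add.r_cancel_one')
  moreover have "D (const_series c \<otimes> \<one>) = const_series c \<otimes> D \<one>"
    using D one_closed unfolding in_derivations_iff by blast
  ultimately show ?thesis by simp
qed

text \<open>The map \<open>T\<close> has values in an ordinary group, such as the coefficients of a series, and need
  only be additive on \<open>R\<close>.\<close>

lemma additive_finsum:
  assumes T: "\<And>f g. f \<in> carrier R \<Longrightarrow> g \<in> carrier R \<Longrightarrow> T (f \<oplus> g) = T f + (T g :: 'b::ab_group_add)"
    and "finite A" "F \<in> A \<rightarrow> carrier R"
  shows "T (\<Oplus>i\<in>A. F i) = (\<Sum>i\<in>A. T (F i))"
proof -
  have T0: "T \<zero> = 0" using T[of \<zero> \<zero>] by simp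
  show ?thesis using assms(2,3) T0 by (induction A) (auto simp: finsum_insert T finsum_closed Pi_iff)
qed

text \<open>A derivation is determined by its values on the variables. The difference \<open>T\<close> of the two sides
  satisfies \<open>T (x\<^sub>i f) = x\<^sub>i T f\<close> and kills constants, so all its coefficients vanish, by induction
  on the degree.\<close>

lemma derivation_expand:
  assumes D: "D \<in> carrier (derivations R constants)" and f: "f \<in> carrier R"
  shows "D f = (\<Oplus>i\<in>{..<n}. D (series_var i) \<otimes> series_deriv i f)"
proof -
  define S where "S f = (\<Oplus>i\<in>{..<n}. D (series_var i) \<otimes> series_deriv i f)" for f
  note Dc = derivation_closed[OF D]
  have Sc: "S f \<in> carrier R" if "f \<in> carrier R" for f
    using that by (simp add: S_def Dc Pi_iff)
  have S_add: "S (f \<oplus> g) = S f \<oplus> S g" if "f \<in> carrier R" "g \<in> carrier R" for f g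
  proof -
    have "S (f \<oplus> g) = (\<Oplus>i\<in>{..<n}. D (series_var i) \<otimes> series_deriv i f \<oplus> D (series_var i) \<otimes> series_deriv i g)"
      unfolding S_def deriv_plus using that by (intro finsum_cong') (simp_all add: Dc r_distr)
    then show ?thesis using that by (simp add: S_def Dc Pi_iff)
  qed
  have S_const: "S (const_series c) = \<zero>" for c
    unfolding S_def by (rule add.finprod_one_eqI) (simp add: Dc)
  have S_var: "S (series_var i \<otimes> f) = D (series_var i) \<otimes> f \<oplus> series_var i \<otimes> S f"
    if f: "f \<in> carrier R" and i: "i < n" for f i
  proof -
    have "S (series_var i \<otimes> f) =
        (\<Oplus>j\<in>{..<n}. D (series_var j) \<otimes> (series_deriv j (series_var i) \<otimes> f) \<oplus>
          series_var i \<otimes> (D (series_var j) \<otimes> series_deriv j f))"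
      unfolding S_def using f i
      by (intro finsum_cong') (simp_all add: Dc deriv_times r_distr m_lcomm)
    also have "\<dots> = (\<Oplus>j\<in>{..<n}. D (series_var j) \<otimes> (series_deriv j (series_var i) \<otimes> f)) \<oplus>
        series_var i \<otimes> S f"
      unfolding S_def using f i by (subst finsum_rdistr) (simp_all add: Dc Pi_iff)
    also have "(\<Oplus>j\<in>{..<n}. D (series_var j) \<otimes> (series_deriv j (series_var i) \<otimes> f)) =
        (\<Oplus>j\<in>{..<n}. if i = j then D (series_var j) \<otimes> f else \<zero>)"
      using f i by (intro finsum_cong') (simp_all add: Dc deriv_var)
    also have "\<dots> = D (series_var i) \<otimes> f"
      using f i by (intro finsum_singleton) (simp_all add: Dc)
    finally show ?thesis .
  qed
  define T where "T f = D f \<ominus> S f" for f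
  have Tc: "T f \<in> carrier R" if "f \<in> carrier R" for f using that by (simp add: T_def Dc Sc)
  have T_add: "T (f \<oplus> g) a = T f a + T g a" if "f \<in> carrier R" "g \<in> carrier R" for f g a
  proof -
    have "D (f \<oplus> g) = D f \<oplus> D g" using D that unfolding in_derivations_iff by blast
    then show ?thesis using that by (simp add: T_def S_add Sc)
  qed
  have T_const: "T (const_series c) a = 0" for c a
    by (simp add: T_def S_const derivation_const[OF D])
  have T_var: "T (series_var i \<otimes> f) = series_var i \<otimes> T f" if "f \<in> carrier R" "i < n" for f i
  proof -
    have "D (series_var i \<otimes> f) = D (series_var i) \<otimes> f \<oplus> series_var i \<otimes> D f"
      using that D var_closed unfolding in_derivations_iff by blast
    then show ?thesis
      using that by (simp add: T_def a_minus_def r_distr r_minus minus_add S_var Dc Sc a_ac r_neg2 r_neg r_neg1)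
  qed
  have "T f a = 0" if "f \<in> carrier R" for f a
    using that
  proof (induction "mi_degree a" arbitrary: f a rule: less_induct)
    case less
    have "T f a = T (const_series (f 0) \<oplus> (\<Oplus>i\<in>{..<n}. series_var i \<otimes> series_tail i f)) a"
      using decomp[OF less.prems] by simp
    also have "\<dots> = T (const_series (f 0)) a + T (\<Oplus>i\<in>{..<n}. series_var i \<otimes> series_tail i f) a"
      using less.prems by (intro T_add) (auto intro!: finsum_closed)
    also have "\<dots> = (\<Sum>i<n. T (series_var i \<otimes> series_tail i f) a)"
    proof -
      have "T (\<Oplus>i\<in>{..<n}. series_var i \<otimes> series_tail i f) a = (\<Sum>i<n. T (series_var i \<otimes> series_tail i f) a)"
        by (rule additive_finsum[of "\<lambda>f. T f a", OF T_add]) (use less.prems in auto)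
      then show ?thesis by (simp add: T_const)
    qed
    also have "\<dots> = 0"
    proof (intro sum.neutral ballI)
      fix i assume "i \<in> {..<n}"
      moreover have "T (series_tail i f) (a - mi_unit i) = 0" if "Poly_Mapping.lookup a i > 0"
        using less.hyps[of "a - mi_unit i"] less.prems
          arg_cong[OF add_unit_minus[OF that], of mi_degree] by (simp add: mi_degree_add)
      ultimately show "T (series_var i \<otimes> series_tail i f) a = 0"
        using less.prems by (simp add: T_var) (simp add: mult_eq series_mult_var)
    qed
    finally show ?case .
  qed
  then have "(D f \<ominus> S f) a = 0" for a using f by (simp add: T_def)
  then have "D f = S f" using f Sc by (intro ext) simp
  then show ?thesis by (simp add: S_def)
qed

end

section \<open>Linear combinations and bases\<close>

text \<open>A module over a ring record without additional fields, as in the definitions of spans, linear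
  maps and tensor products.\<close>

locale ring_module = module R M
  for R :: "'r ring" (structure) and M :: "('r, 'a, 'x) module_scheme" (structure)
begin

lemma minus_eq_smult: "x \<in> carrier M \<Longrightarrow> \<ominus>\<^bsub>M\<^esub> x = (\<ominus> \<one>) \<odot>\<^bsub>M\<^esub> x"
  by (simp add: smult_l_minus)

lemma submodule_zero: "submodule N R M \<Longrightarrow> \<zero>\<^bsub>M\<^esub> \<in> N"
  using submodule.axioms(1)[of N R M] subgroup.one_closed[of N "add_monoid M"] by simp

lemma span_mod_submodule:
  assumes "Y \<subseteq> carrier M"
  shows "submodule (span_mod R M Y) R M"
proof (rule submoduleI)
  show "span_mod R M Y \<subseteq> carrier M"
    using assms carrier_is_submodule by (auto simp: span_mod_def)
  show "\<zero>\<^bsub>M\<^esub> \<in> span_mod R M Y"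
    by (simp add: span_mod_def submodule_zero)
qed (auto simp: span_mod_def dest: submoduleE)

lemma span_mod_base: "Y \<subseteq> span_mod R M Y"
  by (auto simp: span_mod_def)

lemma span_mod_least: "submodule N R M \<Longrightarrow> Y \<subseteq> N \<Longrightarrow> span_mod R M Y \<subseteq> N"
  by (auto simp: span_mod_def)

lemma submodule_finsum:
  assumes N: "submodule N R M" and F: "F \<in> A \<rightarrow> N"
  shows "(\<Oplus>\<^bsub>M\<^esub>i\<in>A. F i) \<in> N"
  using F
proof (induction A rule: infinite_finite_induct)
  case (insert i A)
  have "F \<in> A \<rightarrow> carrier M" "F i \<in> carrier M" using insert.prems submoduleE(1)[OF N] by auto
  then show ?case using insert submoduleE(5)[OF N] by (simp add: M.finsum_insert Pi_iff)
qed (use submodule_zero[OF N] in \<open>simp_all add: M.finsum_infinite\<close>)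

text \<open>The linear combination \<open>\<Sum>\<^sub>i v\<^sub>i e\<^sub>i\<close> of a family \<open>e\<close> indexed by a finite set \<open>I\<close>.\<close>

definition lincomb :: "'i set \<Rightarrow> ('i \<Rightarrow> 'a) \<Rightarrow> ('i \<Rightarrow> 'r) \<Rightarrow> 'a" where
  "lincomb I e v = (\<Oplus>\<^bsub>M\<^esub>i\<in>I. v i \<odot>\<^bsub>M\<^esub> e i)"

lemma lincomb_closed [simp, intro]:
  "e \<in> I \<rightarrow> carrier M \<Longrightarrow> v \<in> I \<rightarrow> carrier R \<Longrightarrow> lincomb I e v \<in> carrier M"
  by (simp add: lincomb_def Pi_iff)

lemma lincomb_cong:
  "e \<in> I \<rightarrow> carrier M \<Longrightarrow> w \<in> I \<rightarrow> carrier R \<Longrightarrow> (\<And>i. i \<in> I \<Longrightarrow> v i = w i) \<Longrightarrow>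
    lincomb I e v = lincomb I e w"
  unfolding lincomb_def by (rule M.finsum_cong') (auto simp: Pi_iff)

lemma lincomb_add:
  assumes "e \<in> I \<rightarrow> carrier M" "v \<in> I \<rightarrow> carrier R" "w \<in> I \<rightarrow> carrier R"
  shows "lincomb I e (\<lambda>i. v i \<oplus> w i) = lincomb I e v \<oplus>\<^bsub>M\<^esub> lincomb I e w"
proof -
  have "lincomb I e (\<lambda>i. v i \<oplus> w i) = (\<Oplus>\<^bsub>M\<^esub>i\<in>I. v i \<odot>\<^bsub>M\<^esub> e i \<oplus>\<^bsub>M\<^esub> w i \<odot>\<^bsub>M\<^esub> e i)"
    unfolding lincomb_def using assms by (intro M.finsum_cong') (auto simp: Pi_iff smult_l_distr)
  then show ?thesis using assms by (simp add: lincomb_def Pi_iff)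
qed

lemma lincomb_smult:
  assumes "finite I" "e \<in> I \<rightarrow> carrier M" "v \<in> I \<rightarrow> carrier R" "r \<in> carrier R"
  shows "lincomb I e (\<lambda>i. r \<otimes> v i) = r \<odot>\<^bsub>M\<^esub> lincomb I e v"
proof -
  have "lincomb I e (\<lambda>i. r \<otimes> v i) = (\<Oplus>\<^bsub>M\<^esub>i\<in>I. r \<odot>\<^bsub>M\<^esub> (v i \<odot>\<^bsub>M\<^esub> e i))"
    unfolding lincomb_def using assms by (intro M.finsum_cong') (auto simp: Pi_iff smult_assoc1)
  also have "\<dots> = r \<odot>\<^bsub>M\<^esub> (\<Oplus>\<^bsub>M\<^esub>i\<in>I. v i \<odot>\<^bsub>M\<^esub> e i)"
    using assms by (intro finsum_smult_ldistr[symmetric]) (auto simp: Pi_iff)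
  finally show ?thesis by (simp add: lincomb_def)
qed

lemma lincomb_zero: "e \<in> I \<rightarrow> carrier M \<Longrightarrow> (\<And>i. i \<in> I \<Longrightarrow> v i = \<zero>) \<Longrightarrow> lincomb I e v = \<zero>\<^bsub>M\<^esub>"
  unfolding lincomb_def by (rule M.add.finprod_one_eqI) (auto simp: Pi_iff)

lemma lincomb_minus:
  assumes "finite I" "e \<in> I \<rightarrow> carrier M" "v \<in> I \<rightarrow> carrier R"
  shows "lincomb I e (\<lambda>i. \<ominus> v i) = \<ominus>\<^bsub>M\<^esub> lincomb I e v"
proof -
  have "lincomb I e (\<lambda>i. \<ominus> v i) = lincomb I e (\<lambda>i. (\<ominus> \<one>) \<otimes> v i)"
    using assms by (intro lincomb_cong) (auto simp: Pi_iff l_minus)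
  then show ?thesis
    using assms by (simp add: lincomb_smult smult_l_minus)
qed

lemma lincomb_unit:
  assumes "finite I" "e \<in> I \<rightarrow> carrier M" "i \<in> I"
  shows "lincomb I e (\<lambda>j. if i = j then \<one> else \<zero>) = e i"
proof -
  have "lincomb I e (\<lambda>j. if i = j then \<one> else \<zero>) = (\<Oplus>\<^bsub>M\<^esub>j\<in>I. if i = j then e j else \<zero>\<^bsub>M\<^esub>)"
    unfolding lincomb_def using assms by (intro M.finsum_cong') (auto simp: Pi_iff)
  also have "\<dots> = e i" using assms by (intro M.finsum_singleton) auto
  finally show ?thesis .
qed

lemma lincomb_insert:
  assumes "finite I" "i \<notin> I" "e \<in> insert i I \<rightarrow> carrier M" "v \<in> insert i I \<rightarrow> carrier R"
  shows "lincomb (insert i I) e v = v i \<odot>\<^bsub>M\<^esub> e i \<oplus>\<^bsub>M\<^esub> lincomb I e v"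
  unfolding lincomb_def using assms by (subst M.finsum_insert) (auto simp: Pi_iff)

text \<open>If \<open>e\<^sub>i = \<Sum>\<^sub>j \<Gamma>\<^sub>i\<^sub>j f\<^sub>j\<close>, coordinates with respect to \<open>e\<close> are transformed by the matrix \<open>\<Gamma>\<close>.\<close>

lemma lincomb_lincomb:
  assumes I: "finite I" and J: "finite J" and f: "f \<in> J \<rightarrow> carrier M"
    and \<Gamma>: "\<And>i j. i \<in> I \<Longrightarrow> j \<in> J \<Longrightarrow> \<Gamma> i j \<in> carrier R"
    and e: "\<And>i. i \<in> I \<Longrightarrow> e i = lincomb J f (\<Gamma> i)" and v: "v \<in> I \<rightarrow> carrier R"
  shows "lincomb I e v = lincomb J f (\<lambda>j. \<Oplus>i\<in>I. v i \<otimes> \<Gamma> i j)"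
  using I \<Gamma> e v
proof (induction I)
  case empty
  show ?case using f by (simp add: lincomb_def[of "{}"] lincomb_zero)
next
  case (insert k I)
  have \<Gamma>k: "\<Gamma> k \<in> J \<rightarrow> carrier R" using insert by auto
  have sum: "(\<lambda>j. \<Oplus>i\<in>I. v i \<otimes> \<Gamma> i j) \<in> J \<rightarrow> carrier R"
    using insert by (auto simp: Pi_iff)
  have ek: "e \<in> insert k I \<rightarrow> carrier M" using insert f by (auto simp: Pi_iff)
  have "lincomb (insert k I) e v = v k \<odot>\<^bsub>M\<^esub> lincomb J f (\<Gamma> k) \<oplus>\<^bsub>M\<^esub> lincomb J f (\<lambda>j. \<Oplus>i\<in>I. v i \<otimes> \<Gamma> i j)"
    using insert ek by (simp add: lincomb_insert)
  also have "\<dots> = lincomb J f (\<lambda>j. v k \<otimes> \<Gamma> k j \<oplus> (\<Oplus>i\<in>I. v i \<otimes> \<Gamma> i j))"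
    using insert.prems \<Gamma>k sum J f
    by (subst lincomb_add) (auto simp: lincomb_smult Pi_iff)
  also have "\<dots> = lincomb J f (\<lambda>j. \<Oplus>i\<in>insert k I. v i \<otimes> \<Gamma> i j)"
  proof (rule lincomb_cong[OF f])
    fix j assume "j \<in> J"
    then show "v k \<otimes> \<Gamma> k j \<oplus> (\<Oplus>i\<in>I. v i \<otimes> \<Gamma> i j) = (\<Oplus>i\<in>insert k I. v i \<otimes> \<Gamma> i j)"
      using insert by (subst R.finsum_insert) (auto simp: Pi_iff)
  qed (use insert in \<open>auto simp: Pi_iff intro!: R.finsum_closed\<close>)
  finally show ?case .
qed

lemma lincombs_submodule:
  assumes I: "finite I" and e: "e \<in> I \<rightarrow> carrier M" and J: "ideal J R"
  shows "submodule (lincomb I e ` (I \<rightarrow> J)) R M"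
proof -
  have JR: "J \<subseteq> carrier R" using J by (meson additive_subgroup.a_subset ideal.axioms(1))
  have sub: "additive_subgroup J R" using J by (rule ideal.axioms(1))
  have J0: "\<zero> \<in> J" "\<And>x y. x \<in> J \<Longrightarrow> y \<in> J \<Longrightarrow> x \<oplus> y \<in> J"
    using additive_subgroup.zero_closed[OF sub] additive_subgroup.a_closed[OF sub] by auto
  have J1: "\<ominus> x \<in> J" if "x \<in> J" for x
  proof -
    have "(\<ominus> \<one>) \<otimes> x \<in> J" by (rule ideal.I_l_closed[OF J that]) simp
    moreover have "x \<in> carrier R" using JR that by blast
    ultimately show ?thesis by (simp add: l_minus)
  qed
  have JR': "\<And>v. v \<in> I \<rightarrow> J \<Longrightarrow> v \<in> I \<rightarrow> carrier R" using JR by blast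
  show ?thesis
  proof (rule submoduleI)
    show "lincomb I e ` (I \<rightarrow> J) \<subseteq> carrier M" using e JR' by auto
    have "lincomb I e (\<lambda>_. \<zero>) = \<zero>\<^bsub>M\<^esub>" using e by (rule lincomb_zero) simp
    then show "\<zero>\<^bsub>M\<^esub> \<in> lincomb I e ` (I \<rightarrow> J)" using J0(1) by (metis (no_types, lifting) Pi_I image_eqI)
  next
    fix x assume "x \<in> lincomb I e ` (I \<rightarrow> J)"
    then obtain v where v: "v \<in> I \<rightarrow> J" "x = lincomb I e v" by blast
    then have "\<ominus>\<^bsub>M\<^esub> x = lincomb I e (\<lambda>i. \<ominus> v i)" using I e JR' by (simp add: lincomb_minus)
    then show "\<ominus>\<^bsub>M\<^esub> x \<in> lincomb I e ` (I \<rightarrow> J)" using v J1 by (auto simp: Pi_iff)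
  next
    fix x y assume "x \<in> lincomb I e ` (I \<rightarrow> J)" "y \<in> lincomb I e ` (I \<rightarrow> J)"
    then obtain v w where v: "v \<in> I \<rightarrow> J" "x = lincomb I e v" "w \<in> I \<rightarrow> J" "y = lincomb I e w" by blast
    then have "x \<oplus>\<^bsub>M\<^esub> y = lincomb I e (\<lambda>i. v i \<oplus> w i)" using I e JR' by (simp add: lincomb_add)
    then show "x \<oplus>\<^bsub>M\<^esub> y \<in> lincomb I e ` (I \<rightarrow> J)" using v J0 by (auto simp: Pi_iff)
  next
    fix r x assume r: "r \<in> carrier R" and "x \<in> lincomb I e ` (I \<rightarrow> J)"
    then obtain v where v: "v \<in> I \<rightarrow> J" "x = lincomb I e v" by blast
    then have "r \<odot>\<^bsub>M\<^esub> x = lincomb I e (\<lambda>i. r \<otimes> v i)" using I e r JR' by (simp add: lincomb_smult)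
    moreover have "(\<lambda>i. r \<otimes> v i) \<in> I \<rightarrow> J" using v r ideal.I_l_closed[OF J] by auto
    ultimately show "r \<odot>\<^bsub>M\<^esub> x \<in> lincomb I e ` (I \<rightarrow> J)" by blast
  qed
qed

lemma lincomb_in_submodule:
  assumes "submodule N R M" "e \<in> I \<rightarrow> N" "v \<in> I \<rightarrow> carrier R"
  shows "lincomb I e v \<in> N"
  unfolding lincomb_def
  by (rule submodule_finsum[OF assms(1)]) (use assms submoduleE(4)[OF assms(1)] in auto)

lemma span_mod_finite:
  assumes "finite Y" "Y \<subseteq> carrier M"
  shows "span_mod R M Y = lincomb Y (\<lambda>y. y) ` (Y \<rightarrow> carrier R)"
proof
  show "span_mod R M Y \<subseteq> lincomb Y (\<lambda>y. y) ` (Y \<rightarrow> carrier R)"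
  proof (rule span_mod_least)
    show "submodule (lincomb Y (\<lambda>y. y) ` (Y \<rightarrow> carrier R)) R M"
      by (rule lincombs_submodule) (use assms oneideal in auto)
    show "Y \<subseteq> lincomb Y (\<lambda>y. y) ` (Y \<rightarrow> carrier R)"
    proof
      fix y assume "y \<in> Y"
      then have "lincomb Y (\<lambda>y. y) (\<lambda>j. if y = j then \<one> else \<zero>) = y"
        by (intro lincomb_unit) (use assms in auto)
      then show "y \<in> lincomb Y (\<lambda>y. y) ` (Y \<rightarrow> carrier R)"
        by (intro image_eqI[where x = "\<lambda>j. if y = j then \<one> else \<zero>"]) simp_all
    qed
  qed
next
  show "lincomb Y (\<lambda>y. y) ` (Y \<rightarrow> carrier R) \<subseteq> span_mod R M Y"
    using span_mod_submodule[OF assms(2)] span_mod_base by (auto intro: lincomb_in_submodule)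
qed

text \<open>A finite basis, indexed by \<open>I\<close>. Coordinate vectors are functions on \<open>I\<close> and only matter there.\<close>

definition basis :: "'i set \<Rightarrow> ('i \<Rightarrow> 'a) \<Rightarrow> bool" where
  "basis I e \<longleftrightarrow> finite I \<and> e \<in> I \<rightarrow> carrier M \<and>
    (\<forall>x\<in>carrier M. \<exists>v\<in>I \<rightarrow> carrier R. x = lincomb I e v) \<and>
    (\<forall>v\<in>I \<rightarrow> carrier R. lincomb I e v = \<zero>\<^bsub>M\<^esub> \<longrightarrow> (\<forall>i\<in>I. v i = \<zero>))"

lemma basis_unique:
  assumes b: "basis I e" and v: "v \<in> I \<rightarrow> carrier R" and w: "w \<in> I \<rightarrow> carrier R"
    and eq: "lincomb I e v = lincomb I e w" and i: "i \<in> I"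
  shows "v i = w i"
proof -
  have I: "finite I" "e \<in> I \<rightarrow> carrier M" using b by (auto simp: basis_def)
  have w': "(\<lambda>i. \<ominus> w i) \<in> I \<rightarrow> carrier R" using w by auto
  have "lincomb I e (\<lambda>i. v i \<oplus> \<ominus> w i) = \<zero>\<^bsub>M\<^esub>"
    using I v w w' eq by (simp add: lincomb_add lincomb_minus M.r_neg)
  moreover have "(\<lambda>i. v i \<oplus> \<ominus> w i) \<in> I \<rightarrow> carrier R" using v w by auto
  ultimately have "v i \<oplus> \<ominus> w i = \<zero>" using b i by (auto simp: basis_def)
  moreover have "v i \<in> carrier R" "w i \<in> carrier R" using v w i by auto
  ultimately show ?thesis by (metis R.minus_equality R.minus_minus R.add.inv_closed R.add.m_comm)
qed

lemma ideal_times_basis: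
  assumes b: "basis I e" and J: "ideal J R"
  shows "ideal_times R J M = lincomb I e ` (I \<rightarrow> J)"
proof
  have I: "finite I" "e \<in> I \<rightarrow> carrier M" using b by (auto simp: basis_def)
  have JR: "J \<subseteq> carrier R" using J by (meson additive_subgroup.a_subset ideal.axioms(1))
  show "ideal_times R J M \<subseteq> lincomb I e ` (I \<rightarrow> J)"
    unfolding ideal_times_def
  proof (rule span_mod_least[OF lincombs_submodule[OF I J]], clarify)
    fix s x assume s: "s \<in> J" and x: "x \<in> carrier M"
    obtain v where v: "v \<in> I \<rightarrow> carrier R" "x = lincomb I e v" using b x by (auto simp: basis_def)
    then have "s \<odot>\<^bsub>M\<^esub> x = lincomb I e (\<lambda>i. s \<otimes> v i)" using I s JR by (auto simp: lincomb_smult)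
    moreover have "(\<lambda>i. s \<otimes> v i) \<in> I \<rightarrow> J" using v s ideal.I_r_closed[OF J] by auto
    ultimately show "s \<odot>\<^bsub>M\<^esub> x \<in> lincomb I e ` (I \<rightarrow> J)" by blast
  qed
  show "lincomb I e ` (I \<rightarrow> J) \<subseteq> ideal_times R J M"
  proof clarify
    fix v assume v: "v \<in> I \<rightarrow> J"
    have "{s \<odot>\<^bsub>M\<^esub> x |s x. s \<in> J \<and> x \<in> carrier M} \<subseteq> carrier M" using JR by auto
    note span_mod_submodule[OF this] span_mod_base
    moreover have "v i \<odot>\<^bsub>M\<^esub> e i \<in> {s \<odot>\<^bsub>M\<^esub> x |s x. s \<in> J \<and> x \<in> carrier M}" if "i \<in> I" for i
      using v I that by auto
    ultimately show "lincomb I e v \<in> ideal_times R J M"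
      unfolding lincomb_def ideal_times_def by (intro submodule_finsum) blast+
  qed
qed

lemma ideal_times_submodule: "J \<subseteq> carrier R \<Longrightarrow> submodule (ideal_times R J M) R M"
  unfolding ideal_times_def by (rule span_mod_submodule) auto

lemma ideal_times_mem: "s \<in> J \<Longrightarrow> x \<in> carrier M \<Longrightarrow> s \<odot>\<^bsub>M\<^esub> x \<in> ideal_times R J M"
  unfolding ideal_times_def by (rule subsetD[OF span_mod_base]) auto

lemma additive_finsum_module:
  assumes P: "\<And>x. x \<in> carrier M \<Longrightarrow> P x \<in> carrier M"
      "\<And>x y. x \<in> carrier M \<Longrightarrow> y \<in> carrier M \<Longrightarrow> P (x \<oplus>\<^bsub>M\<^esub> y) = P x \<oplus>\<^bsub>M\<^esub> P y"
    and "finite A" "F \<in> A \<rightarrow> carrier M"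
  shows "P (\<Oplus>\<^bsub>M\<^esub>i\<in>A. F i) = (\<Oplus>\<^bsub>M\<^esub>i\<in>A. P (F i))"
proof -
  have "P \<zero>\<^bsub>M\<^esub> \<oplus>\<^bsub>M\<^esub> P \<zero>\<^bsub>M\<^esub> = P \<zero>\<^bsub>M\<^esub>" using P(2)[of "\<zero>\<^bsub>M\<^esub>" "\<zero>\<^bsub>M\<^esub>"] by simp
  then have P0: "P \<zero>\<^bsub>M\<^esub> = \<zero>\<^bsub>M\<^esub>" using P(1)[of "\<zero>\<^bsub>M\<^esub>"] by (metis M.add.r_cancel_one' M.zero_closed)
  show ?thesis using assms(3,4) P0 P
    by (induction A) (simp_all add: M.finsum_insert Pi_iff)
qed

text \<open>The matrix form of an operator \<open>P\<close> that satisfies a Leibniz rule over a map \<open>D\<close> of \<open>R\<close>.\<close>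

lemma leibniz_lincomb:
  assumes P: "\<And>x. x \<in> carrier M \<Longrightarrow> P x \<in> carrier M"
      "\<And>x y. x \<in> carrier M \<Longrightarrow> y \<in> carrier M \<Longrightarrow> P (x \<oplus>\<^bsub>M\<^esub> y) = P x \<oplus>\<^bsub>M\<^esub> P y"
      "\<And>r x. r \<in> carrier R \<Longrightarrow> x \<in> carrier M \<Longrightarrow> P (r \<odot>\<^bsub>M\<^esub> x) = D r \<odot>\<^bsub>M\<^esub> x \<oplus>\<^bsub>M\<^esub> r \<odot>\<^bsub>M\<^esub> P x"
    and D: "\<And>r. r \<in> carrier R \<Longrightarrow> D r \<in> carrier R"
    and I: "finite I" "e \<in> I \<rightarrow> carrier M"
    and \<Gamma>: "\<And>i j. i \<in> I \<Longrightarrow> j \<in> I \<Longrightarrow> \<Gamma> i j \<in> carrier R"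
      "\<And>i. i \<in> I \<Longrightarrow> P (e i) = lincomb I e (\<Gamma> i)" and v: "v \<in> I \<rightarrow> carrier R"
  shows "P (lincomb I e v) = lincomb I e (\<lambda>j. D (v j) \<oplus> (\<Oplus>i\<in>I. v i \<otimes> \<Gamma> i j))"
proof -
  have "P (lincomb I e v) = (\<Oplus>\<^bsub>M\<^esub>i\<in>I. P (v i \<odot>\<^bsub>M\<^esub> e i))"
    unfolding lincomb_def by (rule additive_finsum_module) (use P I v in auto)
  also have "\<dots> = (\<Oplus>\<^bsub>M\<^esub>i\<in>I. D (v i) \<odot>\<^bsub>M\<^esub> e i \<oplus>\<^bsub>M\<^esub> v i \<odot>\<^bsub>M\<^esub> P (e i))"
    by (rule M.finsum_cong') (use P D I v in \<open>auto simp: Pi_iff\<close>)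
  also have "\<dots> = lincomb I e (\<lambda>i. D (v i)) \<oplus>\<^bsub>M\<^esub> lincomb I (\<lambda>i. P (e i)) v"
    unfolding lincomb_def using P D I v by (intro M.finsum_addf) (auto simp: Pi_iff)
  also have "lincomb I (\<lambda>i. P (e i)) v = lincomb I e (\<lambda>j. \<Oplus>i\<in>I. v i \<otimes> \<Gamma> i j)"
    by (rule lincomb_lincomb) (use I \<Gamma> v in auto)
  also have "lincomb I e (\<lambda>i. D (v i)) \<oplus>\<^bsub>M\<^esub> \<dots> = lincomb I e (\<lambda>j. D (v j) \<oplus> (\<Oplus>i\<in>I. v i \<otimes> \<Gamma> i j))"
    using I D \<Gamma> v by (intro lincomb_add[symmetric]) (auto simp: Pi_iff)
  finally show ?thesis .
qed

end

section \<open>Modules with a connection over a power series ring\<close>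

text \<open>A connection is given by its values \<open>\<nabla>\<^sub>i\<close> on the partial derivatives.\<close>

lemma series_var_0 [simp]: "series_var i 0 = 0"
  by (simp add: series_var_def)

locale connection = R?: power_series_ring R n + ring_module R N
  for R :: "'k::field_char_0 mseries ring" (structure) and n :: nat
    and N :: "('k mseries, 'a, 'x) module_scheme" (structure) +
  fixes nab :: "nat \<Rightarrow> 'a \<Rightarrow> 'a"
  assumes nab_closed [simp, intro]: "i < n \<Longrightarrow> x \<in> carrier N \<Longrightarrow> nab i x \<in> carrier N"
    and nab_add: "i < n \<Longrightarrow> x \<in> carrier N \<Longrightarrow> y \<in> carrier N \<Longrightarrow>
      nab i (x \<oplus>\<^bsub>N\<^esub> y) = nab i x \<oplus>\<^bsub>N\<^esub> nab i y"
    and nab_leibniz: "i < n \<Longrightarrow> r \<in> carrier R \<Longrightarrow> x \<in> carrier N \<Longrightarrow>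
      nab i (r \<odot>\<^bsub>N\<^esub> x) = series_deriv i r \<odot>\<^bsub>N\<^esub> x \<oplus>\<^bsub>N\<^esub> r \<odot>\<^bsub>N\<^esub> nab i x"
    and finite_type: "finite_type R N"
begin

lemma max_id_subset: "max_id \<subseteq> carrier R"
  by (auto simp: max_id_def)

text \<open>The submodule \<open>\<mm> N\<close>.\<close>

definition mN :: "'a set" where
  "mN = ideal_times R max_id N"

lemma mN_submodule: "submodule mN R N"
  unfolding mN_def by (rule ideal_times_submodule[OF max_id_subset])

lemma mN_subset: "mN \<subseteq> carrier N"
  using submoduleE(1)[OF mN_submodule] .

lemma nab_lincomb:
  assumes "i < n" "finite I" "e \<in> I \<rightarrow> carrier N"
    "\<And>j k. j \<in> I \<Longrightarrow> k \<in> I \<Longrightarrow> \<Gamma> j k \<in> carrier R" "\<And>j. j \<in> I \<Longrightarrow> nab i (e j) = lincomb I e (\<Gamma> j)"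
    "v \<in> I \<rightarrow> carrier R"
  shows "nab i (lincomb I e v) =
    lincomb I e (\<lambda>k. series_deriv i (v k) \<oplus> (\<Oplus>j\<in>I. v j \<otimes> \<Gamma> j k))"
  by (rule leibniz_lincomb) (use assms nab_add nab_leibniz in auto)

text \<open>A relation of order \<open>d + 1\<close> between generators, differentiated with respect to a variable in a
  monomial of that degree, gives one of order \<open>d\<close>. So if no relation has a coefficient with nonzero
  constant term, only the trivial relation is left.\<close>

lemma relation_order:
  assumes Y: "finite Y" "Y \<subseteq> carrier N" and gen: "\<And>x. x \<in> carrier N \<Longrightarrow> \<exists>v\<in>Y \<rightarrow> carrier R. x = lincomb Y (\<lambda>y. y) v"
    and order: "\<And>v y. v \<in> Y \<rightarrow> carrier R \<Longrightarrow> lincomb Y (\<lambda>y. y) v = \<zero>\<^bsub>N\<^esub> \<Longrightarrow> y \<in> Y \<Longrightarrow> v y 0 = 0"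
    and v: "v \<in> Y \<rightarrow> carrier R" "lincomb Y (\<lambda>y. y) v = \<zero>\<^bsub>N\<^esub>" and y: "y \<in> Y"
  shows "v y a = 0"
  using v y
proof (induction "mi_degree a" arbitrary: a v y rule: less_induct)
  case less
  have id: "(\<lambda>y. y) \<in> Y \<rightarrow> carrier N" using Y by auto
  show ?case
  proof (cases "a = 0")
    case True
    then show ?thesis using order less.prems by blast
  next
    case False
    then obtain i where i: "Poly_Mapping.lookup a i > 0" by (metis gr0I poly_mapping_eqI lookup_zero)
    show ?thesis
    proof (cases "i < n")
      case False
      then show ?thesis using i less.prems by (intro coeff_outside) (auto simp: in_keys_iff subset_iff)
    next
      case True
      define b where "b = a - mi_unit i"
      have ab: "a = b + mi_unit i" using add_unit_minus[OF i] by (simp add: b_def)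
      have deg: "mi_degree b < mi_degree a" by (simp add: ab mi_degree_add)
      have "\<exists>\<Gamma>. \<forall>y\<in>Y. \<Gamma> y \<in> Y \<rightarrow> carrier R \<and> nab i y = lincomb Y (\<lambda>y. y) (\<Gamma> y)"
        using gen Y True by (intro bchoice) blast
      then obtain \<Gamma> where \<Gamma>: "\<And>y z. y \<in> Y \<Longrightarrow> z \<in> Y \<Longrightarrow> \<Gamma> y z \<in> carrier R"
          "\<And>y. y \<in> Y \<Longrightarrow> nab i y = lincomb Y (\<lambda>y. y) (\<Gamma> y)" by blast
      define w where "w z = series_deriv i (v z) \<oplus> (\<Oplus>x\<in>Y. v x \<otimes> \<Gamma> x z)" for z
      have w: "w \<in> Y \<rightarrow> carrier R" using less.prems \<Gamma> by (auto simp: w_def Pi_iff)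
      have nab0: "nab i \<zero>\<^bsub>N\<^esub> = \<zero>\<^bsub>N\<^esub>"
        using nab_leibniz[OF True R.zero_closed M.zero_closed] True nab_closed[OF True M.zero_closed]
        by simp
      have "lincomb Y (\<lambda>y. y) w = nab i (lincomb Y (\<lambda>y. y) v)"
        unfolding w_def by (rule nab_lincomb[symmetric]) (use True Y id \<Gamma> less.prems in auto)
      then have "lincomb Y (\<lambda>y. y) w = \<zero>\<^bsub>N\<^esub>" using less.prems nab0 by simp
      from less.hyps[OF deg w this less.prems(3)] have "w y b = 0" .
      moreover have "(\<Oplus>x\<in>Y. v x \<otimes> \<Gamma> x y) b = 0"
      proof -
        have "(\<Oplus>x\<in>Y. v x \<otimes> \<Gamma> x y) b = (\<Sum>x\<in>Y. (v x \<otimes> \<Gamma> x y) b)"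
          using Y less.prems \<Gamma> by (intro finsum_coeff) auto
        also have "\<dots> = 0"
        proof (rule sum.neutral, rule ballI)
          fix x assume x: "x \<in> Y"
          have "v x c = 0" if "mi_degree c \<le> mi_degree b" for c
            using less.hyps[OF _ less.prems(1,2) x, of c] that deg by simp
          then show "(v x \<otimes> \<Gamma> x y) b = 0" unfolding mult_eq by (intro series_mult_eq_0_degree)
        qed
        finally show ?thesis .
      qed
      ultimately have "series_deriv i (v y) b = 0" by (simp add: w_def)
      then show ?thesis by (simp add: series_deriv_def ab del: of_nat_Suc)
    qed
  qed
qed

text \<open>A minimal system of generators is a basis: if a coefficient of a relation is a unit, its
  generator is superfluous.\<close>

lemma basis_exists: "\<exists>Y. basis Y (\<lambda>y. y)"
proof -
  define P where "P Y \<longleftrightarrow> finite Y \<and> Y \<subseteq> carrier N \<and> span_mod R N Y = carrier N" for Y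
  obtain Y0 where "P Y0" using finite_type by (auto simp: finite_type_def P_def)
  then obtain Y where PY: "P Y" and least: "\<And>Z. P Z \<Longrightarrow> card Y \<le> card Z"
    using ex_has_least_nat[of P Y0 card] by blast
  have Y: "finite Y" "Y \<subseteq> carrier N" using PY by (auto simp: P_def)
  have id: "(\<lambda>y. y) \<in> Y \<rightarrow> carrier N" using Y by auto
  have gen: "\<exists>v\<in>Y \<rightarrow> carrier R. x = lincomb Y (\<lambda>y. y) v" if "x \<in> carrier N" for x
    using that PY span_mod_finite[OF Y] by (auto simp: P_def)
  have order: "v y 0 = 0" if v: "v \<in> Y \<rightarrow> carrier R" "lincomb Y (\<lambda>y. y) v = \<zero>\<^bsub>N\<^esub>" and y: "y \<in> Y" for v y
  proof (rule ccontr)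
    assume nz: "v y 0 \<noteq> 0"
    have vy: "v y \<in> carrier R" using v y by auto
    obtain g where g: "g \<in> carrier R" "v y \<otimes> g = \<one>" using inverse_exists[OF vy nz] by blast
    define Z where "Z = Y - {y}"
    have Z: "finite Z" "Z \<subseteq> carrier N" "y \<notin> Z" "insert y Z = Y" using Y y by (auto simp: Z_def)
    have ZS: "submodule (span_mod R N Z) R N" by (rule span_mod_submodule[OF Z(2)])
    let ?l = "lincomb Z (\<lambda>y. y) v"
    have lS: "?l \<in> span_mod R N Z"
      by (rule lincomb_in_submodule[OF ZS]) (use span_mod_base[of Z] v Z in auto)
    have lN: "?l \<in> carrier N" using lS submoduleE(1)[OF ZS] by blast
    have yN: "y \<in> carrier N" using Y y by blast
    have "v y \<odot>\<^bsub>N\<^esub> y \<oplus>\<^bsub>N\<^esub> ?l = \<zero>\<^bsub>N\<^esub>"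
      using lincomb_insert[of Z y "\<lambda>y. y" v] Z v id by simp
    then have "v y \<odot>\<^bsub>N\<^esub> y = \<ominus>\<^bsub>N\<^esub> ?l" using lN yN vy by (metis M.minus_equality smult_closed)
    then have "v y \<odot>\<^bsub>N\<^esub> y \<in> span_mod R N Z" using submoduleE(3)[OF ZS lS] by simp
    then have "g \<odot>\<^bsub>N\<^esub> (v y \<odot>\<^bsub>N\<^esub> y) \<in> span_mod R N Z" by (rule submoduleE(4)[OF ZS g(1)])
    then have "y \<in> span_mod R N Z"
      using g vy yN by (simp add: smult_assoc1[symmetric] R.m_comm)
    then have "Y \<subseteq> span_mod R N Z" using Z span_mod_base[of Z] by blast
    then have "span_mod R N Y \<subseteq> span_mod R N Z" by (rule span_mod_least[OF ZS])
    then have "P Z" using Z PY submoduleE(1)[OF ZS] by (auto simp: P_def)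
    then have "card Y \<le> card (Y - {y})" using least by (simp only: Z_def)
    with card_Diff1_less[OF Y(1) y] show False by linarith
  qed
  have "basis Y (\<lambda>y. y)"
    unfolding basis_def
  proof (intro conjI Y id ballI gen impI)
    fix v y assume v: "v \<in> Y \<rightarrow> carrier R" "lincomb Y (\<lambda>y. y) v = \<zero>\<^bsub>N\<^esub>" and y: "y \<in> Y"
    have "v y a = 0" for a by (rule relation_order[OF Y _ _ v y]) (use gen order in auto)
    then show "v y = \<zero>" by (intro ext) simp
  qed
  then show ?thesis by blast
qed

subsection \<open>The radial operator\<close>

text \<open>The action \<open>E = \<Sum>\<^sub>i x\<^sub>i \<nabla>\<^sub>i\<close> of the Euler derivation.\<close>

definition radial :: "'a \<Rightarrow> 'a" where
  "radial x = (\<Oplus>\<^bsub>N\<^esub>i\<in>{..<n}. series_var i \<odot>\<^bsub>N\<^esub> nab i x)"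

lemma radial_closed [simp, intro]: "x \<in> carrier N \<Longrightarrow> radial x \<in> carrier N"
  by (simp add: radial_def Pi_iff)

lemma radial_add:
  assumes "x \<in> carrier N" "y \<in> carrier N"
  shows "radial (x \<oplus>\<^bsub>N\<^esub> y) = radial x \<oplus>\<^bsub>N\<^esub> radial y"
proof -
  have "radial (x \<oplus>\<^bsub>N\<^esub> y) =
      (\<Oplus>\<^bsub>N\<^esub>i\<in>{..<n}. series_var i \<odot>\<^bsub>N\<^esub> nab i x \<oplus>\<^bsub>N\<^esub> series_var i \<odot>\<^bsub>N\<^esub> nab i y)"
    unfolding radial_def using assms by (intro M.finsum_cong') (auto simp: nab_add smult_r_distr)
  then show ?thesis using assms by (simp add: radial_def Pi_iff)
qed

lemma finsum_smult_right:
  assumes "finite A" "f \<in> A \<rightarrow> carrier R" "x \<in> carrier N"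
  shows "(\<Oplus>\<^bsub>N\<^esub>i\<in>A. f i \<odot>\<^bsub>N\<^esub> x) = (\<Oplus>i\<in>A. f i) \<odot>\<^bsub>N\<^esub> x"
  using assms by (induction A) (simp_all add: M.finsum_insert R.finsum_insert Pi_iff smult_l_distr)

lemma radial_leibniz:
  assumes r: "r \<in> carrier R" and x: "x \<in> carrier N"
  shows "radial (r \<odot>\<^bsub>N\<^esub> x) = euler r \<odot>\<^bsub>N\<^esub> x \<oplus>\<^bsub>N\<^esub> r \<odot>\<^bsub>N\<^esub> radial x"
proof -
  have "radial (r \<odot>\<^bsub>N\<^esub> x) = (\<Oplus>\<^bsub>N\<^esub>i\<in>{..<n}. (series_var i \<otimes> series_deriv i r) \<odot>\<^bsub>N\<^esub> x \<oplus>\<^bsub>N\<^esub>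
      r \<odot>\<^bsub>N\<^esub> (series_var i \<odot>\<^bsub>N\<^esub> nab i x))"
    unfolding radial_def using r x
    by (intro M.finsum_cong')
      (auto simp: nab_leibniz smult_r_distr smult_assoc1[symmetric] R.m_comm)
  also have "\<dots> = (\<Oplus>\<^bsub>N\<^esub>i\<in>{..<n}. (series_var i \<otimes> series_deriv i r) \<odot>\<^bsub>N\<^esub> x) \<oplus>\<^bsub>N\<^esub>
      (\<Oplus>\<^bsub>N\<^esub>i\<in>{..<n}. r \<odot>\<^bsub>N\<^esub> (series_var i \<odot>\<^bsub>N\<^esub> nab i x))"
    using r x by (intro M.finsum_addf) (auto simp: Pi_iff)
  also have "\<dots> = euler r \<odot>\<^bsub>N\<^esub> x \<oplus>\<^bsub>N\<^esub> r \<odot>\<^bsub>N\<^esub> radial x"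
    using r x by (simp add: finsum_smult_right finsum_smult_ldistr radial_def euler_def Pi_iff)
  finally show ?thesis .
qed

lemma radial_in_mN: "x \<in> carrier N \<Longrightarrow> radial x \<in> mN"
  unfolding radial_def
proof (rule submodule_finsum[OF mN_submodule], rule Pi_I)
  fix i assume "x \<in> carrier N" "i \<in> {..<n}"
  then show "series_var i \<odot>\<^bsub>N\<^esub> nab i x \<in> mN"
    unfolding mN_def by (intro ideal_times_mem) (auto simp: max_id_def)
qed

text \<open>In a basis, \<open>E + c\<close>, where \<open>E\<close> is the radial operator, is a triangular system whose diagonal
  entry in degree \<open>d\<close> is \<open>d + c\<close>.\<close>

lemma radial_matrix:
  assumes b: "basis I e"
  shows "\<exists>A. (\<forall>i\<in>I. \<forall>j\<in>I. A i j \<in> carrier R \<and> A i j 0 = 0) \<and> (\<forall>v\<in>I \<rightarrow> carrier R.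
    radial (lincomb I e v) = lincomb I e (\<lambda>j. euler (v j) \<oplus> (\<Oplus>i\<in>I. v i \<otimes> A i j)))"
proof -
  have I: "finite I" "e \<in> I \<rightarrow> carrier N" using b by (auto simp: basis_def)
  have "radial (e i) \<in> lincomb I e ` (I \<rightarrow> max_id)" if "i \<in> I" for i
    using radial_in_mN[of "e i"] I that ideal_times_basis[OF b max_id_ideal] by (auto simp: mN_def)
  then have "\<exists>A. \<forall>i\<in>I. A i \<in> I \<rightarrow> max_id \<and> radial (e i) = lincomb I e (A i)"
    by (intro bchoice) blast
  then obtain A where A: "\<And>i j. i \<in> I \<Longrightarrow> j \<in> I \<Longrightarrow> A i j \<in> carrier R \<and> A i j 0 = 0"
      "\<And>i. i \<in> I \<Longrightarrow> radial (e i) = lincomb I e (A i)"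
    by (auto simp: max_id_def Pi_iff)
  have "radial (lincomb I e v) = lincomb I e (\<lambda>j. euler (v j) \<oplus> (\<Oplus>i\<in>I. v i \<otimes> A i j))"
    if "v \<in> I \<rightarrow> carrier R" for v
    by (rule leibniz_lincomb) (use radial_add radial_leibniz I A that in auto)
  with A(1) show ?thesis by blast
qed

lemma system_coeff:
  assumes I: "finite I" and A: "\<And>i j. i \<in> I \<Longrightarrow> j \<in> I \<Longrightarrow> A i j \<in> carrier R \<and> A i j 0 = 0"
    and v: "v \<in> I \<rightarrow> carrier R" and j: "j \<in> I"
  shows "(euler (v j) \<oplus> (\<Oplus>i\<in>I. v i \<otimes> A i j)) a =
    of_nat (mi_degree a) * v j a + (\<Sum>i\<in>I. series_mult (v i) (A i j) a)"
  using assms by (subst plus_coeff, subst euler_coeff, blast, subst finsum_coeff)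
    (auto simp: mult_eq times_closed Pi_iff)

lemma radial_shift_lincomb:
  assumes b: "basis I e" and v: "v \<in> I \<rightarrow> carrier R"
    and A: "\<And>i j. i \<in> I \<Longrightarrow> j \<in> I \<Longrightarrow> A i j \<in> carrier R \<and> A i j 0 = 0"
    and rad: "radial (lincomb I e v) = lincomb I e (\<lambda>j. euler (v j) \<oplus> (\<Oplus>i\<in>I. v i \<otimes> A i j))"
    and w: "w \<in> I \<rightarrow> carrier R"
  shows "radial (lincomb I e v) \<oplus>\<^bsub>N\<^esub> const_series (of_nat c) \<odot>\<^bsub>N\<^esub> lincomb I e v = lincomb I e w \<longleftrightarrow>
    solves_system (\<lambda>d. of_nat (d + c)) I A w v"
proof -
  have I: "finite I" "e \<in> I \<rightarrow> carrier N" using b by (auto simp: basis_def)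
  define z where "z j = (euler (v j) \<oplus> (\<Oplus>i\<in>I. v i \<otimes> A i j)) \<oplus> const_series (of_nat c) \<otimes> v j" for j
  have z: "z \<in> I \<rightarrow> carrier R" using v A by (auto simp: z_def Pi_iff)
  have "radial (lincomb I e v) \<oplus>\<^bsub>N\<^esub> const_series (of_nat c) \<odot>\<^bsub>N\<^esub> lincomb I e v = lincomb I e z"
    unfolding rad z_def lincomb_smult[OF I v const_closed, symmetric]
    by (rule lincomb_add[symmetric]) (use I v A in \<open>auto simp: Pi_iff\<close>)
  moreover have "z j a = of_nat (mi_degree a + c) * v j a + (\<Sum>i\<in>I. series_mult (v i) (A i j) a)"
    if "j \<in> I" for j a
    using system_coeff[OF I(1) A v that, where a = a] by (simp add: z_def algebra_simps)
  then have "solves_system (\<lambda>d. of_nat (d + c)) I A w v \<longleftrightarrow> (\<forall>j\<in>I. z j = w j)"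
    by (auto simp: solves_system_def fun_eq_iff)
  moreover have "lincomb I e z = lincomb I e w \<longleftrightarrow> (\<forall>j\<in>I. z j = w j)"
    using basis_unique[OF b z w] lincomb_cong[OF I(2) w] by blast
  ultimately show ?thesis by simp
qed

text \<open>\<open>E + c\<close> is surjective for \<open>c \<ge> 1\<close>.\<close>

lemma radial_shift_surj:
  assumes c: "c \<ge> 1" and x: "x \<in> carrier N"
  shows "\<exists>u\<in>carrier N. radial u \<oplus>\<^bsub>N\<^esub> const_series (of_nat c) \<odot>\<^bsub>N\<^esub> u = x"
proof -
  obtain I where b: "basis I (\<lambda>y. y)" using basis_exists by blast
  let ?e = "\<lambda>y. y"
  have I: "finite I" "?e \<in> I \<rightarrow> carrier N" using b by (auto simp: basis_def)
  obtain A where A: "\<And>i j. i \<in> I \<Longrightarrow> j \<in> I \<Longrightarrow> A i j \<in> carrier R \<and> A i j 0 = 0"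
    "\<And>v. v \<in> I \<rightarrow> carrier R \<Longrightarrow>
      radial (lincomb I ?e v) = lincomb I ?e (\<lambda>j. euler (v j) \<oplus> (\<Oplus>i\<in>I. v i \<otimes> A i j))"
    using radial_matrix[OF b] by blast
  obtain w where w: "w \<in> I \<rightarrow> carrier R" "x = lincomb I ?e w" using b x by (auto simp: basis_def)
  obtain v where v: "v \<in> I \<rightarrow> carrier R" "solves_system (\<lambda>d. of_nat (d + c)) I A w v"
    by (rule solve_system[OF I(1) w(1), of A "\<lambda>d. d + c"]) (use A c in auto)
  then have "radial (lincomb I ?e v) \<oplus>\<^bsub>N\<^esub> const_series (of_nat c) \<odot>\<^bsub>N\<^esub> lincomb I ?e v = x"
    using radial_shift_lincomb[OF b v(1) A(1) A(2)[OF v(1)] w(1)] w by simp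
  then show ?thesis using I v by blast
qed

text \<open>\<open>E + c\<close> is injective for \<open>c \<ge> 1\<close>, and also for \<open>c = 0\<close> on \<open>\<mm> N\<close>.\<close>

lemma radial_shift_inj:
  assumes c: "c \<ge> 1 \<or> u \<in> mN" and u: "u \<in> carrier N"
    and eq: "radial u \<oplus>\<^bsub>N\<^esub> const_series (of_nat c) \<odot>\<^bsub>N\<^esub> u = \<zero>\<^bsub>N\<^esub>"
  shows "u = \<zero>\<^bsub>N\<^esub>"
proof -
  obtain I where b: "basis I (\<lambda>y. y)" using basis_exists by blast
  let ?e = "\<lambda>y. y"
  have I: "finite I" "?e \<in> I \<rightarrow> carrier N" using b by (auto simp: basis_def)
  obtain A where A: "\<And>i j. i \<in> I \<Longrightarrow> j \<in> I \<Longrightarrow> A i j \<in> carrier R \<and> A i j 0 = 0"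
    "\<And>v. v \<in> I \<rightarrow> carrier R \<Longrightarrow>
      radial (lincomb I ?e v) = lincomb I ?e (\<lambda>j. euler (v j) \<oplus> (\<Oplus>i\<in>I. v i \<otimes> A i j))"
    using radial_matrix[OF b] by blast
  obtain v where v: "v \<in> I \<rightarrow> carrier R" "u = lincomb I ?e v"
      and v0: "c \<ge> 1 \<or> (\<forall>i\<in>I. v i 0 = 0)"
  proof (cases "u \<in> mN")
    case True
    then obtain v where "v \<in> I \<rightarrow> max_id" "u = lincomb I ?e v"
      using ideal_times_basis[OF b max_id_ideal] by (auto simp: mN_def)
    then show thesis by (intro that) (auto simp: max_id_def)
  next
    case False
    then show thesis using b u c that by (auto simp: basis_def)
  qed
  have "lincomb I ?e (\<lambda>i. \<zero>) = \<zero>\<^bsub>N\<^esub>" using I by (intro lincomb_zero) auto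
  then have s: "solves_system (\<lambda>d. of_nat (d + c)) I A (\<lambda>i. \<zero>) v"
    using radial_shift_lincomb[OF b v(1) A(1) A(2)[OF v(1)], of "\<lambda>i. \<zero>" c] eq v(2) by auto
  \<comment> \<open>for \<open>c = 0\<close> the diagonal entry in degree \<open>0\<close> is irrelevant, as \<open>v\<close> has no constant term\<close>
  have s': "solves_system (\<lambda>d. of_nat (max 1 (d + c))) I A (\<lambda>i a. 0) v"
    unfolding solves_system_def
  proof (intro ballI allI)
    fix i a assume i: "i \<in> I"
    have "of_nat (max 1 (mi_degree a + c)) * v i a = of_nat (mi_degree a + c) * v i a"
    proof (cases "mi_degree a + c = 0")
      case True
      then have "v i a = 0" using v0 i by (auto simp: mi_degree_eq_0_iff)
      then show ?thesis by simp
    next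
      case False
      then have "max 1 (mi_degree a + c) = mi_degree a + c" by linarith
      then show ?thesis by (simp only:)
    qed
    moreover have "of_nat (mi_degree a + c) * v i a + (\<Sum>j\<in>I. series_mult (v j) (A j i) a) = 0"
      using s i unfolding solves_system_def zero_coeff by blast
    ultimately show "of_nat (max 1 (mi_degree a + c)) * v i a + (\<Sum>j\<in>I. series_mult (v j) (A j i) a) = 0"
      by (simp only:)
  qed
  have "v i a = 0" if "i \<in> I" for i a
    by (rule solves_system_zero[OF _ _ s' that]) (use A in \<open>auto simp del: of_nat_max\<close>)
  then have "v i = \<zero>" if "i \<in> I" for i using that by (intro ext) simp
  then show ?thesis using v(2) I by (auto intro: lincomb_zero)
qed

text \<open>The equation \<open>E u = - E x\<close> has a solution in \<open>\<mm> N\<close>. The diagonal entry \<open>0\<close> in degree \<open>0\<close> may be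
  replaced by \<open>1\<close>, because the right-hand side has no constant terms.\<close>

lemma radial_lift:
  assumes x: "x \<in> carrier N"
  shows "\<exists>u\<in>mN. radial (x \<oplus>\<^bsub>N\<^esub> u) = \<zero>\<^bsub>N\<^esub>"
proof -
  obtain I where b: "basis I (\<lambda>y. y)" using basis_exists by blast
  let ?e = "\<lambda>y. y"
  have I: "finite I" "?e \<in> I \<rightarrow> carrier N" using b by (auto simp: basis_def)
  obtain A where A: "\<And>i j. i \<in> I \<Longrightarrow> j \<in> I \<Longrightarrow> A i j \<in> carrier R \<and> A i j 0 = 0"
    "\<And>v. v \<in> I \<rightarrow> carrier R \<Longrightarrow>
      radial (lincomb I ?e v) = lincomb I ?e (\<lambda>j. euler (v j) \<oplus> (\<Oplus>i\<in>I. v i \<otimes> A i j))"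
    using radial_matrix[OF b] by blast
  have "\<ominus>\<^bsub>N\<^esub> radial x \<in> mN" by (rule submoduleE(3)[OF mN_submodule radial_in_mN[OF x]])
  then obtain w where w: "w \<in> I \<rightarrow> max_id" "\<ominus>\<^bsub>N\<^esub> radial x = lincomb I ?e w"
    using ideal_times_basis[OF b max_id_ideal] by (auto simp: mN_def)
  have wR: "w \<in> I \<rightarrow> carrier R" using w max_id_subset by blast
  obtain v where v: "v \<in> I \<rightarrow> carrier R" "solves_system (\<lambda>d. of_nat (max 1 d)) I A w v"
    by (rule solve_system[OF I(1) wR, of A "\<lambda>d. max 1 d"]) (use A in auto)
  have v0: "v i 0 = 0" if "i \<in> I" for i
  proof -
    have "of_nat (max 1 (mi_degree 0)) * v i 0 + (\<Sum>j\<in>I. series_mult (v j) (A j i) 0) = w i 0"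
      using v(2) that unfolding solves_system_def by blast
    then show ?thesis using w(1) A that by (auto simp: max_id_def Pi_iff)
  qed
  have "solves_system (\<lambda>d. of_nat (d + 0)) I A w v"
    unfolding solves_system_def
  proof (intro ballI allI)
    fix i a assume i: "i \<in> I"
    have "of_nat (max 1 (mi_degree a)) * v i a = of_nat (mi_degree a + 0) * v i a"
    proof (cases "mi_degree a = 0")
      case True
      then have "v i a = 0" using v0 i by (auto simp: mi_degree_eq_0_iff)
      then show ?thesis by simp
    next
      case False
      then have "max 1 (mi_degree a) = mi_degree a + 0" by linarith
      then show ?thesis by (simp only:)
    qed
    moreover have "of_nat (max 1 (mi_degree a)) * v i a + (\<Sum>j\<in>I. series_mult (v j) (A j i) a) = w i a"
      using v(2) i unfolding solves_system_def by blast
    ultimately show "of_nat (mi_degree a + 0) * v i a + (\<Sum>j\<in>I. series_mult (v j) (A j i) a) = w i a"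
      by (simp only:)
  qed
  then have "radial (lincomb I ?e v) \<oplus>\<^bsub>N\<^esub> const_series (of_nat 0) \<odot>\<^bsub>N\<^esub> lincomb I ?e v = \<ominus>\<^bsub>N\<^esub> radial x"
    using radial_shift_lincomb[OF b v(1) A(1) A(2)[OF v(1)] wR, of 0] w by simp
  moreover have u: "lincomb I ?e v \<in> carrier N" using I v by blast
  moreover have "const_series (of_nat 0) = \<zero>" by (simp add: zero_eq)
  ultimately have "radial (lincomb I ?e v) = \<ominus>\<^bsub>N\<^esub> radial x" by simp
  then have "radial (x \<oplus>\<^bsub>N\<^esub> lincomb I ?e v) = \<zero>\<^bsub>N\<^esub>" using x u by (simp add: radial_add M.r_neg)
  moreover have "lincomb I ?e v \<in> mN"
    using v v0 ideal_times_basis[OF b max_id_ideal] by (auto simp: mN_def max_id_def Pi_iff)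
  ultimately show ?thesis by blast
qed

end

subsection \<open>Flat connections\<close>

text \<open>A connection is flat if the \<open>\<nabla>\<^sub>i\<close> commute, that is, if it is an action of the Lie algebra
  \<open>T\<^sub>R\<close>.\<close>

locale flat_connection = connection +
  assumes nab_commute: "i < n \<Longrightarrow> j < n \<Longrightarrow> x \<in> carrier N \<Longrightarrow> nab i (nab j x) = nab j (nab i x)"
begin

text \<open>The horizontal elements.\<close>

definition hor :: "'b set" where
  "hor = {x \<in> carrier N. \<forall>i<n. nab i x = \<zero>\<^bsub>N\<^esub>}"

lemma hor_subset: "hor \<subseteq> carrier N"
  by (auto simp: hor_def)

lemma nab_finsum:
  assumes "i < n" "finite A" "F \<in> A \<rightarrow> carrier N"
  shows "nab i (\<Oplus>\<^bsub>N\<^esub>j\<in>A. F j) = (\<Oplus>\<^bsub>N\<^esub>j\<in>A. nab i (F j))"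
  by (rule additive_finsum_module) (use assms nab_add in auto)

text \<open>\<open>E \<nabla>\<^sub>i x = \<nabla>\<^sub>i E x - \<nabla>\<^sub>i x\<close>, so \<open>E x = 0\<close> implies \<open>(E + 1) \<nabla>\<^sub>i x = 0\<close>.\<close>

lemma hor_iff_radial: "x \<in> hor \<longleftrightarrow> x \<in> carrier N \<and> radial x = \<zero>\<^bsub>N\<^esub>"
proof
  assume x: "x \<in> hor"
  then have "radial x = \<zero>\<^bsub>N\<^esub>"
    unfolding radial_def by (intro M.add.finprod_one_eqI) (auto simp: hor_def)
  then show "x \<in> carrier N \<and> radial x = \<zero>\<^bsub>N\<^esub>" using x by (simp add: hor_def)
next
  assume x: "x \<in> carrier N \<and> radial x = \<zero>\<^bsub>N\<^esub>"
  have "nab i x = \<zero>\<^bsub>N\<^esub>" if i: "i < n" for i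
  proof (rule radial_shift_inj[of 1])
    have nab0: "nab i \<zero>\<^bsub>N\<^esub> = \<zero>\<^bsub>N\<^esub>" using nab_finsum[OF i, of "{}" "\<lambda>_. \<zero>\<^bsub>N\<^esub>"] by simp
    have "nab i (radial x) = (\<Oplus>\<^bsub>N\<^esub>j\<in>{..<n}. nab i (series_var j \<odot>\<^bsub>N\<^esub> nab j x))"
      unfolding radial_def using x i by (intro nab_finsum) auto
    also have "\<dots> = (\<Oplus>\<^bsub>N\<^esub>j\<in>{..<n}. (if i = j then nab j x else \<zero>\<^bsub>N\<^esub>) \<oplus>\<^bsub>N\<^esub> series_var j \<odot>\<^bsub>N\<^esub> nab j (nab i x))"
      using x i by (intro M.finsum_cong') (auto simp: nab_leibniz deriv_var nab_commute[of i])
    also have "\<dots> = (\<Oplus>\<^bsub>N\<^esub>j\<in>{..<n}. if i = j then nab j x else \<zero>\<^bsub>N\<^esub>) \<oplus>\<^bsub>N\<^esub> radial (nab i x)"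
      unfolding radial_def using x i by (intro M.finsum_addf) auto
    also have "(\<Oplus>\<^bsub>N\<^esub>j\<in>{..<n}. if i = j then nab j x else \<zero>\<^bsub>N\<^esub>) = nab i x"
      using x i by (intro M.finsum_singleton) auto
    finally have "nab i x \<oplus>\<^bsub>N\<^esub> radial (nab i x) = \<zero>\<^bsub>N\<^esub>" using x nab0 by simp
    moreover have "const_series (of_nat 1) = \<one>" by (simp add: one_eq)
    ultimately show "radial (nab i x) \<oplus>\<^bsub>N\<^esub> const_series (of_nat 1) \<odot>\<^bsub>N\<^esub> nab i x = \<zero>\<^bsub>N\<^esub>"
      using x i by (simp add: M.a_comm)
  qed (use x i in auto)
  then show "x \<in> hor" using x by (simp add: hor_def)
qed

lemma hor_lift: "x \<in> carrier N \<Longrightarrow> \<exists>u\<in>mN. x \<oplus>\<^bsub>N\<^esub> u \<in> hor"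
  using radial_lift[of x] mN_subset by (auto simp: hor_iff_radial)

lemma hor_in_mN:
  assumes "x \<in> hor" "x \<in> mN" shows "x = \<zero>\<^bsub>N\<^esub>"
proof (rule radial_shift_inj[of 0])
  have "const_series (of_nat 0) = \<zero>" by (simp add: zero_eq)
  then show "radial x \<oplus>\<^bsub>N\<^esub> const_series (of_nat 0) \<odot>\<^bsub>N\<^esub> x = \<zero>\<^bsub>N\<^esub>"
    using assms by (simp add: hor_iff_radial)
qed (use assms hor_subset in auto)

lemma hor_add: "x \<in> hor \<Longrightarrow> y \<in> hor \<Longrightarrow> x \<oplus>\<^bsub>N\<^esub> y \<in> hor"
  by (simp add: hor_def nab_add)

lemma hor_const_smult: "x \<in> hor \<Longrightarrow> const_series c \<odot>\<^bsub>N\<^esub> x \<in> hor"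
  by (simp add: hor_def nab_leibniz)

lemma hor_zero: "\<zero>\<^bsub>N\<^esub> \<in> hor"
  using nab_finsum[of _ "{}" "\<lambda>_. \<zero>\<^bsub>N\<^esub>"] by (auto simp: hor_def)

lemma hor_minus:
  assumes "x \<in> hor" shows "\<ominus>\<^bsub>N\<^esub> x \<in> hor"
proof -
  have "\<ominus>\<^bsub>N\<^esub> x = const_series (- 1) \<odot>\<^bsub>N\<^esub> x"
    using assms hor_subset by (simp add: minus_eq_smult subsetD one_eq const_minus)
  then show ?thesis using hor_const_smult[OF assms] by simp
qed

lemma nab_hor_lincomb:
  assumes i: "i < n" and I: "finite I" and h: "h \<in> I \<rightarrow> hor" and v: "v \<in> I \<rightarrow> carrier R"
  shows "nab i (lincomb I h v) = lincomb I h (\<lambda>j. series_deriv i (v j))"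
proof -
  have hN: "h \<in> I \<rightarrow> carrier N" using h hor_subset by blast
  have "nab i (lincomb I h v) = (\<Oplus>\<^bsub>N\<^esub>j\<in>I. nab i (v j \<odot>\<^bsub>N\<^esub> h j))"
    unfolding lincomb_def using i I hN v by (intro nab_finsum) (auto simp: Pi_iff)
  also have "\<dots> = lincomb I h (\<lambda>j. series_deriv i (v j))"
    unfolding lincomb_def using i h hN v
    by (intro M.finsum_cong') (auto simp: Pi_iff nab_leibniz hor_def)
  finally show ?thesis .
qed

text \<open>The horizontal representatives of the classes of a basis differ from it by a matrix \<open>1 + B\<close>
  with \<open>B\<close> over \<open>\<mm>\<close>, which is invertible by the case \<open>\<lambda> = 1\<close> of the triangular systems.\<close>

lemma hor_basis_exists: "\<exists>I (h :: 'b \<Rightarrow> 'b). basis I h \<and> h \<in> I \<rightarrow> hor"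
proof -
  obtain I where b: "basis I (\<lambda>y. y)" using basis_exists by blast
  let ?e = "\<lambda>y. y"
  have I: "finite I" "?e \<in> I \<rightarrow> carrier N" using b by (auto simp: basis_def)
  have "\<exists>B. \<forall>y\<in>I. B y \<in> I \<rightarrow> max_id \<and> y \<oplus>\<^bsub>N\<^esub> lincomb I ?e (B y) \<in> hor"
  proof (rule bchoice, rule ballI)
    fix y assume "y \<in> I"
    then obtain u where "u \<in> mN" "y \<oplus>\<^bsub>N\<^esub> u \<in> hor" using hor_lift[of y] I by auto
    then show "\<exists>B. B \<in> I \<rightarrow> max_id \<and> y \<oplus>\<^bsub>N\<^esub> lincomb I ?e B \<in> hor"
      using ideal_times_basis[OF b max_id_ideal] by (auto simp: mN_def)
  qed
  then obtain B where B: "\<And>y z. y \<in> I \<Longrightarrow> z \<in> I \<Longrightarrow> B y z \<in> max_id"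
      "\<And>y. y \<in> I \<Longrightarrow> y \<oplus>\<^bsub>N\<^esub> lincomb I ?e (B y) \<in> hor" by blast
  have BR: "B y z \<in> carrier R \<and> B y z 0 = 0" if "y \<in> I" "z \<in> I" for y z
    using B(1)[OF that] by (simp add: max_id_def)
  define h where "h y = y \<oplus>\<^bsub>N\<^esub> lincomb I ?e (B y)" for y
  have h: "h \<in> I \<rightarrow> hor" using B by (auto simp: h_def)
  then have hN: "h \<in> I \<rightarrow> carrier N" using hor_subset by blast
  have h_lincomb: "lincomb I h v = lincomb I ?e w \<longleftrightarrow> solves_system (\<lambda>d. of_nat 1) I B w v"
    if v: "v \<in> I \<rightarrow> carrier R" and w: "w \<in> I \<rightarrow> carrier R" for v w
  proof -
    define z where "z j = v j \<oplus> (\<Oplus>i\<in>I. v i \<otimes> B i j)" for j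
    have z: "z \<in> I \<rightarrow> carrier R" using v BR by (auto simp: z_def Pi_iff)
    have "lincomb I h v = (\<Oplus>\<^bsub>N\<^esub>i\<in>I. v i \<odot>\<^bsub>N\<^esub> i \<oplus>\<^bsub>N\<^esub> v i \<odot>\<^bsub>N\<^esub> lincomb I ?e (B i))"
      unfolding lincomb_def[of I h] h_def using v BR I
      by (intro M.finsum_cong') (auto simp: Pi_iff smult_r_distr)
    also have "\<dots> = lincomb I ?e v \<oplus>\<^bsub>N\<^esub> lincomb I (\<lambda>i. lincomb I ?e (B i)) v"
      unfolding lincomb_def[of _ _ v] using v BR I by (intro M.finsum_addf) (auto simp: Pi_iff)
    also have "lincomb I (\<lambda>i. lincomb I ?e (B i)) v = lincomb I ?e (\<lambda>j. \<Oplus>i\<in>I. v i \<otimes> B i j)"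
      by (rule lincomb_lincomb) (use I BR v in auto)
    also have "lincomb I ?e v \<oplus>\<^bsub>N\<^esub> \<dots> = lincomb I ?e z"
      unfolding z_def using I BR v by (intro lincomb_add[symmetric]) (auto simp: Pi_iff)
    finally have eq: "lincomb I h v = lincomb I ?e z" .
    have "z j a = of_nat 1 * v j a + (\<Sum>i\<in>I. series_mult (v i) (B i j) a)" if "j \<in> I" for j a
      unfolding z_def plus_coeff using I v BR that
      by (subst finsum_coeff) (auto simp: mult_eq times_closed Pi_iff)
    then have "solves_system (\<lambda>d. of_nat 1) I B w v \<longleftrightarrow> (\<forall>j\<in>I. z j = w j)"
      by (simp add: solves_system_def fun_eq_iff)
    moreover have "lincomb I ?e z = lincomb I ?e w \<longleftrightarrow> (\<forall>j\<in>I. z j = w j)"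
      using basis_unique[OF b z w] lincomb_cong[OF I(2) w] by blast
    ultimately show ?thesis using eq by simp
  qed
  have "basis I h"
    unfolding basis_def
  proof (intro conjI I(1) hN ballI impI)
    fix x assume "x \<in> carrier N"
    then obtain w where w: "w \<in> I \<rightarrow> carrier R" "x = lincomb I ?e w" using b by (auto simp: basis_def)
    obtain v where v: "v \<in> I \<rightarrow> carrier R" "solves_system (\<lambda>d. of_nat 1) I B w v"
      using solve_system[of I w B "\<lambda>d. 1", OF I(1) w(1) BR order_refl] by blast
    have "x = lincomb I h v" using h_lincomb[OF v(1) w(1)] v(2) w(2) by simp
    then show "\<exists>v\<in>I \<rightarrow> carrier R. x = lincomb I h v" using v(1) by blast
  next
    fix v i assume v: "v \<in> I \<rightarrow> carrier R" and v0: "lincomb I h v = \<zero>\<^bsub>N\<^esub>" and i: "i \<in> I"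
    have "lincomb I ?e (\<lambda>i. \<zero>) = \<zero>\<^bsub>N\<^esub>" using I by (intro lincomb_zero) auto
    then have "solves_system (\<lambda>d. of_nat 1) I B (\<lambda>i. \<zero>) v" using h_lincomb[OF v, of "\<lambda>i. \<zero>"] v0 by auto
    then have s: "solves_system (\<lambda>d. of_nat 1) I B (\<lambda>i a. 0) v" by (simp add: solves_system_def)
    have "v i a = 0" for a by (rule solves_system_zero[OF _ _ s i]) (use BR in auto)
    then show "v i = \<zero>" by (intro ext) simp
  qed
  then show ?thesis using h by blast
qed

lemma deriv_zero_const:
  assumes f: "f \<in> carrier R" and d: "\<And>i. i < n \<Longrightarrow> series_deriv i f = \<zero>"
  shows "f = const_series (f 0)"
proof
  fix a
  show "f a = const_series (f 0) a"
  proof (cases "a = 0")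
    case False
    then obtain i where i: "Poly_Mapping.lookup a i > 0" by (metis gr0I poly_mapping_eqI lookup_zero)
    have "f a = 0"
    proof (cases "i < n")
      case True
      have "series_deriv i f (a - mi_unit i) = 0" using d[OF True] by simp
      then show ?thesis using add_unit_minus[OF i] by (simp add: series_deriv_def del: of_nat_Suc)
    next
      case False
      then show ?thesis using i f by (intro coeff_outside) (auto simp: in_keys_iff subset_iff)
    qed
    then show ?thesis using False by (simp add: const_coeff)
  qed (simp add: const_coeff)
qed

lemma hor_coords_const:
  assumes b: "basis I h" and h: "h \<in> I \<rightarrow> hor" and v: "v \<in> I \<rightarrow> carrier R"
    and x: "lincomb I h v \<in> hor" and j: "j \<in> I"
  shows "v j = const_series (v j 0)"
proof (rule deriv_zero_const)
  fix i assume i: "i < n"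
  have "lincomb I h (\<lambda>j. series_deriv i (v j)) = \<zero>\<^bsub>N\<^esub>"
    using nab_hor_lincomb[OF i _ h v] x b i by (simp add: hor_def basis_def)
  moreover have "(\<lambda>j. series_deriv i (v j)) \<in> I \<rightarrow> carrier R" using v by auto
  ultimately show "series_deriv i (v j) = \<zero>" using b j by (auto simp: basis_def)
qed (use v j in auto)

subsection \<open>Descent of stable submodules\<close>

text \<open>If a coordinate of an element of a stable submodule is not \<open>0\<close>, a suitable higher derivative has
  a unit there, and it has no new nonzero coordinates.\<close>

lemma stable_derivative:
  assumes b: "basis I h" and h: "h \<in> I \<rightarrow> hor"
    and L: "submodule L R N" and stable: "\<And>i x. i < n \<Longrightarrow> x \<in> L \<Longrightarrow> nab i x \<in> L"
    and v: "v \<in> I \<rightarrow> carrier R" "lincomb I h v \<in> L" and j: "j \<in> I" "v j a \<noteq> 0"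
  shows "\<exists>w\<in>I \<rightarrow> carrier R. lincomb I h w \<in> L \<and> w j 0 \<noteq> 0 \<and> (\<forall>i\<in>I. v i = \<zero> \<longrightarrow> w i = \<zero>)"
  using v j
proof (induction "mi_degree a" arbitrary: a v rule: less_induct)
  case less
  show ?case
  proof (cases "a = 0")
    case True
    then show ?thesis using less.prems by blast
  next
    case False
    then obtain i where i: "Poly_Mapping.lookup a i > 0" by (metis gr0I poly_mapping_eqI lookup_zero)
    have vj: "v j \<in> carrier R" using less.prems by auto
    have n: "i < n"
    proof (rule ccontr)
      assume "\<not> i < n"
      then have "\<not> Poly_Mapping.keys a \<subseteq> {..<n}" using i by (auto simp: in_keys_iff subset_iff)
      then show False using coeff_outside[OF vj] less.prems by blast
    qed
    let ?a = "a - mi_unit i" and ?v = "\<lambda>j. series_deriv i (v j)"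
    have "mi_degree ?a < mi_degree a"
      using arg_cong[OF add_unit_minus[OF i], of mi_degree] by (simp add: mi_degree_add)
    moreover have "?v \<in> I \<rightarrow> carrier R" using less.prems by auto
    moreover have "lincomb I h ?v \<in> L"
      using nab_hor_lincomb[OF n _ h less.prems(1)] b stable[OF n less.prems(2)] by (simp add: basis_def)
    moreover have "?v j ?a \<noteq> 0"
      using less.prems add_unit_minus[OF i] by (simp add: series_deriv_def del: of_nat_Suc)
    ultimately obtain w where w: "w \<in> I \<rightarrow> carrier R" "lincomb I h w \<in> L" "w j 0 \<noteq> 0"
        "\<forall>i\<in>I. ?v i = \<zero> \<longrightarrow> w i = \<zero>"
      using less.hyps[of ?a ?v] less.prems by blast
    have "series_deriv i \<zero> = \<zero>" using deriv_const[of i 0] by (simp add: zero_eq)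
    then show ?thesis using w by metis
  qed
qed

text \<open>An element of a stable submodule with the least number of nonzero coordinates can be
  normalised to have a coordinate \<open>1\<close>. Its derivatives then have fewer nonzero coordinates, so it is
  horizontal. The lemma concerns elements supported in \<open>J\<close>, where no horizontal ones are left.\<close>

lemma stable_zero_if_no_hor:
  assumes b: "basis I h" and h: "h \<in> I \<rightarrow> hor"
    and L: "submodule L R N" and stable: "\<And>i x. i < n \<Longrightarrow> x \<in> L \<Longrightarrow> nab i x \<in> L"
    and nohor: "\<And>c. lincomb I h (\<lambda>i. const_series (c i)) \<in> L \<Longrightarrow> \<forall>i\<in>I - J. c i = 0 \<Longrightarrow> \<forall>i\<in>I. c i = 0"
    and v: "v \<in> I \<rightarrow> carrier R" "lincomb I h v \<in> L" "\<forall>i\<in>I - J. v i = \<zero>"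
  shows "\<forall>i\<in>I. v i = \<zero>"
  using v
proof (induction "card {i\<in>I. v i \<noteq> \<zero>}" arbitrary: v rule: less_induct)
  case less
  have I: "finite I" using b by (simp add: basis_def)
  have hN: "h \<in> I \<rightarrow> carrier N" using h hor_subset by blast
  show ?case
  proof (rule ccontr)
    assume "\<not> (\<forall>i\<in>I. v i = \<zero>)"
    then obtain j where j: "j \<in> I" "v j \<noteq> \<zero>" by blast
    then obtain a where "v j a \<noteq> 0" by (metis ext zero_coeff)
    then obtain w where w: "w \<in> I \<rightarrow> carrier R" "lincomb I h w \<in> L" "w j 0 \<noteq> 0"
        "\<forall>i\<in>I. v i = \<zero> \<longrightarrow> w i = \<zero>"
      using stable_derivative[OF b h L stable less.prems(1,2) j(1)] by blast
    obtain g where g: "g \<in> carrier R" "w j \<otimes> g = \<one>"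
      using inverse_exists[of "w j"] w j by blast
    define z where "z i = g \<otimes> w i" for i
    have z: "z \<in> I \<rightarrow> carrier R" using w(1) g(1) by (simp add: z_def Pi_iff)
    have zL: "lincomb I h z \<in> L"
      unfolding z_def lincomb_smult[OF I hN w(1) g(1)] by (rule submoduleE(4)[OF L g(1) w(2)])
    have zj: "z j = \<one>" using g w j by (simp add: z_def R.m_comm Pi_iff)
    have z0: "z i = \<zero>" if "i \<in> I" "v i = \<zero>" for i using w that g by (simp add: z_def)
    have "series_deriv k (z i) = \<zero>" if k: "k < n" and i: "i \<in> I" for k i
    proof -
      let ?d = "\<lambda>i. series_deriv k (z i)"
      have d0: "series_deriv k \<zero> = \<zero>" "series_deriv k \<one> = \<zero>"
        using deriv_const[of k] by (simp_all add: zero_eq one_eq)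
      have sub: "{i\<in>I. ?d i \<noteq> \<zero>} \<subseteq> {i\<in>I. v i \<noteq> \<zero>} - {j}" using z0 zj d0 by force
      have "card {i\<in>I. ?d i \<noteq> \<zero>} \<le> card ({i\<in>I. v i \<noteq> \<zero>} - {j})"
        by (rule card_mono) (use sub I in auto)
      also have "\<dots> < card {i\<in>I. v i \<noteq> \<zero>}" by (rule card_Diff1_less) (use I j in auto)
      finally have "card {i\<in>I. ?d i \<noteq> \<zero>} < card {i\<in>I. v i \<noteq> \<zero>}" .
      moreover have "?d \<in> I \<rightarrow> carrier R" using z by auto
      moreover have "lincomb I h ?d \<in> L" using nab_hor_lincomb[OF k I h z] stable[OF k zL] by simp
      moreover have "\<forall>i\<in>I - J. ?d i = \<zero>" using less.prems(3) z0 d0 by simp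
      ultimately show ?thesis using less.hyps[of ?d] i by blast
    qed
    then have zc: "z i = const_series (z i 0)" if "i \<in> I" for i
      using z that by (intro deriv_zero_const) auto
    have "lincomb I h (\<lambda>i. const_series (z i 0)) = lincomb I h z"
      by (rule lincomb_cong[OF hN z]) (rule zc[symmetric])
    then have "\<forall>i\<in>I. z i 0 = 0" using nohor[of "\<lambda>i. z i 0"] zL less.prems(3) z0 by simp
    then show False using zj j by (auto simp: one_coeff)
  qed
qed

text \<open>For a maximal set \<open>J\<close> of basis elements whose span contains no nonzero horizontal element of
  \<open>L\<close>, the horizontal part of \<open>L\<close> and that span together generate \<open>N\<close>; the component of an element
  of \<open>L\<close> in the span lies in \<open>L\<close> and vanishes by the previous lemma.\<close>

theorem stable_submodule_span_hor:
  assumes L: "submodule L R N" and stable: "\<And>i x. i < n \<Longrightarrow> x \<in> L \<Longrightarrow> nab i x \<in> L"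
  shows "L = span_mod R N (L \<inter> hor)"
proof
  have LN: "L \<subseteq> carrier N" using submoduleE(1)[OF L] .
  show "span_mod R N (L \<inter> hor) \<subseteq> L" by (rule span_mod_least[OF L]) simp
  obtain I :: "'b set" and h :: "'b \<Rightarrow> 'b" where b: "basis I h" and h: "h \<in> I \<rightarrow> hor"
    using hor_basis_exists by blast
  have I: "finite I" "h \<in> I \<rightarrow> carrier N" using b by (auto simp: basis_def)
  let ?S = "span_mod R N (L \<inter> hor)"
  have S: "submodule ?S R N" by (rule span_mod_submodule) (use LN in auto)
  \<comment> \<open>\<open>J\<close> indexes a complement of the horizontal part of \<open>L\<close>\<close>
  define good where "good J \<longleftrightarrow> J \<subseteq> I \<and>
    (\<forall>c. lincomb I h (\<lambda>i. const_series (c i)) \<in> L \<longrightarrow> (\<forall>i\<in>I - J. c i = 0) \<longrightarrow> (\<forall>i\<in>I. c i = 0))" for J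
  have "good {}" by (simp add: good_def)
  moreover have "card J < Suc (card I)" if "good J" for J
    using that I card_mono[of I J] by (auto simp: good_def)
  ultimately obtain J where J: "good J" and max: "\<And>J'. good J' \<Longrightarrow> card J' \<le> card J"
    using ex_has_greatest_nat[of good "{}" card "Suc (card I)"] by (metis less_imp_le)
  have JI: "J \<subseteq> I" "finite J" using J I by (auto simp: good_def intro: finite_subset)
  define T where "T = lincomb J h ` (J \<rightarrow> carrier R)"
  have hJ: "h \<in> J \<rightarrow> carrier N" using I JI by auto
  have T: "submodule T R N" unfolding T_def by (rule lincombs_submodule[OF JI(2) hJ R.oneideal])
  define Q where "Q = {s \<oplus>\<^bsub>N\<^esub> t |s t. s \<in> ?S \<and> t \<in> T}"
  have SN: "?S \<subseteq> carrier N" "T \<subseteq> carrier N" using submoduleE(1) S T by blast+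
  have Q: "submodule Q R N"
  proof (rule submoduleI)
    show "Q \<subseteq> carrier N" using SN by (auto simp: Q_def)
    have "\<zero>\<^bsub>N\<^esub> = \<zero>\<^bsub>N\<^esub> \<oplus>\<^bsub>N\<^esub> \<zero>\<^bsub>N\<^esub>" by simp
    then show "\<zero>\<^bsub>N\<^esub> \<in> Q" unfolding Q_def using submodule_zero[OF S] submodule_zero[OF T] by blast
  next
    fix x assume "x \<in> Q"
    then obtain s t where st: "x = s \<oplus>\<^bsub>N\<^esub> t" "s \<in> ?S" "t \<in> T" by (auto simp: Q_def)
    then have "\<ominus>\<^bsub>N\<^esub> x = \<ominus>\<^bsub>N\<^esub> s \<oplus>\<^bsub>N\<^esub> \<ominus>\<^bsub>N\<^esub> t" using SN by (simp add: M.minus_add subsetD)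
    then show "\<ominus>\<^bsub>N\<^esub> x \<in> Q" unfolding Q_def using st submoduleE(3)[OF S] submoduleE(3)[OF T] by blast
  next
    fix x y assume "x \<in> Q" "y \<in> Q"
    then obtain s t s' t' where st: "x = s \<oplus>\<^bsub>N\<^esub> t" "s \<in> ?S" "t \<in> T" "y = s' \<oplus>\<^bsub>N\<^esub> t'" "s' \<in> ?S" "t' \<in> T"
      by (auto simp: Q_def)
    then have c: "s \<in> carrier N" "t \<in> carrier N" "s' \<in> carrier N" "t' \<in> carrier N" using SN by auto
    have "x \<oplus>\<^bsub>N\<^esub> y = (s \<oplus>\<^bsub>N\<^esub> s') \<oplus>\<^bsub>N\<^esub> (t \<oplus>\<^bsub>N\<^esub> t')" using c by (simp add: st M.a_ac)
    then show "x \<oplus>\<^bsub>N\<^esub> y \<in> Q" unfolding Q_def using st submoduleE(5)[OF S] submoduleE(5)[OF T] by blast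
  next
    fix r x assume r: "r \<in> carrier R" and "x \<in> Q"
    then obtain s t where st: "x = s \<oplus>\<^bsub>N\<^esub> t" "s \<in> ?S" "t \<in> T" by (auto simp: Q_def)
    then have "r \<odot>\<^bsub>N\<^esub> x = r \<odot>\<^bsub>N\<^esub> s \<oplus>\<^bsub>N\<^esub> r \<odot>\<^bsub>N\<^esub> t" using SN r by (simp add: smult_r_distr subsetD)
    then show "r \<odot>\<^bsub>N\<^esub> x \<in> Q" unfolding Q_def using st submoduleE(4)[OF S r] submoduleE(4)[OF T r] by blast
  qed
  have SQ: "s \<in> Q" if "s \<in> ?S" for s
  proof -
    have "s = s \<oplus>\<^bsub>N\<^esub> \<zero>\<^bsub>N\<^esub>" using that SN by (simp add: subsetD)
    then show ?thesis unfolding Q_def using that submodule_zero[OF T] by blast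
  qed
  have TQ: "t \<in> Q" if "t \<in> T" for t
  proof -
    have "t = \<zero>\<^bsub>N\<^esub> \<oplus>\<^bsub>N\<^esub> t" using that SN by (simp add: subsetD)
    then show ?thesis unfolding Q_def using that submodule_zero[OF S] by blast
  qed
  have hJT: "h i \<in> T" if "i \<in> J" for i
    unfolding T_def
    by (rule image_eqI[where x = "\<lambda>j. if i = j then \<one> else \<zero>"])
      (simp_all add: lincomb_unit[OF JI(2) hJ that])
  have hQ: "h i \<in> Q" if i: "i \<in> I" for i
  proof (cases "i \<in> J")
    case True
    then show ?thesis using hJT TQ by blast
  next
    case False
    then have "\<not> good (insert i J)" using max[of "insert i J"] JI by auto
    then obtain c where c: "lincomb I h (\<lambda>i. const_series (c i)) \<in> L" "\<forall>k\<in>I - insert i J. c k = 0"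
        and nz: "\<exists>k\<in>I. c k \<noteq> 0"
      using i JI by (auto simp: good_def)
    have ci: "c i \<noteq> 0"
    proof
      assume "c i = 0"
      then have "\<forall>k\<in>I - J. c k = 0" using c(2) by auto
      then show False using J c(1) nz by (auto simp: good_def)
    qed
    let ?c = "\<lambda>i. const_series (c i)"
    let ?z = "lincomb I h ?c" and ?t = "lincomb J h ?c"
    have "?z \<in> hor"
      unfolding hor_def
    proof (intro CollectI conjI allI impI)
      fix k assume "k < n"
      then have "nab k ?z = lincomb I h (\<lambda>i. \<zero>)" using nab_hor_lincomb[OF _ I(1) h, of k ?c] by simp
      then show "nab k ?z = \<zero>\<^bsub>N\<^esub>" using I by (simp add: lincomb_zero)
    qed (use I in auto)
    then have zS: "?z \<in> ?S" using c(1) span_mod_base[of "L \<inter> hor"] by blast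
    have tT: "?t \<in> T" by (auto simp: T_def)
    have hi: "h i \<in> carrier N" using I i by auto
    have tN: "?t \<in> carrier N" using tT SN by blast
    have "?z = lincomb (insert i J) h ?c"
      unfolding lincomb_def
      by (rule M.add.finprod_mono_neutral_cong_right) (use I i JI c(2) in \<open>auto simp: zero_eq[symmetric] Pi_iff\<close>)
    also have "\<dots> = const_series (c i) \<odot>\<^bsub>N\<^esub> h i \<oplus>\<^bsub>N\<^esub> ?t"
      by (rule lincomb_insert) (use JI False hi hJ in auto)
    finally have "const_series (c i) \<odot>\<^bsub>N\<^esub> h i = ?z \<oplus>\<^bsub>N\<^esub> \<ominus>\<^bsub>N\<^esub> ?t"
      using hi tN by (simp add: M.a_assoc M.r_neg)
    moreover have "?z \<oplus>\<^bsub>N\<^esub> \<ominus>\<^bsub>N\<^esub> ?t \<in> Q"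
      by (rule submoduleE(5)[OF Q SQ[OF zS] submoduleE(3)[OF Q TQ[OF tT]]])
    ultimately have "const_series (inverse (c i)) \<odot>\<^bsub>N\<^esub> (const_series (c i) \<odot>\<^bsub>N\<^esub> h i) \<in> Q"
      using submoduleE(4)[OF Q const_closed] by simp
    moreover have "const_series (inverse (c i)) \<odot>\<^bsub>N\<^esub> (const_series (c i) \<odot>\<^bsub>N\<^esub> h i) = h i"
      using ci hi by (simp add: smult_assoc1[symmetric] const_mult one_eq[symmetric])
    ultimately show ?thesis by simp
  qed
  show "L \<subseteq> ?S"
  proof
    fix x assume x: "x \<in> L"
    then obtain v where v: "v \<in> I \<rightarrow> carrier R" "x = lincomb I h v" using b LN unfolding basis_def by blast
    have "x \<in> Q" unfolding v(2) by (rule lincomb_in_submodule[OF Q _ v(1)]) (use hQ in auto)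
    then obtain s w where s: "s \<in> ?S" and w: "w \<in> J \<rightarrow> carrier R" and x_eq: "x = s \<oplus>\<^bsub>N\<^esub> lincomb J h w"
      by (auto simp: Q_def T_def)
    define w' where "w' i = (if i \<in> J then w i else \<zero>)" for i
    have w': "w' \<in> I \<rightarrow> carrier R" using w by (auto simp: w'_def)
    have t: "lincomb J h w \<in> carrier N" using hJ w by blast
    have sL: "s \<in> L" using s span_mod_least[OF L, of "L \<inter> hor"] by blast
    have sN: "s \<in> carrier N" using s SN by blast
    have "lincomb J h w = \<ominus>\<^bsub>N\<^esub> s \<oplus>\<^bsub>N\<^esub> x" using t sN by (simp add: x_eq M.r_neg1)
    then have "lincomb J h w \<in> L" using submoduleE(5)[OF L submoduleE(3)[OF L sL] x] by simp
    moreover have "lincomb I h w' = lincomb J h w"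
      unfolding lincomb_def w'_def
      by (rule M.add.finprod_mono_neutral_cong_right) (use I JI w in \<open>auto simp: Pi_iff\<close>)
    ultimately have "\<forall>i\<in>I. w' i = \<zero>"
      using J by (intro stable_zero_if_no_hor[OF b h L stable _ w', of J]) (auto simp: good_def w'_def)
    then have "lincomb J h w = \<zero>\<^bsub>N\<^esub>" using \<open>lincomb I h w' = lincomb J h w\<close> I by (metis lincomb_zero)
    then have "x = s" using sN by (simp add: x_eq)
    then show "x \<in> ?S" using s by simp
  qed
qed

end

section \<open>Quotients and tensor products of modules\<close>

lemma ring_module_iff: "ring_module S A \<longleftrightarrow> module S A"
  by (simp add: ring_module_def)

lemma lin_mapsD:
  assumes "h \<in> lin_maps S A C"
  shows "x \<in> carrier A \<Longrightarrow> h x \<in> carrier C"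
    and "x \<in> carrier A \<Longrightarrow> y \<in> carrier A \<Longrightarrow> h (x \<oplus>\<^bsub>A\<^esub> y) = h x \<oplus>\<^bsub>C\<^esub> h y"
    and "s \<in> carrier S \<Longrightarrow> x \<in> carrier A \<Longrightarrow> h (s \<odot>\<^bsub>A\<^esub> x) = s \<odot>\<^bsub>C\<^esub> h x"
  using assms by (auto simp: lin_maps_def)

lemma lin_maps_zero:
  assumes A: "module S A" and C: "module S C" and h: "h \<in> lin_maps S A C"
  shows "h \<zero>\<^bsub>A\<^esub> = \<zero>\<^bsub>C\<^esub>"
proof -
  interpret A: module S A by fact
  interpret C: module S C by fact
  have "h (\<zero>\<^bsub>S\<^esub> \<odot>\<^bsub>A\<^esub> \<zero>\<^bsub>A\<^esub>) = \<zero>\<^bsub>S\<^esub> \<odot>\<^bsub>C\<^esub> h \<zero>\<^bsub>A\<^esub>" by (rule lin_mapsD(3)[OF h]) auto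
  then show ?thesis using lin_mapsD(1)[OF h, of "\<zero>\<^bsub>A\<^esub>"] by simp
qed

lemma lin_maps_minus:
  assumes A: "module S A" and C: "module S C" and h: "h \<in> lin_maps S A C" and x: "x \<in> carrier A"
  shows "h (\<ominus>\<^bsub>A\<^esub> x) = \<ominus>\<^bsub>C\<^esub> h x"
proof -
  interpret A: module S A by fact
  interpret C: module S C by fact
  have "h (\<ominus>\<^bsub>A\<^esub> x) \<oplus>\<^bsub>C\<^esub> h x = h (\<ominus>\<^bsub>A\<^esub> x \<oplus>\<^bsub>A\<^esub> x)" using x by (intro lin_mapsD(2)[OF h, symmetric]) auto
  also have "\<dots> = \<zero>\<^bsub>C\<^esub>" using x by (simp add: A.M.l_neg lin_maps_zero[OF A C h])
  finally show ?thesis using x lin_mapsD(1)[OF h] by (metis A.M.a_inv_closed C.M.minus_equality)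
qed

lemma lin_maps_diff:
  assumes A: "module S A" and C: "module S C" and h: "h \<in> lin_maps S A C"
    and x: "x \<in> carrier A" and y: "y \<in> carrier A"
  shows "h (x \<ominus>\<^bsub>A\<^esub> y) = h x \<ominus>\<^bsub>C\<^esub> h y"
proof -
  interpret A: module S A by fact
  show ?thesis using x y lin_mapsD(2)[OF h x, of "\<ominus>\<^bsub>A\<^esub> y"] lin_maps_minus[OF A C h y]
    by (simp add: a_minus_def)
qed

lemma lin_maps_kernel:
  assumes A: "module S A" and C: "module S C" and h: "h \<in> lin_maps S A C"
  shows "submodule {x \<in> carrier A. h x = \<zero>\<^bsub>C\<^esub>} S A"
proof -
  interpret A: module S A by fact
  interpret C: module S C by fact
  show ?thesis
    by (rule A.submoduleI)
      (auto simp: lin_maps_zero[OF A C h] lin_maps_minus[OF A C h] lin_mapsD[OF h])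
qed

subsection \<open>Quotients\<close>

context ring_module
begin

context
  fixes N assumes N: "submodule N R M"
begin

interpretation N: abelian_subgroup N M
  by (rule abelian_subgroupI3[OF _ M.abelian_group_axioms])
    (rule additive_subgroup.intro[OF submodule.axioms(1)[OF N]])

lemma coset_eq_iff:
  assumes "x \<in> carrier M" "y \<in> carrier M"
  shows "N +>\<^bsub>M\<^esub> x = N +>\<^bsub>M\<^esub> y \<longleftrightarrow> x \<ominus>\<^bsub>M\<^esub> y \<in> N"
proof
  assume "N +>\<^bsub>M\<^esub> x = N +>\<^bsub>M\<^esub> y"
  then have "x \<in> N +>\<^bsub>M\<^esub> y" using N.a_rcos_self[OF assms(1)] by simp
  then show "x \<ominus>\<^bsub>M\<^esub> y \<in> N" using N.a_rcos_module_minus[OF _ assms(2,1)] R.ring_axioms N.a_rcos_module_imp[OF assms(2)]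
    by (simp add: a_minus_def)
next
  assume "x \<ominus>\<^bsub>M\<^esub> y \<in> N"
  then have "x \<in> N +>\<^bsub>M\<^esub> y" using N.a_rcos_module_rev[OF assms(2,1)] by (simp add: a_minus_def)
  then show "N +>\<^bsub>M\<^esub> x = N +>\<^bsub>M\<^esub> y" using N.a_repr_independence' assms by metis
qed

lemma coset_mem_iff:
  assumes "x \<in> carrier M"
  shows "y \<in> N +>\<^bsub>M\<^esub> x \<longleftrightarrow> y \<in> carrier M \<and> y \<ominus>\<^bsub>M\<^esub> x \<in> N"
  using N.a_rcos_module_imp[OF assms] N.a_rcos_module_rev[OF assms] N.a_elemrcos_carrier[OF assms]
  by (auto simp: a_minus_def)

lemma carrier_quot_module: "carrier (quot_module M N) = (\<lambda>x. N +>\<^bsub>M\<^esub> x) ` carrier M"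
  by (auto simp: quot_module_def A_RCOSETS_def')

lemma coset_in_quot: "x \<in> carrier M \<Longrightarrow> N +>\<^bsub>M\<^esub> x \<in> carrier (quot_module M N)"
  by (auto simp: carrier_quot_module)

lemma quot_add:
  "x \<in> carrier M \<Longrightarrow> y \<in> carrier M \<Longrightarrow>
    (N +>\<^bsub>M\<^esub> x) \<oplus>\<^bsub>quot_module M N\<^esub> (N +>\<^bsub>M\<^esub> y) = N +>\<^bsub>M\<^esub> (x \<oplus>\<^bsub>M\<^esub> y)"
  by (simp add: quot_module_def N.a_rcos_sum)

lemma quot_zero: "\<zero>\<^bsub>quot_module M N\<^esub> = N +>\<^bsub>M\<^esub> \<zero>\<^bsub>M\<^esub>"
  using N.a_subset by (simp add: quot_module_def M.a_coset_add_zero)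

lemma quot_smult:
  assumes r: "r \<in> carrier R" and x: "x \<in> carrier M"
  shows "r \<odot>\<^bsub>quot_module M N\<^esub> (N +>\<^bsub>M\<^esub> x) = N +>\<^bsub>M\<^esub> (r \<odot>\<^bsub>M\<^esub> x)"
proof -
  have "N +>\<^bsub>M\<^esub> (r \<odot>\<^bsub>M\<^esub> y) = N +>\<^bsub>M\<^esub> (r \<odot>\<^bsub>M\<^esub> x)" if y: "y \<in> N +>\<^bsub>M\<^esub> x" for y
  proof -
    have yM: "y \<in> carrier M" "y \<ominus>\<^bsub>M\<^esub> x \<in> N" using y coset_mem_iff[OF x] by auto
    have "r \<odot>\<^bsub>M\<^esub> y \<ominus>\<^bsub>M\<^esub> r \<odot>\<^bsub>M\<^esub> x = r \<odot>\<^bsub>M\<^esub> (y \<ominus>\<^bsub>M\<^esub> x)"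
      using r x yM by (simp add: a_minus_def smult_r_distr smult_r_minus)
    then have "r \<odot>\<^bsub>M\<^esub> y \<ominus>\<^bsub>M\<^esub> r \<odot>\<^bsub>M\<^esub> x \<in> N" using submoduleE(4)[OF N r yM(2)] by simp
    then show ?thesis using coset_eq_iff r x yM by simp
  qed
  moreover have "x \<in> N +>\<^bsub>M\<^esub> x" by (rule N.a_rcos_self[OF x])
  ultimately have "(\<Union>y\<in>N +>\<^bsub>M\<^esub> x. N +>\<^bsub>M\<^esub> (r \<odot>\<^bsub>M\<^esub> y)) = N +>\<^bsub>M\<^esub> (r \<odot>\<^bsub>M\<^esub> x)" by blast
  then show ?thesis by (simp add: quot_module_def)
qed

lemma module_quot: "module R (quot_module M N)"
proof (rule moduleI[OF R.cring_axioms])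
  show "abelian_group (quot_module M N)"
  proof (rule abelian_groupI)
    fix X assume "X \<in> carrier (quot_module M N)"
    then obtain x where x: "x \<in> carrier M" "X = N +>\<^bsub>M\<^esub> x" by (auto simp: carrier_quot_module)
    then have "(N +>\<^bsub>M\<^esub> (\<ominus>\<^bsub>M\<^esub> x)) \<oplus>\<^bsub>quot_module M N\<^esub> X = \<zero>\<^bsub>quot_module M N\<^esub>"
      by (simp add: quot_add quot_zero M.l_neg)
    then show "\<exists>Y\<in>carrier (quot_module M N). Y \<oplus>\<^bsub>quot_module M N\<^esub> X = \<zero>\<^bsub>quot_module M N\<^esub>"
      using x by (meson M.a_inv_closed coset_in_quot)
  qed (auto simp: carrier_quot_module quot_add quot_zero M.a_ac)
qed (auto simp: carrier_quot_module quot_add quot_smult smult_l_distr smult_r_distr smult_assoc1)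

text \<open>A linear map that vanishes on \<open>N\<close> factors through the quotient.\<close>

lemma quot_lift:
  assumes C: "module R C" and h: "h \<in> lin_maps R M C" and ker: "\<And>x. x \<in> N \<Longrightarrow> h x = \<zero>\<^bsub>C\<^esub>"
  shows "\<exists>h'\<in>lin_maps R (quot_module M N) C. \<forall>x\<in>carrier M. h' (N +>\<^bsub>M\<^esub> x) = h x"
proof -
  interpret C: module R C by fact
  define h' where "h' Y = h (SOME x. x \<in> Y)" for Y
  have eq: "h' (N +>\<^bsub>M\<^esub> x) = h x" if x: "x \<in> carrier M" for x
  proof -
    define y where "y = (SOME y. y \<in> N +>\<^bsub>M\<^esub> x)"
    have "y \<in> N +>\<^bsub>M\<^esub> x" unfolding y_def using N.a_rcos_self[OF x] by (rule someI)
    then have y: "y \<in> carrier M" "y \<ominus>\<^bsub>M\<^esub> x \<in> N" using coset_mem_iff[OF x] by auto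
    have "h y \<ominus>\<^bsub>C\<^esub> h x = \<zero>\<^bsub>C\<^esub>"
      using ker[OF y(2)] lin_maps_diff[OF module_axioms C h y(1) x] by simp
    then have "h y = h x"
      using lin_mapsD(1)[OF h] x y by (metis C.M.minus_equality C.M.minus_minus C.M.a_inv_closed a_minus_def)
    then show ?thesis by (simp add: h'_def y_def)
  qed
  have "h' \<in> lin_maps R (quot_module M N) C"
    unfolding lin_maps_def using lin_mapsD[OF h]
    by (auto simp: carrier_quot_module quot_add quot_smult eq)
  then show ?thesis using eq by blast
qed

end

end

subsection \<open>Free modules\<close>

lemma free_module_simps [simp]:
  "ring.zero (free_module S I) = (\<lambda>i. \<zero>\<^bsub>S\<^esub>)"
  "add (free_module S I) = (\<lambda>f g i. f i \<oplus>\<^bsub>S\<^esub> g i)"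
  "smult (free_module S I) = (\<lambda>s f i. s \<otimes>\<^bsub>S\<^esub> f i)"
  by (simp_all add: free_module_def)

lemma in_free_module_iff:
  "f \<in> carrier (free_module S I) \<longleftrightarrow>
    (\<forall>i. f i \<in> carrier S) \<and> (\<forall>i. i \<notin> I \<longrightarrow> f i = \<zero>\<^bsub>S\<^esub>) \<and> finite {i. f i \<noteq> \<zero>\<^bsub>S\<^esub>}"
  by (simp add: free_module_def)

text \<open>A commutative ring record without additional fields, the base of free modules.\<close>

locale plain_cring = cring R for R :: "'r ring" (structure)
begin

lemma module_free: "module R (free_module R I)"
proof (rule moduleI[OF cring_axioms])
  show "abelian_group (free_module R I)"
  proof (rule abelian_groupI)
    fix f g assume "f \<in> carrier (free_module R I)" "g \<in> carrier (free_module R I)"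
    moreover have "{i. f i \<oplus> g i \<noteq> \<zero>} \<subseteq> {i. f i \<noteq> \<zero>} \<union> {i. g i \<noteq> \<zero>}" by auto
    ultimately show "f \<oplus>\<^bsub>free_module R I\<^esub> g \<in> carrier (free_module R I)"
      by (auto simp: in_free_module_iff intro: finite_subset)
  next
    fix f assume f: "f \<in> carrier (free_module R I)"
    have "{i. \<ominus> f i \<noteq> \<zero>} \<subseteq> {i. f i \<noteq> \<zero>}" by auto
    then have "(\<lambda>i. \<ominus> f i) \<in> carrier (free_module R I)"
      using f by (auto simp: in_free_module_iff intro: finite_subset)
    moreover have "(\<lambda>i. \<ominus> f i) \<oplus>\<^bsub>free_module R I\<^esub> f = \<zero>\<^bsub>free_module R I\<^esub>"
      using f by (auto simp: in_free_module_iff l_neg)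
    ultimately show "\<exists>g\<in>carrier (free_module R I). g \<oplus>\<^bsub>free_module R I\<^esub> f = \<zero>\<^bsub>free_module R I\<^esub>" by blast
  qed (auto simp: in_free_module_iff a_ac)
next
  fix r f assume "r \<in> carrier R" "f \<in> carrier (free_module R I)"
  moreover have "{i. r \<otimes> f i \<noteq> \<zero>} \<subseteq> {i. f i \<noteq> \<zero>}" using \<open>r \<in> carrier R\<close> by auto
  ultimately show "r \<odot>\<^bsub>free_module R I\<^esub> f \<in> carrier (free_module R I)"
    by (auto simp: in_free_module_iff intro: finite_subset)
qed (auto simp: in_free_module_iff l_distr r_distr m_assoc)

lemma free_gen_closed: "i \<in> I \<Longrightarrow> free_gen R i \<in> carrier (free_module R I)"
proof -
  assume "i \<in> I"
  moreover have "{j. free_gen R i j \<noteq> \<zero>} \<subseteq> {i}" by (auto simp: free_gen_def)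
  then have "finite {j. free_gen R i j \<noteq> \<zero>}" by (rule finite_subset) simp
  ultimately show ?thesis by (auto simp: in_free_module_iff free_gen_def)
qed

lemma free_module_induct:
  assumes f: "f \<in> carrier (free_module R I)"
    and zero: "P (\<lambda>i. \<zero>)"
    and step: "\<And>f r i. f \<in> carrier (free_module R I) \<Longrightarrow> P f \<Longrightarrow> r \<in> carrier R \<Longrightarrow> i \<in> I \<Longrightarrow>
      P (f \<oplus>\<^bsub>free_module R I\<^esub> r \<odot>\<^bsub>free_module R I\<^esub> free_gen R i)"
  shows "P f"
proof -
  have "finite J \<Longrightarrow> J \<subseteq> I \<Longrightarrow> f \<in> carrier (free_module R I) \<Longrightarrow> {i. f i \<noteq> \<zero>} \<subseteq> J \<Longrightarrow> P f" for J
  proof (induction J arbitrary: f rule: finite_induct)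
    case empty
    then have "f = (\<lambda>i. \<zero>)" by auto
    then show ?case using zero by simp
  next
    case (insert j J)
    define g where "g i = (if i = j then \<zero> else f i)" for i
    have "{i. g i \<noteq> \<zero>} \<subseteq> {i. f i \<noteq> \<zero>}" by (auto simp: g_def)
    then have g: "g \<in> carrier (free_module R I)"
      using insert.prems by (auto simp: in_free_module_iff g_def intro: finite_subset)
    have "J \<subseteq> I" "{i. g i \<noteq> \<zero>} \<subseteq> J" using insert.prems by (auto simp: g_def)
    then have "P g" using insert.IH g by blast
    moreover have fj: "f j \<in> carrier R" using insert.prems by (simp add: in_free_module_iff)
    ultimately have "P (g \<oplus>\<^bsub>free_module R I\<^esub> f j \<odot>\<^bsub>free_module R I\<^esub> free_gen R j)"
      using g insert.prems by (intro step) auto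
    moreover have "g \<oplus>\<^bsub>free_module R I\<^esub> f j \<odot>\<^bsub>free_module R I\<^esub> free_gen R j = f"
      using fj insert.prems by (auto simp: g_def free_gen_def in_free_module_iff fun_eq_iff)
    ultimately show ?case by simp
  qed
  from this[of "{i. f i \<noteq> \<zero>}"] f show ?thesis by (auto simp: in_free_module_iff)
qed

text \<open>A family in \<open>C\<close> extends to a linear map on the free module.\<close>

lemma free_module_lift:
  assumes C: "module R C" and p: "p \<in> I \<rightarrow> carrier C"
  shows "\<exists>L\<in>lin_maps R (free_module R I) C. \<forall>i\<in>I. L (free_gen R i) = p i"
proof -
  interpret C: ring_module R C using C by (simp add: ring_module_def)
  define L where "L f = C.lincomb {i. f i \<noteq> \<zero>} p f" for f
  have L: "L f = C.lincomb J p f" if "f \<in> carrier (free_module R I)" "finite J" "J \<subseteq> I" "{i. f i \<noteq> \<zero>} \<subseteq> J" for f J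
    unfolding L_def C.lincomb_def
    by (rule C.M.add.finprod_mono_neutral_cong_left)
      (use that p in \<open>auto simp: in_free_module_iff Pi_iff subset_iff\<close>)
  have fR: "f \<in> J \<rightarrow> carrier R" if "f \<in> carrier (free_module R I)" for f J
    using that by (simp add: in_free_module_iff)
  have "L \<in> lin_maps R (free_module R I) C"
    unfolding lin_maps_def
  proof (intro CollectI conjI ballI Pi_I)
    fix f assume f: "f \<in> carrier (free_module R I)"
    then have "{i. f i \<noteq> \<zero>} \<subseteq> I" by (auto simp: in_free_module_iff)
    then show "L f \<in> carrier C" unfolding L_def using fR[OF f] p by (intro C.lincomb_closed) auto
  next
    fix f g assume f: "f \<in> carrier (free_module R I)" and g: "g \<in> carrier (free_module R I)"
    let ?J = "{i. f i \<noteq> \<zero>} \<union> {i. g i \<noteq> \<zero>}"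
    have J: "finite ?J" "?J \<subseteq> I" using f g by (auto simp: in_free_module_iff)
    have fg: "f \<oplus>\<^bsub>free_module R I\<^esub> g \<in> carrier (free_module R I)"
      using module.axioms(2)[OF module_free[of I]] f g by (meson abelian_groupE(1))
    have "L (f \<oplus>\<^bsub>free_module R I\<^esub> g) = C.lincomb ?J p (f \<oplus>\<^bsub>free_module R I\<^esub> g)"
      by (rule L[OF fg J]) (auto simp: in_free_module_iff)
    also have "\<dots> = C.lincomb ?J p f \<oplus>\<^bsub>C\<^esub> C.lincomb ?J p g"
      unfolding free_module_simps using p J fR[OF f] fR[OF g] by (intro C.lincomb_add) auto
    also have "\<dots> = L f \<oplus>\<^bsub>C\<^esub> L g" using L[OF f J] L[OF g J] by auto
    finally show "L (f \<oplus>\<^bsub>free_module R I\<^esub> g) = L f \<oplus>\<^bsub>C\<^esub> L g" .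
  next
    fix r f assume r: "r \<in> carrier R" and f: "f \<in> carrier (free_module R I)"
    let ?J = "{i. f i \<noteq> \<zero>}"
    have J: "finite ?J" "?J \<subseteq> I" using f by (auto simp: in_free_module_iff)
    have rf: "r \<odot>\<^bsub>free_module R I\<^esub> f \<in> carrier (free_module R I)"
      by (rule module.smult_closed[OF module_free r f])
    have "L (r \<odot>\<^bsub>free_module R I\<^esub> f) = C.lincomb ?J p (r \<odot>\<^bsub>free_module R I\<^esub> f)"
      by (rule L[OF rf J]) (use r in auto)
    also have "\<dots> = r \<odot>\<^bsub>C\<^esub> C.lincomb ?J p f"
      unfolding free_module_simps using p J fR[OF f] r by (intro C.lincomb_smult) auto
    finally show "L (r \<odot>\<^bsub>free_module R I\<^esub> f) = r \<odot>\<^bsub>C\<^esub> L f" by (simp add: L_def)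
  qed
  moreover have "L (free_gen R i) = p i" if i: "i \<in> I" for i
  proof -
    have "L (free_gen R i) = C.lincomb {i} p (free_gen R i)"
      using i by (intro L free_gen_closed) (auto simp: free_gen_def)
    also have "\<dots> = p i" using i p by (simp add: C.lincomb_def C.M.finsum_insert free_gen_def Pi_iff)
    finally show ?thesis .
  qed
  ultimately show ?thesis by blast
qed

end

subsection \<open>The universal property of the tensor product\<close>

text \<open>Two modules over \<open>S\<close>, whose tensor product is a quotient of the free module \<open>F\<close> on the pairs.\<close>

locale tensor_modules = A: ring_module S A + B: ring_module S B
  for S :: "'s ring" and A :: "('s, 'a, 'x) module_scheme" and B :: "('s, 'b, 'y) module_scheme"
begin

abbreviation F :: "('s, 'a \<times> 'b \<Rightarrow> 's) module" where
  "F \<equiv> free_module S (carrier A \<times> carrier B)"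

abbreviation ptensor where
  "ptensor \<equiv> pure_tensor S A B"

sublocale S: plain_cring S
  by (rule plain_cring.intro[OF A.R.cring_axioms])

sublocale F: ring_module S F
  using S.module_free by (simp add: ring_module_def)

lemma gen_closed [simp]: "a \<in> carrier A \<Longrightarrow> b \<in> carrier B \<Longrightarrow> free_gen S (a, b) \<in> carrier F"
  by (rule S.free_gen_closed) simp

lemma relations_subset: "tensor_relations S A B \<subseteq> carrier F"
proof -
  have "x \<in> carrier F" if "x \<in> tensor_relations S A B" for x
    using that unfolding tensor_relations_def Let_def
    by (elim UnE CollectE exE conjE; hypsubst)
      (intro F.M.minus_closed F.M.add.m_closed F.smult_closed gen_closed A.smult_closed B.smult_closed
        A.M.add.m_closed B.M.add.m_closed; assumption)+
  then show ?thesis by blast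
qed

lemma kernel_submodule: "submodule (tensor_kernel S A B) S F"
  unfolding tensor_kernel_def by (rule F.span_mod_submodule[OF relations_subset])

lemma module_tensor: "module S (tensor S A B)"
  unfolding tensor_def by (rule F.module_quot[OF kernel_submodule])

lemma ptensor_closed [simp]: "a \<in> carrier A \<Longrightarrow> b \<in> carrier B \<Longrightarrow> ptensor a b \<in> carrier (tensor S A B)"
  unfolding tensor_def pure_tensor_def by (intro F.coset_in_quot[OF kernel_submodule] gen_closed)

lemma relation_coset:
  assumes "x \<ominus>\<^bsub>F\<^esub> y \<in> tensor_relations S A B" "x \<in> carrier F" "y \<in> carrier F"
  shows "tensor_kernel S A B +>\<^bsub>F\<^esub> x = tensor_kernel S A B +>\<^bsub>F\<^esub> y"
  using assms F.span_mod_base[of "tensor_relations S A B"]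
  by (subst F.coset_eq_iff[OF kernel_submodule]) (auto simp: tensor_kernel_def)

lemma ptensor_add_left:
  assumes "a \<in> carrier A" "a' \<in> carrier A" "b \<in> carrier B"
  shows "ptensor (a \<oplus>\<^bsub>A\<^esub> a') b = ptensor a b \<oplus>\<^bsub>tensor S A B\<^esub> ptensor a' b"
proof -
  have "free_gen S (a \<oplus>\<^bsub>A\<^esub> a', b) \<ominus>\<^bsub>F\<^esub> (free_gen S (a, b) \<oplus>\<^bsub>F\<^esub> free_gen S (a', b)) \<in> tensor_relations S A B"
    unfolding tensor_relations_def Let_def using assms by blast
  note relation_coset[OF this]
  then show ?thesis unfolding pure_tensor_def tensor_def
    using assms by (simp add: F.quot_add[OF kernel_submodule] del: free_module_simps)
qed

lemma ptensor_add_right: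
  assumes "a \<in> carrier A" "b \<in> carrier B" "b' \<in> carrier B"
  shows "ptensor a (b \<oplus>\<^bsub>B\<^esub> b') = ptensor a b \<oplus>\<^bsub>tensor S A B\<^esub> ptensor a b'"
proof -
  have "free_gen S (a, b \<oplus>\<^bsub>B\<^esub> b') \<ominus>\<^bsub>F\<^esub> (free_gen S (a, b) \<oplus>\<^bsub>F\<^esub> free_gen S (a, b')) \<in> tensor_relations S A B"
    unfolding tensor_relations_def Let_def using assms by blast
  note relation_coset[OF this]
  then show ?thesis unfolding pure_tensor_def tensor_def
    using assms by (simp add: F.quot_add[OF kernel_submodule] del: free_module_simps)
qed

lemma ptensor_smult_left:
  assumes "s \<in> carrier S" "a \<in> carrier A" "b \<in> carrier B"
  shows "ptensor (s \<odot>\<^bsub>A\<^esub> a) b = s \<odot>\<^bsub>tensor S A B\<^esub> ptensor a b"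
proof -
  have "free_gen S (s \<odot>\<^bsub>A\<^esub> a, b) \<ominus>\<^bsub>F\<^esub> s \<odot>\<^bsub>F\<^esub> free_gen S (a, b) \<in> tensor_relations S A B"
    unfolding tensor_relations_def Let_def using assms by blast
  note relation_coset[OF this]
  then show ?thesis unfolding pure_tensor_def tensor_def
    using assms by (simp add: F.quot_smult[OF kernel_submodule] del: free_module_simps)
qed

lemma ptensor_smult_right:
  assumes "s \<in> carrier S" "a \<in> carrier A" "b \<in> carrier B"
  shows "ptensor a (s \<odot>\<^bsub>B\<^esub> b) = s \<odot>\<^bsub>tensor S A B\<^esub> ptensor a b"
proof -
  have "free_gen S (a, s \<odot>\<^bsub>B\<^esub> b) \<ominus>\<^bsub>F\<^esub> s \<odot>\<^bsub>F\<^esub> free_gen S (a, b) \<in> tensor_relations S A B"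
    unfolding tensor_relations_def Let_def using assms by blast
  note relation_coset[OF this]
  then show ?thesis unfolding pure_tensor_def tensor_def
    using assms by (simp add: F.quot_smult[OF kernel_submodule] del: free_module_simps)
qed

lemma tensor_induct:
  assumes x: "x \<in> carrier (tensor S A B)"
    and zero: "P \<zero>\<^bsub>tensor S A B\<^esub>"
    and pure: "\<And>a b. a \<in> carrier A \<Longrightarrow> b \<in> carrier B \<Longrightarrow> P (ptensor a b)"
    and add: "\<And>x y. x \<in> carrier (tensor S A B) \<Longrightarrow> y \<in> carrier (tensor S A B) \<Longrightarrow> P x \<Longrightarrow> P y \<Longrightarrow>
      P (x \<oplus>\<^bsub>tensor S A B\<^esub> y)"
  shows "P x"
proof -
  let ?c = "\<lambda>f. tensor_kernel S A B +>\<^bsub>F\<^esub> f"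
  have c: "?c f \<in> carrier (tensor S A B)" if "f \<in> carrier F" for f
    unfolding tensor_def by (rule F.coset_in_quot[OF kernel_submodule that])
  obtain f where f: "f \<in> carrier F" "x = ?c f"
    using x unfolding tensor_def F.carrier_quot_module[OF kernel_submodule] by blast
  have "P (?c f)"
  proof (rule S.free_module_induct[OF f(1)])
    show "P (?c (\<lambda>i. \<zero>\<^bsub>S\<^esub>))" using zero by (simp add: tensor_def F.quot_zero[OF kernel_submodule])
  next
    fix f r i assume step: "f \<in> carrier F" "P (?c f)" "r \<in> carrier S" "i \<in> carrier A \<times> carrier B"
    obtain a b where i: "i = (a, b)" "a \<in> carrier A" "b \<in> carrier B" using step by auto
    have "?c (r \<odot>\<^bsub>F\<^esub> free_gen S i) = ptensor (r \<odot>\<^bsub>A\<^esub> a) b"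
      using i step ptensor_smult_left[of r a b]
      by (simp add: tensor_def pure_tensor_def F.quot_smult[OF kernel_submodule] del: free_module_simps)
    then have "P (?c (r \<odot>\<^bsub>F\<^esub> free_gen S i))" using pure i step by simp
    moreover have rg: "r \<odot>\<^bsub>F\<^esub> free_gen S i \<in> carrier F" using i step by (intro F.smult_closed) simp_all
    ultimately have "P (?c f \<oplus>\<^bsub>tensor S A B\<^esub> ?c (r \<odot>\<^bsub>F\<^esub> free_gen S i))"
      using step c by (intro add) auto
    then show "P (?c (f \<oplus>\<^bsub>F\<^esub> r \<odot>\<^bsub>F\<^esub> free_gen S i))"
      using F.quot_add[OF kernel_submodule step(1) rg] by (simp add: tensor_def del: free_module_simps)
  qed
  then show ?thesis using f by simp
qed

text \<open>A bilinear map factors through the tensor product.\<close>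

theorem tensor_lift:
  assumes C: "module S C" and p: "\<And>a b. a \<in> carrier A \<Longrightarrow> b \<in> carrier B \<Longrightarrow> p a b \<in> carrier C"
    and add_left: "\<And>a a' b. a \<in> carrier A \<Longrightarrow> a' \<in> carrier A \<Longrightarrow> b \<in> carrier B \<Longrightarrow>
      p (a \<oplus>\<^bsub>A\<^esub> a') b = p a b \<oplus>\<^bsub>C\<^esub> p a' b"
    and add_right: "\<And>a b b'. a \<in> carrier A \<Longrightarrow> b \<in> carrier B \<Longrightarrow> b' \<in> carrier B \<Longrightarrow>
      p a (b \<oplus>\<^bsub>B\<^esub> b') = p a b \<oplus>\<^bsub>C\<^esub> p a b'"
    and smult_left: "\<And>s a b. s \<in> carrier S \<Longrightarrow> a \<in> carrier A \<Longrightarrow> b \<in> carrier B \<Longrightarrow>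
      p (s \<odot>\<^bsub>A\<^esub> a) b = s \<odot>\<^bsub>C\<^esub> p a b"
    and smult_right: "\<And>s a b. s \<in> carrier S \<Longrightarrow> a \<in> carrier A \<Longrightarrow> b \<in> carrier B \<Longrightarrow>
      p a (s \<odot>\<^bsub>B\<^esub> b) = s \<odot>\<^bsub>C\<^esub> p a b"
  shows "\<exists>h\<in>lin_maps S (tensor S A B) C. \<forall>a\<in>carrier A. \<forall>b\<in>carrier B. h (ptensor a b) = p a b"
proof -
  interpret C: module S C by fact
  have "(\<lambda>(a, b). p a b) \<in> carrier A \<times> carrier B \<rightarrow> carrier C" using p by auto
  from S.free_module_lift[OF C this] obtain L where L: "L \<in> lin_maps S F C"
      "\<And>a b. a \<in> carrier A \<Longrightarrow> b \<in> carrier B \<Longrightarrow> L (free_gen S (a, b)) = p a b" by auto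
  note Ld = lin_maps_diff[OF F.module_axioms C L(1)]
  have zero: "c \<ominus>\<^bsub>C\<^esub> c = \<zero>\<^bsub>C\<^esub>" if "c \<in> carrier C" for c using that by (simp add: a_minus_def C.M.r_neg)
  have "L x = \<zero>\<^bsub>C\<^esub>" if "x \<in> tensor_relations S A B" for x
    using that unfolding tensor_relations_def Let_def
    by (elim UnE CollectE exE conjE; hypsubst)
      (simp_all add: Ld lin_mapsD[OF L(1)] L(2) zero p add_left add_right smult_left smult_right
        del: free_module_simps)
  then have "tensor_relations S A B \<subseteq> {x \<in> carrier F. L x = \<zero>\<^bsub>C\<^esub>}" using relations_subset by blast
  then have "tensor_kernel S A B \<subseteq> {x \<in> carrier F. L x = \<zero>\<^bsub>C\<^esub>}"
    unfolding tensor_kernel_def by (rule F.span_mod_least[OF lin_maps_kernel[OF F.module_axioms C L(1)]])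
  then have "\<exists>h\<in>lin_maps S (quot_module F (tensor_kernel S A B)) C.
      \<forall>x\<in>carrier F. h (tensor_kernel S A B +>\<^bsub>F\<^esub> x) = L x"
    by (intro F.quot_lift[OF kernel_submodule C L(1)]) blast
  then show ?thesis using L(2) gen_closed unfolding tensor_def pure_tensor_def by metis
qed

end

lemma (in abelian_group) diff_eq_zero_iff:
  assumes "x \<in> carrier G" "y \<in> carrier G"
  shows "x \<ominus> y = \<zero> \<longleftrightarrow> x = y"
proof
  assume eq: "x \<ominus> y = \<zero>"
  have "x = (x \<ominus> y) \<oplus> y" using assms by (simp add: a_minus_def a_assoc l_neg)
  also have "\<dots> = y" unfolding eq using assms by simp
  finally show "x = y" .
qed (use assms in \<open>simp add: a_minus_def r_neg\<close>)

section \<open>The fibre of a module over a power series ring\<close>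

context power_series_ring
begin

lemma module_self: "module R (self_module R)"
proof (rule moduleI[OF cring])
  show "abelian_group (self_module R)"
    by (rule abelian_groupI) (auto simp: a_ac intro: l_neg)
qed (auto simp: l_distr r_distr m_assoc)

lemma constants_cring: "cring (scalars R constants)"
proof (rule cringI)
  show "abelian_group (scalars R constants)"
  proof (rule abelian_groupI)
    fix f assume "f \<in> carrier (scalars R constants)"
    then obtain c where "f = const_series c" by auto
    then have "const_series (- c) \<oplus>\<^bsub>scalars R constants\<^esub> f = \<zero>\<^bsub>scalars R constants\<^esub>"
      by (simp add: const_add zero_eq)
    then show "\<exists>g\<in>carrier (scalars R constants). g \<oplus>\<^bsub>scalars R constants\<^esub> f = \<zero>\<^bsub>scalars R constants\<^esub>"
      by auto
  qed (auto simp: const_add zero_eq ac_simps)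
  show "Group.comm_monoid (scalars R constants)"
    by (rule comm_monoidI) (auto simp: one_eq const_mult ac_simps)
qed (auto simp: l_distr)

lemma module_scalars:
  assumes "module R A"
  shows "module (scalars R constants) A"
proof -
  interpret A: module R A by fact
  show ?thesis
    by (rule moduleI[OF constants_cring A.M.abelian_group_axioms])
      (auto simp: A.smult_l_distr A.smult_r_distr A.smult_assoc1)
qed

text \<open>The class of a series in the residue field \<open>R / \<mm>\<close>.\<close>

definition residue_class :: "'k mseries \<Rightarrow> 'k mseries set" where
  "residue_class r = max_id +>\<^bsub>R\<^esub> r"

lemma self_coset: "max_id +>\<^bsub>self_module R\<^esub> r = residue_class r"
  by (simp add: residue_class_def a_r_coset_def')

lemma max_id_submodule: "submodule max_id R (self_module R)"
proof -
  interpret module R "self_module R" by (rule module_self)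
  have "\<ominus>\<^bsub>self_module R\<^esub> f = \<ominus> f" for f by (simp add: a_inv_def m_inv_def)
  then show ?thesis by (intro submoduleI) (auto simp: max_id_def)
qed

lemma residue_module_eq: "residue_module R = quot_module (self_module R) max_id"
  by (simp add: residue_module_def max_ideal_eq)

lemma module_residue: "module R (residue_module R)"
  unfolding residue_module_eq
  by (rule ring_module.module_quot[OF _ max_id_submodule]) (simp add: ring_module_iff module_self)

lemma residue_module_facts:
  shows carrier_residue: "carrier (residue_module R) = residue_class ` carrier R"
    and residue_add: "r \<in> carrier R \<Longrightarrow> s \<in> carrier R \<Longrightarrow>
      residue_class r \<oplus>\<^bsub>residue_module R\<^esub> residue_class s = residue_class (r \<oplus> s)"
    and residue_smult: "r \<in> carrier R \<Longrightarrow> s \<in> carrier R \<Longrightarrow>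
      r \<odot>\<^bsub>residue_module R\<^esub> residue_class s = residue_class (r \<otimes> s)"
    and residue_eq_iff: "r \<in> carrier R \<Longrightarrow> s \<in> carrier R \<Longrightarrow>
      residue_class r = residue_class s \<longleftrightarrow> r 0 = s 0"
proof -
  interpret S: ring_module R "self_module R" by (simp add: ring_module_iff module_self)
  note N = max_id_submodule
  show "carrier (residue_module R) = residue_class ` carrier R"
    unfolding residue_module_eq S.carrier_quot_module[OF N] self_coset by simp
  assume r: "r \<in> carrier R" and s: "s \<in> carrier R"
  show "residue_class r \<oplus>\<^bsub>residue_module R\<^esub> residue_class s = residue_class (r \<oplus> s)"
    using S.quot_add[OF N, of r s] r s by (simp add: residue_module_eq self_coset)
  show "r \<odot>\<^bsub>residue_module R\<^esub> residue_class s = residue_class (r \<otimes> s)"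
    using S.quot_smult[OF N, of r s] r s by (simp add: residue_module_eq self_coset)
  have "r \<ominus>\<^bsub>self_module R\<^esub> s = r \<ominus> s" by (simp add: a_minus_def a_inv_def m_inv_def)
  moreover have "r \<ominus> s \<in> max_id \<longleftrightarrow> r 0 = s 0" using r s by (simp add: max_id_def)
  ultimately show "residue_class r = residue_class s \<longleftrightarrow> r 0 = s 0"
    using S.coset_eq_iff[OF N, of r s] r s by (simp add: self_coset)
qed

lemma carrier_residue_ring: "carrier (R Quot max_ideal R) = residue_class ` carrier R"
  by (auto simp: FactRing_def max_ideal_eq A_RCOSETS_def' residue_class_def)

lemma residue_ring_mult:
  "r \<in> carrier R \<Longrightarrow> s \<in> carrier R \<Longrightarrow>
    residue_class r \<otimes>\<^bsub>R Quot max_ideal R\<^esub> residue_class s = residue_class (r \<otimes> s)"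
  by (simp add: FactRing_def max_ideal_eq residue_class_def ideal.rcoset_mult_add[OF max_id_ideal])

text \<open>The map \<open>x \<mapsto> 1 \<otimes> x\<close> identifies \<open>A / \<mm> A\<close> with the fibre.\<close>

definition fib :: "('k mseries, 'a, 'x) module_scheme \<Rightarrow> 'a \<Rightarrow> ('k mseries set \<times> 'a \<Rightarrow> 'k mseries) set" where
  "fib A x = pure_tensor R (residue_module R) A (residue_class \<one>) x"

context
  fixes A :: "('k mseries, 'a, 'x) module_scheme"
  assumes A: "module R A"
begin

interpretation A: ring_module R A using A by (simp add: ring_module_iff)
interpretation Q: ring_module R "residue_module R" by (simp add: ring_module_iff module_residue)
interpretation T: tensor_modules R "residue_module R" A ..

lemma module_fibre: "module R (fibre R A)"
  unfolding fibre_def by (rule T.module_tensor)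

lemma ptensor_residue:
  assumes r: "r \<in> carrier R" and x: "x \<in> carrier A"
  shows "pure_tensor R (residue_module R) A (residue_class r) x = fib A (r \<odot>\<^bsub>A\<^esub> x)"
proof -
  have "residue_class r = r \<odot>\<^bsub>residue_module R\<^esub> residue_class \<one>" using r by (simp add: residue_smult)
  moreover have "residue_class \<one> \<in> carrier (residue_module R)" by (auto simp: carrier_residue)
  ultimately show ?thesis
    unfolding fib_def using r x by (simp add: T.ptensor_smult_left T.ptensor_smult_right)
qed

lemma fib_linear: "fib A \<in> lin_maps R A (fibre R A)"
proof -
  have "residue_class \<one> \<in> carrier (residue_module R)" by (auto simp: carrier_residue)
  then show ?thesis
    by (auto simp: lin_maps_def fib_def fibre_def T.ptensor_add_right T.ptensor_smult_right)
qed

lemma fib_surj: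
  assumes X: "X \<in> carrier (fibre R A)"
  shows "\<exists>x\<in>carrier A. X = fib A x"
proof (rule T.tensor_induct[OF X[unfolded fibre_def]])
  have "fib A \<zero>\<^bsub>A\<^esub> = \<zero>\<^bsub>tensor R (residue_module R) A\<^esub>"
    using lin_maps_zero[OF A module_fibre fib_linear] by (simp add: fibre_def)
  then show "\<exists>x\<in>carrier A. \<zero>\<^bsub>tensor R (residue_module R) A\<^esub> = fib A x"
    by (intro bexI[of _ "\<zero>\<^bsub>A\<^esub>"]) simp_all
next
  fix a x assume "a \<in> carrier (residue_module R)" and x: "x \<in> carrier A"
  then obtain r where "r \<in> carrier R" "a = residue_class r" by (auto simp: carrier_residue)
  then show "\<exists>y\<in>carrier A. pure_tensor R (residue_module R) A a x = fib A y"
    using ptensor_residue x by blast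
next
  fix X Y assume "\<exists>x\<in>carrier A. X = fib A x" "\<exists>y\<in>carrier A. Y = fib A y"
  then obtain x y where xy: "x \<in> carrier A" "y \<in> carrier A" "X = fib A x" "Y = fib A y" by blast
  then have "X \<oplus>\<^bsub>tensor R (residue_module R) A\<^esub> Y = fib A (x \<oplus>\<^bsub>A\<^esub> y)"
    using lin_mapsD(2)[OF fib_linear, of x y] by (simp add: fibre_def)
  then show "\<exists>z\<in>carrier A. X \<oplus>\<^bsub>tensor R (residue_module R) A\<^esub> Y = fib A z"
    using xy by (intro bexI[of _ "x \<oplus>\<^bsub>A\<^esub> y"]) simp_all
qed

lemma mA_submodule: "submodule (ideal_times R max_id A) R A"
  by (rule A.ideal_times_submodule) (auto simp: max_id_def)

lemma fib_mA:
  assumes "x \<in> ideal_times R max_id A"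
  shows "fib A x = \<zero>\<^bsub>fibre R A\<^esub>"
proof -
  let ?K = "{x \<in> carrier A. fib A x = \<zero>\<^bsub>fibre R A\<^esub>}"
  have "submodule ?K R A" by (rule lin_maps_kernel[OF A module_fibre fib_linear])
  moreover have "{s \<odot>\<^bsub>A\<^esub> x |s x. s \<in> max_id \<and> x \<in> carrier A} \<subseteq> ?K"
  proof clarify
    fix s x assume s: "s \<in> max_id" and x: "x \<in> carrier A"
    have sR: "s \<in> carrier R" "s 0 = 0" using s by (auto simp: max_id_def)
    then have "residue_class s = residue_class \<zero>" by (simp add: residue_eq_iff)
    then have "fib A (s \<odot>\<^bsub>A\<^esub> x) = fib A (\<zero> \<odot>\<^bsub>A\<^esub> x)" using ptensor_residue[OF _ x] sR by (metis zero_closed)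
    then show "s \<odot>\<^bsub>A\<^esub> x \<in> carrier A \<and> fib A (s \<odot>\<^bsub>A\<^esub> x) = \<zero>\<^bsub>fibre R A\<^esub>"
      using sR x lin_maps_zero[OF A module_fibre fib_linear] by simp
  qed
  ultimately have "ideal_times R max_id A \<subseteq> ?K" unfolding ideal_times_def by (rule A.span_mod_least)
  then show ?thesis using assms by blast
qed

text \<open>The bilinear map \<open>(r mod \<mm>, y) \<mapsto> r(0) y mod \<mm> A\<close> detects whether \<open>1 \<otimes> x\<close> is zero.\<close>

lemma fib_zero_imp_mA:
  assumes x: "x \<in> carrier A" and fx: "fib A x = \<zero>\<^bsub>fibre R A\<^esub>"
  shows "x \<in> ideal_times R max_id A"
proof -
  let ?N = "ideal_times R max_id A"
  let ?C = "quot_module A ?N"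
  note N = mA_submodule
  have C: "module R ?C" by (rule A.module_quot[OF N])
  define p where "p X y = ?N +>\<^bsub>A\<^esub> (const_series (THE c. \<exists>r\<in>carrier R. X = residue_class r \<and> c = r 0) \<odot>\<^bsub>A\<^esub> y)" for X y
  have p0: "p (residue_class r) y = ?N +>\<^bsub>A\<^esub> (const_series (r 0) \<odot>\<^bsub>A\<^esub> y)" if "r \<in> carrier R" for r y
  proof -
    have "(THE c. \<exists>s\<in>carrier R. residue_class r = residue_class s \<and> c = s 0) = r 0"
      by (rule the_equality) (use that residue_eq_iff in auto)
    then show ?thesis by (simp add: p_def)
  qed
  have p: "p (residue_class r) y = ?N +>\<^bsub>A\<^esub> (r \<odot>\<^bsub>A\<^esub> y)" if r: "r \<in> carrier R" and y: "y \<in> carrier A" for r y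
  proof -
    have "const_series (r 0) \<ominus> r \<in> max_id" using r by (simp add: max_id_def const_coeff)
    from A.ideal_times_mem[OF this y] have "const_series (r 0) \<odot>\<^bsub>A\<^esub> y \<ominus>\<^bsub>A\<^esub> r \<odot>\<^bsub>A\<^esub> y \<in> ?N"
      using r y by (simp add: a_minus_def A.smult_l_distr A.smult_l_minus)
    then show ?thesis using r y by (simp add: p0 A.coset_eq_iff[OF N])
  qed
  have "\<exists>h\<in>lin_maps R (tensor R (residue_module R) A) ?C.
      \<forall>a\<in>carrier (residue_module R). \<forall>b\<in>carrier A. h (pure_tensor R (residue_module R) A a b) = p a b"
    by (rule T.tensor_lift[OF C])
      (auto simp: carrier_residue residue_add residue_smult p A.coset_in_quot[OF N] A.quot_add[OF N]
        A.quot_smult[OF N] A.smult_l_distr A.smult_r_distr A.smult_assoc1[symmetric] m_comm)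
  then obtain h where h: "h \<in> lin_maps R (fibre R A) ?C"
    "\<And>r y. r \<in> carrier R \<Longrightarrow> y \<in> carrier A \<Longrightarrow> h (pure_tensor R (residue_module R) A (residue_class r) y) = ?N +>\<^bsub>A\<^esub> (r \<odot>\<^bsub>A\<^esub> y)"
    by (auto simp: carrier_residue p fibre_def)
  have "?N +>\<^bsub>A\<^esub> x = h (fib A x)" using h(2)[of \<one> x] x by (simp add: fib_def)
  also have "\<dots> = \<zero>\<^bsub>?C\<^esub>" using lin_maps_zero[OF module_fibre C h(1)] by (simp add: fx)
  also have "\<dots> = ?N +>\<^bsub>A\<^esub> \<zero>\<^bsub>A\<^esub>" by (rule A.quot_zero[OF N])
  finally have "x \<ominus>\<^bsub>A\<^esub> \<zero>\<^bsub>A\<^esub> \<in> ?N" using x by (simp add: A.coset_eq_iff[OF N])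
  moreover have "x \<ominus>\<^bsub>A\<^esub> \<zero>\<^bsub>A\<^esub> = x"
    using x by (metis A.M.add.inv_one A.M.r_zero a_inv_def a_minus_def)
  ultimately show ?thesis by simp
qed

lemma fib_eq_iff:
  assumes "x \<in> carrier A" "y \<in> carrier A"
  shows "fib A x = fib A y \<longleftrightarrow> x \<ominus>\<^bsub>A\<^esub> y \<in> ideal_times R max_id A"
proof -
  interpret F: module R "fibre R A" by (rule module_fibre)
  have d: "fib A (x \<ominus>\<^bsub>A\<^esub> y) = fib A x \<ominus>\<^bsub>fibre R A\<^esub> fib A y"
    by (rule lin_maps_diff[OF A module_fibre fib_linear assms])
  have c: "fib A x \<in> carrier (fibre R A)" "fib A y \<in> carrier (fibre R A)"
    using lin_mapsD(1)[OF fib_linear] assms by auto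
  have "x \<ominus>\<^bsub>A\<^esub> y \<in> ideal_times R max_id A \<longleftrightarrow> fib A (x \<ominus>\<^bsub>A\<^esub> y) = \<zero>\<^bsub>fibre R A\<^esub>"
    using fib_mA fib_zero_imp_mA assms by (metis A.M.minus_closed)
  also have "\<dots> \<longleftrightarrow> fib A x = fib A y"
    unfolding d using c by (rule F.M.diff_eq_zero_iff)
  finally show ?thesis by simp
qed

end

text \<open>A linear map takes \<open>\<mm> A\<close> into \<open>\<mm> C\<close>, so it acts on the fibres.\<close>

lemma fib_cong:
  assumes A: "module R A" and C: "module R C" and f: "f \<in> lin_maps R A C"
    and x: "x \<in> carrier A" "x' \<in> carrier A" and eq: "fib A x = fib A x'"
  shows "fib C (f x) = fib C (f x')"
proof -
  interpret A: ring_module R A using A by (simp add: ring_module_iff)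
  interpret C: ring_module R C using C by (simp add: ring_module_iff)
  have lin: "(\<lambda>x. fib C (f x)) \<in> lin_maps R A (fibre R C)"
    using lin_mapsD[OF f] lin_mapsD[OF fib_linear[OF C]] by (auto simp: lin_maps_def)
  let ?K = "{x \<in> carrier A. fib C (f x) = \<zero>\<^bsub>fibre R C\<^esub>}"
  have "submodule ?K R A" by (rule lin_maps_kernel[OF A module_fibre[OF C] lin])
  moreover have "{s \<odot>\<^bsub>A\<^esub> x |s x. s \<in> max_id \<and> x \<in> carrier A} \<subseteq> ?K"
  proof clarify
    fix s x assume s: "s \<in> max_id" and x: "x \<in> carrier A"
    have sR: "s \<in> carrier R" using s by (simp add: max_id_def)
    then show "s \<odot>\<^bsub>A\<^esub> x \<in> carrier A \<and> fib C (f (s \<odot>\<^bsub>A\<^esub> x)) = \<zero>\<^bsub>fibre R C\<^esub>"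
      using x fib_mA[OF C C.ideal_times_mem[OF s lin_mapsD(1)[OF f x]]] lin_mapsD(3)[OF f sR x] by simp
  qed
  ultimately have "ideal_times R max_id A \<subseteq> ?K" unfolding ideal_times_def by (rule A.span_mod_least)
  then have "x \<ominus>\<^bsub>A\<^esub> x' \<in> ?K" using fib_eq_iff[OF A x] eq by blast
  then have "fib C (f x \<ominus>\<^bsub>C\<^esub> f x') = \<zero>\<^bsub>fibre R C\<^esub>"
    using lin_maps_diff[OF A C f x] by simp
  then have "f x \<ominus>\<^bsub>C\<^esub> f x' \<in> ideal_times R max_id C"
    using lin_mapsD(1)[OF f] x by (intro fib_zero_imp_mA[OF C]) auto
  then show ?thesis using lin_mapsD(1)[OF f] x by (simp add: fib_eq_iff[OF C])
qed

text \<open>The base change of a bilinear map exists, and it is the only one with the required values because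
  each element of a fibre has the form \<open>1 \<otimes> x\<close>.\<close>

lemma fibre_bilin_eq:
  assumes A: "module R A" and B: "module R B" and C: "module R C"
    and p: "\<And>x. x \<in> carrier A \<Longrightarrow> p x \<in> lin_maps R B C"
      "\<And>y. y \<in> carrier B \<Longrightarrow> (\<lambda>x. p x y) \<in> lin_maps R A C"
    and x: "x \<in> carrier A" and y: "y \<in> carrier B"
  shows "fibre_bilin R A B C p (fib A x) (fib B y) = fib C (p x y)"
proof -
  interpret A: ring_module R A using A by (simp add: ring_module_iff)
  interpret B: ring_module R B using B by (simp add: ring_module_iff)
  interpret C: ring_module R C using C by (simp add: ring_module_iff)
  note flA = fib_linear[OF A] and flB = fib_linear[OF B] and flC = fib_linear[OF C]
  have pc: "p x y \<in> carrier C" if "x \<in> carrier A" "y \<in> carrier B" for x y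
    using lin_mapsD(1)[OF p(1)] that by blast
  define ra where "ra X = (SOME x. x \<in> carrier A \<and> fib A x = X)" for X
  define rb where "rb Y = (SOME y. y \<in> carrier B \<and> fib B y = Y)" for Y
  have ra: "ra (fib A x) \<in> carrier A \<and> fib A (ra (fib A x)) = fib A x" if "x \<in> carrier A" for x
    unfolding ra_def by (rule someI[of _ x]) (use that in auto)
  have rb: "rb (fib B y) \<in> carrier B \<and> fib B (rb (fib B y)) = fib B y" if "y \<in> carrier B" for y
    unfolding rb_def by (rule someI[of _ y]) (use that in auto)
  define h where "h = (\<lambda>X\<in>carrier (fibre R A). \<lambda>Y\<in>carrier (fibre R B). fib C (p (ra X) (rb Y)))"
  have h: "h (fib A x) (fib B y) = fib C (p x y)" if "x \<in> carrier A" "y \<in> carrier B" for x y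
  proof -
    have "h (fib A x) (fib B y) = fib C (p (ra (fib A x)) (rb (fib B y)))"
      using that lin_mapsD(1)[OF flA] lin_mapsD(1)[OF flB] by (simp add: h_def)
    also have "\<dots> = fib C (p x (rb (fib B y)))"
      using ra[OF that(1)] rb[OF that(2)] that by (intro fib_cong[OF A C p(2), of "rb (fib B y)"]) auto
    also have "\<dots> = fib C (p x y)"
      using rb[OF that(2)] that by (intro fib_cong[OF B C p(1)]) auto
    finally show ?thesis .
  qed
  have surA: "\<exists>x\<in>carrier A. X = fib A x" if "X \<in> carrier (fibre R A)" for X by (rule fib_surj[OF A that])
  have surB: "\<exists>x\<in>carrier B. X = fib B x" if "X \<in> carrier (fibre R B)" for X by (rule fib_surj[OF B that])
  define char where "char h \<longleftrightarrow> h \<in> bilin_maps R (fibre R A) (fibre R B) (fibre R C) \<and>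
    (\<forall>a\<in>carrier (R Quot max_ideal R). \<forall>b\<in>carrier (R Quot max_ideal R).
      \<forall>x\<in>carrier A. \<forall>y\<in>carrier B.
        h (pure_tensor R (residue_module R) A a x) (pure_tensor R (residue_module R) B b y) =
          pure_tensor R (residue_module R) C (a \<otimes>\<^bsub>R Quot max_ideal R\<^esub> b) (p x y))" for h
  have "char h"
    unfolding char_def
  proof (intro conjI ballI)
    show "h \<in> bilin_maps R (fibre R A) (fibre R B) (fibre R C)"
      unfolding bilin_maps_def
    proof (intro CollectI conjI ballI)
      show "h \<in> carrier (fibre R A) \<rightarrow>\<^sub>E carrier (fibre R B) \<rightarrow>\<^sub>E carrier (fibre R C)"
      proof (intro PiE_I)
        fix X Y assume "X \<in> carrier (fibre R A)" "Y \<in> carrier (fibre R B)"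
        then obtain x y where "x \<in> carrier A" "X = fib A x" "y \<in> carrier B" "Y = fib B y"
          using surA surB by blast
        then show "h X Y \<in> carrier (fibre R C)" using h pc lin_mapsD(1)[OF flC] by simp
      qed (auto simp: h_def)
    next
      fix X assume "X \<in> carrier (fibre R A)"
      then obtain x where x: "x \<in> carrier A" "X = fib A x" using surA by blast
      note px = lin_mapsD[OF p(1)[OF x(1)]]
      show "h X \<in> lin_maps R (fibre R B) (fibre R C)"
        unfolding lin_maps_def
      proof (intro CollectI conjI ballI Pi_I)
        fix Y assume "Y \<in> carrier (fibre R B)"
        then obtain y where y: "y \<in> carrier B" "Y = fib B y" using surB by blast
        show "h X Y \<in> carrier (fibre R C)" using x y h pc lin_mapsD(1)[OF flC] by simp
        fix r assume r: "r \<in> carrier R"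
        show "h X (r \<odot>\<^bsub>fibre R B\<^esub> Y) = r \<odot>\<^bsub>fibre R C\<^esub> h X Y"
          using x y r h px by (simp add: lin_mapsD(3)[OF flB, symmetric] lin_mapsD(3)[OF flC])
      next
        fix Y Z assume "Y \<in> carrier (fibre R B)" "Z \<in> carrier (fibre R B)"
        then obtain y z where "y \<in> carrier B" "Y = fib B y" "z \<in> carrier B" "Z = fib B z" using surB by blast
        then show "h X (Y \<oplus>\<^bsub>fibre R B\<^esub> Z) = h X Y \<oplus>\<^bsub>fibre R C\<^esub> h X Z"
          using x h px by (simp add: lin_mapsD(2)[OF flB, symmetric] lin_mapsD(2)[OF flC])
      qed
    next
      fix Y assume "Y \<in> carrier (fibre R B)"
      then obtain y where y: "y \<in> carrier B" "Y = fib B y" using surB by blast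
      note py = lin_mapsD[OF p(2)[OF y(1)]]
      show "(\<lambda>X. h X Y) \<in> lin_maps R (fibre R A) (fibre R C)"
        unfolding lin_maps_def
      proof (intro CollectI conjI ballI Pi_I)
        fix X assume "X \<in> carrier (fibre R A)"
        then obtain x where x: "x \<in> carrier A" "X = fib A x" using surA by blast
        show "h X Y \<in> carrier (fibre R C)" using x y h pc lin_mapsD(1)[OF flC] by simp
        fix r assume r: "r \<in> carrier R"
        show "h (r \<odot>\<^bsub>fibre R A\<^esub> X) Y = r \<odot>\<^bsub>fibre R C\<^esub> h X Y"
          using x y r h py pc by (simp add: lin_mapsD(3)[OF flA, symmetric] lin_mapsD(3)[OF flC])
      next
        fix X Z assume "X \<in> carrier (fibre R A)" "Z \<in> carrier (fibre R A)"
        then obtain x z where "x \<in> carrier A" "X = fib A x" "z \<in> carrier A" "Z = fib A z" using surA by blast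
        then show "h (X \<oplus>\<^bsub>fibre R A\<^esub> Z) Y = h X Y \<oplus>\<^bsub>fibre R C\<^esub> h Z Y"
          using y h py pc by (simp add: lin_mapsD(2)[OF flA, symmetric] lin_mapsD(2)[OF flC])
      qed
    qed
  next
    fix a b x y assume "a \<in> carrier (R Quot max_ideal R)" "b \<in> carrier (R Quot max_ideal R)"
      and x: "x \<in> carrier A" and y: "y \<in> carrier B"
    then obtain r s where rs: "r \<in> carrier R" "s \<in> carrier R" "a = residue_class r" "b = residue_class s"
      by (auto simp: carrier_residue_ring)
    have "p (r \<odot>\<^bsub>A\<^esub> x) (s \<odot>\<^bsub>B\<^esub> y) = (r \<otimes> s) \<odot>\<^bsub>C\<^esub> p x y"
      using rs x y pc lin_mapsD(3)[OF p(1)[OF x] rs(2) y]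
        lin_mapsD(3)[OF p(2)[of "s \<odot>\<^bsub>B\<^esub> y"] rs(1) x] by (simp add: C.smult_assoc1)
    then show "h (pure_tensor R (residue_module R) A a x) (pure_tensor R (residue_module R) B b y) =
        pure_tensor R (residue_module R) C (a \<otimes>\<^bsub>R Quot max_ideal R\<^esub> b) (p x y)"
      using rs x y pc h
      by (simp add: ptensor_residue[OF A] ptensor_residue[OF B] ptensor_residue[OF C] residue_ring_mult)
  qed
  moreover have "h' = h" if "char h'" for h'
  proof -
    have P: "h' \<in> carrier (fibre R A) \<rightarrow>\<^sub>E carrier (fibre R B) \<rightarrow>\<^sub>E carrier (fibre R C)"
      using that by (auto simp: char_def bilin_maps_def)
    have H: "h \<in> carrier (fibre R A) \<rightarrow>\<^sub>E carrier (fibre R B) \<rightarrow>\<^sub>E carrier (fibre R C)"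
      using \<open>char h\<close> by (auto simp: char_def bilin_maps_def)
    have val: "h' (fib A x) (fib B y) = fib C (p x y)" if "x \<in> carrier A" "y \<in> carrier B" for x y
    proof -
      have 1: "residue_class \<one> \<in> carrier (R Quot max_ideal R)" by (auto simp: carrier_residue_ring)
      have "h' (fib A x) (fib B y) = pure_tensor R (residue_module R) C
          (residue_class \<one> \<otimes>\<^bsub>R Quot max_ideal R\<^esub> residue_class \<one>) (p x y)"
        unfolding fib_def using \<open>char h'\<close> 1 that by (auto simp: char_def)
      then show ?thesis by (simp add: residue_ring_mult fib_def)
    qed
    show "h' = h"
    proof (rule PiE_ext[OF P H])
      fix X assume X: "X \<in> carrier (fibre R A)"
      then obtain x where x: "x \<in> carrier A" "X = fib A x" using surA by blast
      show "h' X = h X"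
      proof (rule PiE_ext[of _ "carrier (fibre R B)" "\<lambda>_. carrier (fibre R C)"])
        fix Y assume "Y \<in> carrier (fibre R B)"
        then obtain y where "y \<in> carrier B" "Y = fib B y" using surB by blast
        then show "h' X Y = h X Y" using x val h by simp
      qed (use PiE_mem[OF P X] PiE_mem[OF H X] in simp_all)
    qed
  qed
  ultimately have "fibre_bilin R A B C p = h"
    unfolding fibre_bilin_def char_def[symmetric] by (rule the_equality)
  then show ?thesis using h x y by simp
qed

end

section \<open>Transitive Lie algebroids split\<close>

lemma finite_type_image:
  assumes A: "module S A" and C: "module S C" and h: "h \<in> lin_maps S A C"
    and surj: "h ` carrier A = carrier C" and ft: "finite_type S A"
  shows "finite_type S C"
proof -
  interpret A: ring_module S A using A by (simp add: ring_module_iff)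
  interpret C: ring_module S C using C by (simp add: ring_module_iff)
  obtain Y where Y: "Y \<subseteq> carrier A" "finite Y" "span_mod S A Y = carrier A"
    using ft by (auto simp: finite_type_def)
  have hY: "h ` Y \<subseteq> carrier C" using Y surj by blast
  note Sp = C.span_mod_submodule[OF hY]
  have "submodule {x \<in> carrier A. h x \<in> span_mod S C (h ` Y)} S A"
    by (rule A.submoduleI)
      (auto simp: lin_maps_zero[OF A C h] lin_maps_minus[OF A C h] lin_mapsD[OF h]
        C.submodule_zero[OF Sp] C.submoduleE(3,4,5)[OF Sp])
  moreover have "Y \<subseteq> {x \<in> carrier A. h x \<in> span_mod S C (h ` Y)}"
    using Y C.span_mod_base[of "h ` Y"] by auto
  ultimately have "carrier A \<subseteq> {x \<in> carrier A. h x \<in> span_mod S C (h ` Y)}"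
    using A.span_mod_least Y(3) by blast
  then have "h ` carrier A \<subseteq> span_mod S C (h ` Y)" by auto
  then have "span_mod S C (h ` Y) = carrier C" using C.submoduleE(1)[OF Sp] by (simp add: surj)
  then show ?thesis using Y hY by (auto simp: finite_type_def)
qed

lemma (in ring_module) lincomb_submodule_eq:
  assumes H: "submodule H R M" and I: "finite I" "e \<in> I \<rightarrow> H" "v \<in> I \<rightarrow> carrier R"
  shows "ring_module.lincomb (M\<lparr>carrier := H\<rparr>) I e v = lincomb I e v"
proof -
  interpret H: ring_module R "M\<lparr>carrier := H\<rparr>"
    using submodule.submodule_is_module[OF H module_axioms] by (simp add: ring_module_iff)
  have HM: "H \<subseteq> carrier M" using submoduleE(1)[OF H] .
  show ?thesis
    using I
  proof (induction I)
    case empty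
    then show ?case by (simp add: H.lincomb_def lincomb_def)
  next
    case (insert i I)
    have "e \<in> insert i I \<rightarrow> carrier M" using insert.prems HM by blast
    then show ?case using insert by (simp add: H.lincomb_insert lincomb_insert)
  qed
qed

lemma (in ring_module) lincomb_neg_gens:
  assumes "finite I" "e \<in> I \<rightarrow> carrier M" "v \<in> I \<rightarrow> carrier R"
  shows "lincomb I (\<lambda>i. \<ominus>\<^bsub>M\<^esub> e i) v = \<ominus>\<^bsub>M\<^esub> lincomb I e v"
proof -
  have "lincomb I (\<lambda>i. \<ominus>\<^bsub>M\<^esub> e i) v = lincomb I e (\<lambda>i. \<ominus> v i)"
    unfolding lincomb_def using assms
    by (intro M.finsum_cong') (auto simp: Pi_iff smult_l_minus smult_r_minus)
  then show ?thesis using assms by (simp add: lincomb_minus)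
qed

lemma (in ring_module) lincomb_gens_cong:
  assumes "\<And>i. i \<in> I \<Longrightarrow> e i = f i" "f \<in> I \<rightarrow> carrier M" "v \<in> I \<rightarrow> carrier R"
  shows "lincomb I e v = lincomb I f v"
  unfolding lincomb_def using assms by (intro M.finsum_cong') (auto simp: Pi_iff)

text \<open>A transitive Lie algebroid over a ring of power series.\<close>

locale series_lie_algebroid = R?: power_series_ring R n + lie_algebroid R constants G \<alpha>
  for R :: "'k::field_char_0 mseries ring" (structure) and n :: nat
    and G :: "('k mseries, 'g) lie_module" and \<alpha> :: "'g \<Rightarrow> 'k mseries \<Rightarrow> 'k mseries" +
  assumes transitive: "transitive R constants G \<alpha>"
begin

sublocale G: ring_module R G
  using module by (simp add: ring_module_iff)

sublocale L: lie_algebra "scalars R constants" G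
  by (rule lie_algebra)

abbreviation br :: "'g \<Rightarrow> 'g \<Rightarrow> 'g" where
  "br \<equiv> lie_bracket G"

lemma br_antisym:
  assumes "x \<in> carrier G" "y \<in> carrier G"
  shows "br x y = \<ominus>\<^bsub>G\<^esub> br y x"
proof -
  have c: "br x y \<in> carrier G" "br y x \<in> carrier G" using assms L.bracket_closed by auto
  have "\<zero>\<^bsub>G\<^esub> = br (x \<oplus>\<^bsub>G\<^esub> y) (x \<oplus>\<^bsub>G\<^esub> y)" using assms by (simp add: L.bracket_alternating)
  also have "\<dots> = br x (x \<oplus>\<^bsub>G\<^esub> y) \<oplus>\<^bsub>G\<^esub> br y (x \<oplus>\<^bsub>G\<^esub> y)"
    using assms by (intro L.bracket_add_left) auto
  also have "\<dots> = br x y \<oplus>\<^bsub>G\<^esub> br y x"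
    using assms c by (simp add: L.bracket_add_right L.bracket_alternating)
  finally have "br x y \<oplus>\<^bsub>G\<^esub> br y x = \<zero>\<^bsub>G\<^esub>" by simp
  then show ?thesis using c G.M.minus_equality[of "br x y" "br y x"] by simp
qed

lemma br_zero_right: "x \<in> carrier G \<Longrightarrow> br x \<zero>\<^bsub>G\<^esub> = \<zero>\<^bsub>G\<^esub>"
  using L.bracket_add_right[of x "\<zero>\<^bsub>G\<^esub>" "\<zero>\<^bsub>G\<^esub>"] L.bracket_closed[of x "\<zero>\<^bsub>G\<^esub>"]
  by (metis G.M.add.r_cancel_one' G.M.zero_closed G.M.r_zero)

lemma br_minus_right:
  assumes "x \<in> carrier G" "y \<in> carrier G"
  shows "br x (\<ominus>\<^bsub>G\<^esub> y) = \<ominus>\<^bsub>G\<^esub> br x y"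
proof -
  have "br x (\<ominus>\<^bsub>G\<^esub> y) \<oplus>\<^bsub>G\<^esub> br x y = br x (\<ominus>\<^bsub>G\<^esub> y \<oplus>\<^bsub>G\<^esub> y)"
    using assms by (simp add: L.bracket_add_right)
  also have "\<dots> = \<zero>\<^bsub>G\<^esub>" using assms by (simp add: G.M.l_neg br_zero_right)
  finally show ?thesis using assms L.bracket_closed G.M.minus_equality[of "br x (\<ominus>\<^bsub>G\<^esub> y)" "br x y"] by simp
qed

lemma anchor_derivation: "x \<in> carrier G \<Longrightarrow> \<alpha> x \<in> carrier (derivations R constants)"
  by (rule lin_mapsD(1)[OF anchor_linear])

lemma anchor_closed [simp]: "x \<in> carrier G \<Longrightarrow> f \<in> carrier R \<Longrightarrow> \<alpha> x f \<in> carrier R"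
  by (rule derivation_closed[OF anchor_derivation])

lemma anchor_add: "x \<in> carrier G \<Longrightarrow> y \<in> carrier G \<Longrightarrow> f \<in> carrier R \<Longrightarrow>
    \<alpha> (x \<oplus>\<^bsub>G\<^esub> y) f = \<alpha> x f \<oplus> \<alpha> y f"
  using lin_mapsD(2)[OF anchor_linear] by simp

lemma anchor_smult: "r \<in> carrier R \<Longrightarrow> x \<in> carrier G \<Longrightarrow> f \<in> carrier R \<Longrightarrow>
    \<alpha> (r \<odot>\<^bsub>G\<^esub> x) f = r \<otimes> \<alpha> x f"
  using lin_mapsD(3)[OF anchor_linear] by simp

lemma anchor_br: "x \<in> carrier G \<Longrightarrow> y \<in> carrier G \<Longrightarrow> f \<in> carrier R \<Longrightarrow>
    \<alpha> (br x y) f = \<alpha> x (\<alpha> y f) \<ominus> \<alpha> y (\<alpha> x f)"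
  using anchor_lie by (simp add: lie_homs_def)

lemma anchor_zero: "f \<in> carrier R \<Longrightarrow> \<alpha> \<zero>\<^bsub>G\<^esub> f = \<zero>"
  using anchor_smult[of "\<zero>" "\<zero>\<^bsub>G\<^esub>" f] by simp

lemma anchor_lincomb:
  assumes "finite I" "e \<in> I \<rightarrow> carrier G" "v \<in> I \<rightarrow> carrier R" and f: "f \<in> carrier R"
  shows "\<alpha> (G.lincomb I e v) f = (\<Oplus>i\<in>I. v i \<otimes> \<alpha> (e i) f)"
  using assms(1-3)
proof (induction I)
  case empty
  then show ?case using f by (simp add: G.lincomb_def anchor_zero)
next
  case (insert i I)
  then show ?case using f
    by (simp add: G.lincomb_insert anchor_add anchor_smult R.finsum_insert Pi_iff)
qed

lemma br_lincomb:
  assumes x: "x \<in> carrier G" and I: "finite I" "e \<in> I \<rightarrow> carrier G" "v \<in> I \<rightarrow> carrier R"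
  shows "br x (G.lincomb I e v) =
    G.lincomb I e (\<lambda>i. \<alpha> x (v i)) \<oplus>\<^bsub>G\<^esub> G.lincomb I (\<lambda>i. br x (e i)) v"
proof -
  have "br x (G.lincomb I e v) = (\<Oplus>\<^bsub>G\<^esub>i\<in>I. br x (v i \<odot>\<^bsub>G\<^esub> e i))"
    unfolding G.lincomb_def
    by (rule G.additive_finsum_module) (use x I L.bracket_add_right L.bracket_closed in auto)
  also have "\<dots> = (\<Oplus>\<^bsub>G\<^esub>i\<in>I. \<alpha> x (v i) \<odot>\<^bsub>G\<^esub> e i \<oplus>\<^bsub>G\<^esub> v i \<odot>\<^bsub>G\<^esub> br x (e i))"
    using x I by (intro G.M.finsum_cong') (auto simp: Pi_iff leibniz L.bracket_closed)
  also have "\<dots> = G.lincomb I e (\<lambda>i. \<alpha> x (v i)) \<oplus>\<^bsub>G\<^esub> G.lincomb I (\<lambda>i. br x (e i)) v"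
    unfolding G.lincomb_def using x I by (intro G.M.finsum_addf) (auto simp: Pi_iff L.bracket_closed)
  finally show ?thesis .
qed

subsection \<open>The kernel of the anchor\<close>

text \<open>The Lie algebra \<open>\<gg>\<close>, with the anchor tested on the elements of \<open>R\<close>.\<close>

definition ker :: "'g set" where
  "ker = {x \<in> carrier G. \<forall>f\<in>carrier R. \<alpha> x f = \<zero>}"

abbreviation kerG :: "('k mseries, 'g) lie_module" where
  "kerG \<equiv> anchor_kernel R constants G \<alpha>"

lemma kerG_eq: "kerG = G\<lparr>carrier := ker\<rparr>"
proof -
  have "\<alpha> x = (\<lambda>f\<in>carrier R. \<zero>) \<longleftrightarrow> (\<forall>f\<in>carrier R. \<alpha> x f = \<zero>)" if "x \<in> carrier G" for x
  proof -
    have P: "\<alpha> x \<in> carrier R \<rightarrow>\<^sub>E carrier R" using anchor_derivation[OF that] by (simp add: in_derivations_iff)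
    have Q: "(\<lambda>f\<in>carrier R. \<zero>) \<in> carrier R \<rightarrow>\<^sub>E carrier R" by auto
    show ?thesis
    proof
      assume "\<forall>f\<in>carrier R. \<alpha> x f = \<zero>"
      then show "\<alpha> x = (\<lambda>f\<in>carrier R. \<zero>)" by (intro PiE_ext[OF P Q]) simp
    qed simp
  qed
  then have "{x \<in> carrier G. \<alpha> x = \<zero>\<^bsub>derivations R constants\<^esub>} = ker"
    unfolding ker_def derivations_simps by blast
  then show ?thesis by (simp add: anchor_kernel_def)
qed

lemma ker_submodule: "submodule ker R G"
proof (rule G.submoduleI)
  fix x assume x: "x \<in> ker"
  have "\<alpha> (\<ominus>\<^bsub>G\<^esub> x) f = \<zero>" if f: "f \<in> carrier R" for f
    using x f anchor_smult[of "\<ominus> \<one>" x f] by (simp add: ker_def G.minus_eq_smult)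
  then show "\<ominus>\<^bsub>G\<^esub> x \<in> ker" using x by (simp add: ker_def)
qed (auto simp: ker_def anchor_add anchor_smult anchor_zero)

lemma ker_subset: "x \<in> ker \<Longrightarrow> x \<in> carrier G"
  by (simp add: ker_def)

lemma module_kerG: "module R kerG"
  unfolding kerG_eq by (rule submodule.submodule_is_module[OF ker_submodule G.module_axioms])

lemma kerG_simps [simp]:
  "carrier kerG = ker" "add kerG = add G" "smult kerG = smult G" "ring.zero kerG = ring.zero G"
  by (simp_all add: kerG_eq)

lemma br_ker:
  assumes x: "x \<in> carrier G" and y: "y \<in> ker"
  shows "br x y \<in> ker"
proof -
  have yG: "y \<in> carrier G" and y0: "\<And>f. f \<in> carrier R \<Longrightarrow> \<alpha> y f = \<zero>" using y by (auto simp: ker_def)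
  have "\<alpha> x \<zero> = \<zero>" using derivation_const[OF anchor_derivation[OF x], of 0] by (simp add: zero_eq)
  then show ?thesis using x yG y0 L.bracket_closed by (simp add: ker_def anchor_br a_minus_def)
qed

lemma lift_exists: "\<exists>\<delta>. \<forall>i<n. \<delta> i \<in> carrier G \<and> \<alpha> (\<delta> i) = pderiv i"
proof -
  have "\<exists>x. x \<in> carrier G \<and> \<alpha> x = pderiv i" for i
    using transitive pderiv_derivation[of i] unfolding transitive_def by (metis imageE)
  then show ?thesis by metis
qed

end

text \<open>A family of lifts of the partial derivatives.\<close>

locale algebroid_lifts = series_lie_algebroid +
  fixes \<delta> :: "nat \<Rightarrow> 'b"
  assumes lift_closed [simp]: "i < n \<Longrightarrow> \<delta> i \<in> carrier G"
    and lift_anchor: "i < n \<Longrightarrow> \<alpha> (\<delta> i) = pderiv i"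
begin

lemma lift_anchor_apply [simp]: "i < n \<Longrightarrow> f \<in> carrier R \<Longrightarrow> \<alpha> (\<delta> i) f = series_deriv i f"
  by (simp add: lift_anchor pderiv_def)

lemma br_lifts_ker: "i < n \<Longrightarrow> j < n \<Longrightarrow> br (\<delta> i) (\<delta> j) \<in> ker"
  by (auto simp: ker_def L.bracket_closed anchor_br series_deriv_commute[of j i] a_minus_def R.r_neg)

lemma anchor_expand:
  assumes x: "x \<in> carrier G" and f: "f \<in> carrier R"
  shows "\<alpha> (G.lincomb {..<n} \<delta> (\<lambda>i. \<alpha> x (series_var i))) f = \<alpha> x f"
proof -
  have "\<alpha> (G.lincomb {..<n} \<delta> (\<lambda>i. \<alpha> x (series_var i))) f =
      (\<Oplus>i\<in>{..<n}. \<alpha> x (series_var i) \<otimes> \<alpha> (\<delta> i) f)"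
    by (rule anchor_lincomb) (use x f in auto)
  also have "\<dots> = (\<Oplus>i\<in>{..<n}. \<alpha> x (series_var i) \<otimes> series_deriv i f)"
    using x f by (intro R.finsum_cong') auto
  also have "\<dots> = \<alpha> x f" by (rule derivation_expand[OF anchor_derivation[OF x] f, symmetric])
  finally show ?thesis .
qed

text \<open>The projection of \<open>\<gg>\<^sub>R\<close> onto the kernel along the span of the lifts.\<close>

definition proj :: "'b \<Rightarrow> 'b" where
  "proj x = x \<ominus>\<^bsub>G\<^esub> G.lincomb {..<n} \<delta> (\<lambda>i. \<alpha> x (series_var i))"

lemma proj_ker:
  assumes x: "x \<in> carrier G" shows "proj x \<in> ker"
proof -
  let ?l = "G.lincomb {..<n} \<delta> (\<lambda>i. \<alpha> x (series_var i))"
  have l: "?l \<in> carrier G" using x by (intro G.lincomb_closed) auto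
  have "\<alpha> (proj x) f = \<zero>" if f: "f \<in> carrier R" for f
  proof -
    have "\<alpha> (\<ominus>\<^bsub>G\<^esub> ?l) f = \<ominus> \<alpha> ?l f"
      using l f by (simp add: G.minus_eq_smult anchor_smult R.l_minus)
    then show ?thesis
      using x l f anchor_expand[OF x f] by (simp add: proj_def a_minus_def anchor_add R.r_neg)
  qed
  then show ?thesis using x l by (simp add: ker_def proj_def)
qed

lemma proj_id:
  assumes "x \<in> ker" shows "proj x = x"
proof -
  have "G.lincomb {..<n} \<delta> (\<lambda>i. \<alpha> x (series_var i)) = \<zero>\<^bsub>G\<^esub>"
    using assms by (intro G.lincomb_zero) (auto simp: ker_def)
  then have "proj x = x \<oplus>\<^bsub>G\<^esub> \<ominus>\<^bsub>G\<^esub> \<zero>\<^bsub>G\<^esub>" by (simp add: proj_def a_minus_def)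
  also have "\<ominus>\<^bsub>G\<^esub> \<zero>\<^bsub>G\<^esub> = \<zero>\<^bsub>G\<^esub>" by (simp add: a_inv_def)
  finally show ?thesis using ker_subset[OF assms] by simp
qed

lemma proj_linear: "proj \<in> lin_maps R G kerG"
  unfolding lin_maps_def kerG_simps
proof (intro CollectI conjI ballI Pi_I)
  fix x assume x: "x \<in> carrier G"
  then show "proj x \<in> ker" by (rule proj_ker)
  have lx: "G.lincomb {..<n} \<delta> (\<lambda>i. \<alpha> x (series_var i)) \<in> carrier G" if "x \<in> carrier G" for x
    using that by (intro G.lincomb_closed) auto
  {
    fix y assume y: "y \<in> carrier G"
    have "G.lincomb {..<n} \<delta> (\<lambda>i. \<alpha> (x \<oplus>\<^bsub>G\<^esub> y) (series_var i)) =
        G.lincomb {..<n} \<delta> (\<lambda>i. \<alpha> x (series_var i) \<oplus> \<alpha> y (series_var i))"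
      using x y by (intro G.lincomb_cong) (auto simp: anchor_add)
    also have "\<dots> = G.lincomb {..<n} \<delta> (\<lambda>i. \<alpha> x (series_var i)) \<oplus>\<^bsub>G\<^esub> G.lincomb {..<n} \<delta> (\<lambda>i. \<alpha> y (series_var i))"
      using x y by (intro G.lincomb_add) auto
    finally show "proj (x \<oplus>\<^bsub>G\<^esub> y) = proj x \<oplus>\<^bsub>G\<^esub> proj y"
      using x y lx by (simp add: proj_def a_minus_def G.M.minus_add G.M.a_ac)
  next
    fix r assume r: "r \<in> carrier R"
    have "G.lincomb {..<n} \<delta> (\<lambda>i. \<alpha> (r \<odot>\<^bsub>G\<^esub> x) (series_var i)) =
        G.lincomb {..<n} \<delta> (\<lambda>i. r \<otimes> \<alpha> x (series_var i))"
      using x r by (intro G.lincomb_cong) (auto simp: anchor_smult)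
    also have "\<dots> = r \<odot>\<^bsub>G\<^esub> G.lincomb {..<n} \<delta> (\<lambda>i. \<alpha> x (series_var i))"
      using x r by (intro G.lincomb_smult) auto
    finally show "proj (r \<odot>\<^bsub>G\<^esub> x) = r \<odot>\<^bsub>G\<^esub> proj x"
      using x r lx by (simp add: proj_def a_minus_def G.smult_r_distr G.smult_r_minus)
  }
qed

lemma finite_type_kerG: "finite_type R kerG"
proof (rule finite_type_image[OF G.module_axioms module_kerG proj_linear _ finite_type])
  show "proj ` carrier G = carrier kerG"
  proof
    show "proj ` carrier G \<subseteq> carrier kerG" using proj_ker by auto
    show "carrier kerG \<subseteq> proj ` carrier G"
    proof
      fix x assume "x \<in> carrier kerG"
      then have "x \<in> ker" by simp
      then show "x \<in> proj ` carrier G" using proj_id ker_subset by (metis image_eqI)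
    qed
  qed
qed

sublocale K: connection R n kerG "\<lambda>i. br (\<delta> i)"
proof (intro connection.intro connection_axioms.intro)
  show "ring_module R kerG" using module_kerG by (simp add: ring_module_iff)
qed (use finite_type_kerG in \<open>auto simp: br_ker ker_subset L.bracket_add_right leibniz\<close>, unfold_locales)

text \<open>A lift of the Euler derivation.\<close>

definition eul :: 'b where
  "eul = G.lincomb {..<n} \<delta> series_var"

lemma eul_closed [simp]: "eul \<in> carrier G"
  by (auto simp: eul_def)

lemma radial_eq:
  assumes "y \<in> ker"
  shows "K.radial y = G.lincomb {..<n} (\<lambda>i. br (\<delta> i) y) series_var"
proof -
  have "K.radial y = K.lincomb {..<n} (\<lambda>i. br (\<delta> i) y) series_var"
    by (simp add: K.radial_def K.lincomb_def)
  also have "\<dots> = G.lincomb {..<n} (\<lambda>i. br (\<delta> i) y) series_var"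
    unfolding kerG_eq by (rule G.lincomb_submodule_eq[OF ker_submodule]) (use assms br_ker in auto)
  finally show ?thesis .
qed

text \<open>\<open>[E, y] = \<Sum>\<^sub>i x\<^sub>i [\<delta>\<^sub>i, y] - \<Sum>\<^sub>i \<alpha>(y)(x\<^sub>i) \<delta>\<^sub>i\<close>, where the second sum vanishes for \<open>y\<close> in the kernel.\<close>

lemma br_eul:
  assumes y: "y \<in> carrier G"
  shows "br eul y = G.lincomb {..<n} (\<lambda>i. br (\<delta> i) y) series_var \<ominus>\<^bsub>G\<^esub>
    G.lincomb {..<n} \<delta> (\<lambda>i. \<alpha> y (series_var i))"
proof -
  let ?a = "G.lincomb {..<n} (\<lambda>i. br (\<delta> i) y) series_var"
  let ?b = "G.lincomb {..<n} \<delta> (\<lambda>i. \<alpha> y (series_var i))"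
  have c: "?a \<in> carrier G" "?b \<in> carrier G"
    using y L.bracket_closed by (auto intro!: G.lincomb_closed)
  have "G.lincomb {..<n} (\<lambda>i. br y (\<delta> i)) series_var = G.lincomb {..<n} (\<lambda>i. \<ominus>\<^bsub>G\<^esub> br (\<delta> i) y) series_var"
    using y L.bracket_closed by (intro G.lincomb_gens_cong) (auto intro: br_antisym)
  also have "\<dots> = \<ominus>\<^bsub>G\<^esub> ?a" using y L.bracket_closed by (intro G.lincomb_neg_gens) auto
  finally have "br y eul = ?b \<oplus>\<^bsub>G\<^esub> \<ominus>\<^bsub>G\<^esub> ?a"
    unfolding eul_def using y by (simp add: br_lincomb)
  then have "br eul y = \<ominus>\<^bsub>G\<^esub> (?b \<oplus>\<^bsub>G\<^esub> \<ominus>\<^bsub>G\<^esub> ?a)" using br_antisym[of eul y] y by simp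
  then show ?thesis using c by (simp add: a_minus_def G.M.minus_add G.M.a_comm)
qed

lemma br_eul_ker: "y \<in> ker \<Longrightarrow> br eul y = K.radial y"
proof -
  assume y: "y \<in> ker"
  then have yG: "y \<in> carrier G" by (rule ker_subset)
  have "G.lincomb {..<n} \<delta> (\<lambda>i. \<alpha> y (series_var i)) = \<zero>\<^bsub>G\<^esub>"
    using y by (intro G.lincomb_zero) (auto simp: ker_def)
  moreover have "\<ominus>\<^bsub>G\<^esub> \<zero>\<^bsub>G\<^esub> = \<zero>\<^bsub>G\<^esub>" by (simp add: a_inv_def)
  moreover have "G.lincomb {..<n} (\<lambda>i. br (\<delta> i) y) series_var \<in> carrier G"
    using yG L.bracket_closed by (intro G.lincomb_closed) auto
  ultimately show "br eul y = K.radial y"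
    using y by (simp add: br_eul[OF yG] radial_eq a_minus_def)
qed

text \<open>Correcting \<open>\<delta>\<^sub>j\<close> by an element of the kernel, it becomes an eigenvector of \<open>ad E\<close> with
  eigenvalue \<open>-1\<close>.\<close>

lemma eigen_lift:
  assumes j: "j < n"
  shows "\<exists>u\<in>ker. br eul (\<delta> j \<oplus>\<^bsub>G\<^esub> u) = \<ominus>\<^bsub>G\<^esub> (\<delta> j \<oplus>\<^bsub>G\<^esub> u)"
proof -
  let ?w = "G.lincomb {..<n} (\<lambda>i. br (\<delta> i) (\<delta> j)) series_var"
  have w: "?w \<in> ker"
    by (rule G.lincomb_in_submodule[OF ker_submodule]) (use j br_lifts_ker in auto)
  have "\<ominus>\<^bsub>G\<^esub> ?w \<in> carrier kerG" using G.submoduleE(3)[OF ker_submodule w] by simp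
  from K.radial_shift_surj[OF order_refl this]
  obtain u where u: "u \<in> ker" "K.radial u \<oplus>\<^bsub>G\<^esub> u = \<ominus>\<^bsub>G\<^esub> ?w"
    using ker_subset by (auto simp: one_eq[symmetric])
  have c: "u \<in> carrier G" "?w \<in> carrier G" "K.radial u \<in> carrier G" "\<delta> j \<in> carrier G"
    using u w j K.radial_closed[of u] ker_subset by auto
  have "G.lincomb {..<n} \<delta> (\<lambda>i. \<alpha> (\<delta> j) (series_var i)) = G.lincomb {..<n} \<delta> (\<lambda>i. if j = i then \<one> else \<zero>)"
    using j by (intro G.lincomb_cong) (auto simp: deriv_var)
  also have "\<dots> = \<delta> j" by (rule G.lincomb_unit) (use j in auto)
  finally have "br eul (\<delta> j) = ?w \<ominus>\<^bsub>G\<^esub> \<delta> j" using br_eul[OF c(4)] by simp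
  then have "br eul (\<delta> j \<oplus>\<^bsub>G\<^esub> u) = (?w \<oplus>\<^bsub>G\<^esub> \<ominus>\<^bsub>G\<^esub> \<delta> j) \<oplus>\<^bsub>G\<^esub> K.radial u"
    using u c by (simp add: L.bracket_add_right br_eul_ker a_minus_def)
  also have "K.radial u = \<ominus>\<^bsub>G\<^esub> ?w \<oplus>\<^bsub>G\<^esub> \<ominus>\<^bsub>G\<^esub> u"
  proof -
    have "K.radial u = (K.radial u \<oplus>\<^bsub>G\<^esub> u) \<oplus>\<^bsub>G\<^esub> \<ominus>\<^bsub>G\<^esub> u" using c by (simp add: G.M.a_assoc G.M.r_neg)
    then show ?thesis using u(2) by simp
  qed
  also have "(?w \<oplus>\<^bsub>G\<^esub> \<ominus>\<^bsub>G\<^esub> \<delta> j) \<oplus>\<^bsub>G\<^esub> (\<ominus>\<^bsub>G\<^esub> ?w \<oplus>\<^bsub>G\<^esub> \<ominus>\<^bsub>G\<^esub> u) = (?w \<oplus>\<^bsub>G\<^esub> \<ominus>\<^bsub>G\<^esub> ?w) \<oplus>\<^bsub>G\<^esub> (\<ominus>\<^bsub>G\<^esub> \<delta> j \<oplus>\<^bsub>G\<^esub> \<ominus>\<^bsub>G\<^esub> u)"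
    using c by (simp add: G.M.a_ac)
  also have "\<dots> = \<ominus>\<^bsub>G\<^esub> (\<delta> j \<oplus>\<^bsub>G\<^esub> u)" using c by (simp add: G.M.r_neg G.M.minus_add)
  finally show ?thesis using u(1) by blast
qed

text \<open>The bracket of two such eigenvectors has eigenvalue \<open>-2\<close> and lies in the kernel, where \<open>ad E\<close>
  only has eigenvalues \<open>\<ge> 0\<close>.\<close>

lemma eigen_commute:
  assumes c: "c \<in> carrier G" "br eul c = \<ominus>\<^bsub>G\<^esub> c" and d: "d \<in> carrier G" "br eul d = \<ominus>\<^bsub>G\<^esub> d"
    and k: "br c d \<in> ker"
  shows "br c d = \<zero>\<^bsub>G\<^esub>"
proof (rule K.radial_shift_inj[of 2, unfolded kerG_simps])
  let ?b = "br c d"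
  have b: "?b \<in> carrier G" using k by (rule ker_subset)
  have rb: "br eul ?b \<in> carrier G" using b L.bracket_closed by simp
  have "br eul (br c d) \<oplus>\<^bsub>G\<^esub> br c (br d eul) \<oplus>\<^bsub>G\<^esub> br d (br eul c) = \<zero>\<^bsub>G\<^esub>"
    using c d by (intro L.jacobi) auto
  moreover have "br d eul = d" using br_antisym[OF d(1) eul_closed] d by simp
  moreover have "br d (br eul c) = ?b" using br_minus_right[OF d(1) c(1)] br_antisym[OF c(1) d(1)] c(2) by simp
  ultimately have "br eul ?b \<oplus>\<^bsub>G\<^esub> (?b \<oplus>\<^bsub>G\<^esub> ?b) = \<zero>\<^bsub>G\<^esub>" using b rb by (simp add: G.M.a_assoc)
  moreover have "const_series (of_nat 2) \<odot>\<^bsub>G\<^esub> ?b = ?b \<oplus>\<^bsub>G\<^esub> ?b"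
  proof -
    have "const_series (of_nat 2) = \<one> \<oplus> \<one>" by (simp add: one_eq const_add)
    then show ?thesis using b by (simp add: G.smult_l_distr)
  qed
  ultimately show "K.radial ?b \<oplus>\<^bsub>G\<^esub> const_series (of_nat 2) \<odot>\<^bsub>G\<^esub> ?b = \<zero>\<^bsub>G\<^esub>"
    using br_eul_ker[OF k] by simp
qed (use k in auto)

lemma commuting_lifts:
  "\<exists>e. (\<forall>i<n. e i \<in> carrier G \<and> \<alpha> (e i) = pderiv i) \<and> (\<forall>i<n. \<forall>j<n. br (e i) (e j) = \<zero>\<^bsub>G\<^esub>)"
proof -
  have "\<exists>u. \<forall>j\<in>{..<n}. u j \<in> ker \<and> br eul (\<delta> j \<oplus>\<^bsub>G\<^esub> u j) = \<ominus>\<^bsub>G\<^esub> (\<delta> j \<oplus>\<^bsub>G\<^esub> u j)"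
    using eigen_lift by (intro bchoice) blast
  then obtain u where u: "\<And>j. j < n \<Longrightarrow> u j \<in> ker"
      "\<And>j. j < n \<Longrightarrow> br eul (\<delta> j \<oplus>\<^bsub>G\<^esub> u j) = \<ominus>\<^bsub>G\<^esub> (\<delta> j \<oplus>\<^bsub>G\<^esub> u j)" by blast
  define e where "e j = \<delta> j \<oplus>\<^bsub>G\<^esub> u j" for j
  have eG: "e j \<in> carrier G" if "j < n" for j using that u(1) ker_subset by (simp add: e_def)
  have ea: "\<alpha> (e j) = pderiv j" if j: "j < n" for j
  proof (rule PiE_ext)
    show "\<alpha> (e j) \<in> carrier R \<rightarrow>\<^sub>E carrier R" "pderiv j \<in> carrier R \<rightarrow>\<^sub>E carrier R"
      using anchor_derivation[OF eG[OF j]] pderiv_derivation[of j] by (auto simp: in_derivations_iff)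
    fix f assume f: "f \<in> carrier R"
    show "\<alpha> (e j) f = pderiv j f"
      using j f u(1)[OF j] by (simp add: e_def anchor_add ker_def pderiv_def)
  qed
  have "br (e i) (e j) = \<zero>\<^bsub>G\<^esub>" if "i < n" "j < n" for i j
  proof (rule eigen_commute)
    show "br (e i) (e j) \<in> ker"
      using that eG ea by (auto simp: ker_def L.bracket_closed anchor_br pderiv_def
          series_deriv_commute[of j i] a_minus_def R.r_neg)
  qed (use that eG u(2) in \<open>auto simp: e_def\<close>)
  then show ?thesis using eG ea by blast
qed

end

context series_lie_algebroid
begin

text \<open>The splitting is \<open>D \<mapsto> \<Sum>\<^sub>i D(x\<^sub>i) e\<^sub>i\<close> for commuting lifts \<open>e\<^sub>i\<close> of the partial derivatives.\<close>

theorem transitive_split: "is_split R constants G \<alpha>"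
proof -
  obtain \<delta> where "\<forall>i<n. \<delta> i \<in> carrier G \<and> \<alpha> (\<delta> i) = pderiv i" using lift_exists by blast
  then interpret algebroid_lifts R n G \<alpha> \<delta> by unfold_locales auto
  obtain e where e: "\<And>i. i < n \<Longrightarrow> e i \<in> carrier G" "\<And>i. i < n \<Longrightarrow> \<alpha> (e i) = pderiv i"
      "\<And>i j. i < n \<Longrightarrow> j < n \<Longrightarrow> br (e i) (e j) = \<zero>\<^bsub>G\<^esub>" using commuting_lifts by blast
  define \<phi> where "\<phi> D = G.lincomb {..<n} e (\<lambda>i. D (series_var i))"
    for D :: "'k mseries \<Rightarrow> 'k mseries"
  let ?T = "derivations R constants"
  have eG: "e \<in> {..<n} \<rightarrow> carrier G" using e by auto
  have DR: "(\<lambda>i. D (series_var i)) \<in> {..<n} \<rightarrow> carrier R" if "D \<in> carrier ?T" for D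
    using derivation_closed[OF that] by auto
  have \<phi>G: "\<phi> D \<in> carrier G" if "D \<in> carrier ?T" for D
    unfolding \<phi>_def using eG DR[OF that] by (rule G.lincomb_closed)
  have \<phi>a: "\<alpha> (\<phi> D) f = D f" if D: "D \<in> carrier ?T" and f: "f \<in> carrier R" for D f
  proof -
    have "\<alpha> (\<phi> D) f = (\<Oplus>i\<in>{..<n}. D (series_var i) \<otimes> \<alpha> (e i) f)"
      unfolding \<phi>_def using f by (intro anchor_lincomb eG DR[OF D]) auto
    also have "\<dots> = (\<Oplus>i\<in>{..<n}. D (series_var i) \<otimes> series_deriv i f)"
      using e f derivation_closed[OF D] by (intro R.finsum_cong') (auto simp: pderiv_def)
    also have "\<dots> = D f" by (rule derivation_expand[OF D f, symmetric])
    finally show ?thesis .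
  qed
  have "\<phi> \<in> lin_maps R ?T G"
    unfolding lin_maps_def
  proof (intro CollectI conjI ballI Pi_I)
    fix D assume D: "D \<in> carrier ?T"
    then show "\<phi> D \<in> carrier G" by (rule \<phi>G)
    {
      fix D' assume D': "D' \<in> carrier ?T"
      have "\<phi> (D \<oplus>\<^bsub>?T\<^esub> D') = G.lincomb {..<n} e (\<lambda>i. D (series_var i) \<oplus> D' (series_var i))"
        unfolding \<phi>_def using DR[OF D] DR[OF D'] by (intro G.lincomb_cong[OF eG]) auto
      then show "\<phi> (D \<oplus>\<^bsub>?T\<^esub> D') = \<phi> D \<oplus>\<^bsub>G\<^esub> \<phi> D'"
        unfolding \<phi>_def using G.lincomb_add[OF eG DR[OF D] DR[OF D']] by simp
    next
      fix r assume r: "r \<in> carrier R"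
      have "\<phi> (r \<odot>\<^bsub>?T\<^esub> D) = G.lincomb {..<n} e (\<lambda>i. r \<otimes> D (series_var i))"
        unfolding \<phi>_def using DR[OF D] r by (intro G.lincomb_cong[OF eG]) auto
      then show "\<phi> (r \<odot>\<^bsub>?T\<^esub> D) = r \<odot>\<^bsub>G\<^esub> \<phi> D"
        unfolding \<phi>_def using G.lincomb_smult[OF _ eG DR[OF D] r] by simp
    }
  qed
  moreover have "\<phi> \<in> lie_homs ?T G"
    unfolding lie_homs_def
  proof (intro CollectI conjI ballI Pi_I)
    fix D assume D: "D \<in> carrier ?T"
    then show "\<phi> D \<in> carrier G" by (rule \<phi>G)
    fix D' assume D': "D' \<in> carrier ?T"
    define a where "a i = D (series_var i)" for i
    define b where "b i = D' (series_var i)" for i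
    have a: "a \<in> {..<n} \<rightarrow> carrier R" and b: "b \<in> {..<n} \<rightarrow> carrier R"
      using DR[OF D] DR[OF D'] by (auto simp: a_def b_def)
    have brX: "br (\<phi> D) (e j) = G.lincomb {..<n} e (\<lambda>i. \<ominus> series_deriv j (a i))" if j: "j < n" for j
    proof -
      have "br (e j) (\<phi> D) = G.lincomb {..<n} e (\<lambda>i. \<alpha> (e j) (a i)) \<oplus>\<^bsub>G\<^esub> G.lincomb {..<n} (\<lambda>i. br (e j) (e i)) a"
        unfolding \<phi>_def a_def[symmetric] using e(1)[OF j] a eG by (intro br_lincomb) auto
      also have "G.lincomb {..<n} (\<lambda>i. br (e j) (e i)) a = \<zero>\<^bsub>G\<^esub>"
        unfolding G.lincomb_def using a e(3)[OF j] by (intro G.M.add.finprod_one_eqI) (auto simp: Pi_iff)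
      also have "G.lincomb {..<n} e (\<lambda>i. \<alpha> (e j) (a i)) = G.lincomb {..<n} e (\<lambda>i. series_deriv j (a i))"
        using a e(2)[OF j] by (intro G.lincomb_cong[OF eG]) (auto simp: pderiv_def)
      finally have "br (e j) (\<phi> D) = G.lincomb {..<n} e (\<lambda>i. series_deriv j (a i))"
        using a eG by (simp add: G.lincomb_closed Pi_iff)
      then have "br (\<phi> D) (e j) = \<ominus>\<^bsub>G\<^esub> G.lincomb {..<n} e (\<lambda>i. series_deriv j (a i))"
        using br_antisym[OF \<phi>G[OF D] e(1)[OF j]] by simp
      also have "\<dots> = G.lincomb {..<n} e (\<lambda>i. \<ominus> series_deriv j (a i))"
        using a eG by (intro G.lincomb_minus[symmetric]) auto
      finally show ?thesis .
    qed
    have "br (\<phi> D) (\<phi> D') = G.lincomb {..<n} e (\<lambda>i. \<alpha> (\<phi> D) (b i)) \<oplus>\<^bsub>G\<^esub>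
        G.lincomb {..<n} (\<lambda>j. br (\<phi> D) (e j)) b"
      unfolding \<phi>_def[of D'] b_def[symmetric] by (rule br_lincomb[OF \<phi>G[OF D] _ eG b]) simp
    also have "G.lincomb {..<n} (\<lambda>j. br (\<phi> D) (e j)) b =
        G.lincomb {..<n} e (\<lambda>i. \<Oplus>j\<in>{..<n}. b j \<otimes> \<ominus> series_deriv j (a i))"
      by (rule G.lincomb_lincomb) (use eG a b brX in auto)
    also have "G.lincomb {..<n} e (\<lambda>i. \<alpha> (\<phi> D) (b i)) \<oplus>\<^bsub>G\<^esub> \<dots> =
        G.lincomb {..<n} e (\<lambda>i. \<alpha> (\<phi> D) (b i) \<oplus> (\<Oplus>j\<in>{..<n}. b j \<otimes> \<ominus> series_deriv j (a i)))"
      using a b \<phi>G[OF D] by (intro G.lincomb_add[symmetric] eG) (auto simp: Pi_iff)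
    also have "\<dots> = \<phi> (lie_bracket ?T D D')"
      unfolding \<phi>_def[of "lie_bracket ?T D D'"]
    proof (rule G.lincomb_cong[OF eG])
      show "(\<lambda>i. lie_bracket ?T D D' (series_var i)) \<in> {..<n} \<rightarrow> carrier R"
        using derivation_closed[OF D] derivation_closed[OF D'] by auto
      fix i assume "i \<in> {..<n}"
      then have i: "i < n" by simp
      have ai: "a i \<in> carrier R" and bi: "b i \<in> carrier R" using a b i by auto
      have "(\<Oplus>j\<in>{..<n}. b j \<otimes> \<ominus> series_deriv j (a i)) =
          (\<Oplus>j\<in>{..<n}. (\<ominus> \<one>) \<otimes> (b j \<otimes> series_deriv j (a i)))"
        using ai b by (intro R.finsum_cong') (auto simp: R.l_minus R.r_minus Pi_iff)
      also have "\<dots> = (\<ominus> \<one>) \<otimes> (\<Oplus>j\<in>{..<n}. b j \<otimes> series_deriv j (a i))"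
        using ai b by (intro R.finsum_rdistr[symmetric]) (auto simp: Pi_iff)
      also have "(\<Oplus>j\<in>{..<n}. b j \<otimes> series_deriv j (a i)) = D' (a i)"
        unfolding b_def by (rule derivation_expand[OF D' ai, symmetric])
      finally have "(\<Oplus>j\<in>{..<n}. b j \<otimes> \<ominus> series_deriv j (a i)) = \<ominus> D' (a i)"
        using derivation_closed[OF D' ai] by (simp add: R.l_minus del: minus_coeff)
      then show "\<alpha> (\<phi> D) (b i) \<oplus> (\<Oplus>j\<in>{..<n}. b j \<otimes> \<ominus> series_deriv j (a i)) =
          lie_bracket ?T D D' (series_var i)"
        using \<phi>a[OF D bi] i by (simp add: a_def b_def a_minus_def)
    qed
    finally show "\<phi> (lie_bracket ?T D D') = br (\<phi> D) (\<phi> D')" by simp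
  qed
  moreover have "\<alpha> (\<phi> D) = D" if D: "D \<in> carrier ?T" for D
  proof (rule PiE_ext)
    show "\<alpha> (\<phi> D) \<in> carrier R \<rightarrow>\<^sub>E carrier R" "D \<in> carrier R \<rightarrow>\<^sub>E carrier R"
      using anchor_derivation[OF \<phi>G[OF D]] D by (auto simp: in_derivations_iff)
  qed (rule \<phi>a[OF D])
  ultimately show ?thesis unfolding is_split_def splitting_def by blast
qed

end

section \<open>Modules over a split Lie algebroid\<close>

lemma endo_lie_simps [simp]:
  "carrier (endo_lie R K M) = (carrier M \<rightarrow>\<^sub>E carrier M) \<inter> lin_maps (scalars R K) M M"
  "add (endo_lie R K M) = (\<lambda>f g. \<lambda>m\<in>carrier M. f m \<oplus>\<^bsub>M\<^esub> g m)"
  "smult (endo_lie R K M) = (\<lambda>r f. \<lambda>m\<in>carrier M. r \<odot>\<^bsub>M\<^esub> f m)"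
  "lie_bracket (endo_lie R K M) = (\<lambda>f g. \<lambda>m\<in>carrier M. f (g m) \<ominus>\<^bsub>M\<^esub> g (f m))"
  by (simp_all add: endo_lie_def)

lemma lin_maps_finsum:
  assumes A: "module S A" and C: "module S C" and h: "h \<in> lin_maps S A C"
    and F: "finite I" "F \<in> I \<rightarrow> carrier A"
  shows "h (finsum A F I) = finsum C (\<lambda>i. h (F i)) I"
proof -
  interpret A: module S A by fact
  interpret C: module S C by fact
  show ?thesis
    using F
    by (induction I) (simp_all add: A.M.finsum_insert C.M.finsum_insert lin_maps_zero[OF A C h]
        lin_mapsD[OF h] Pi_iff)
qed

context power_series_ring
begin

lemma derivation_add_closed:
  assumes D: "D \<in> carrier (derivations R constants)" and E: "E \<in> carrier (derivations R constants)"
  shows "D \<oplus>\<^bsub>derivations R constants\<^esub> E \<in> carrier (derivations R constants)"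
proof -
  note c = derivation_closed[OF D] derivation_closed[OF E]
  show ?thesis
    using D E c unfolding in_derivations_iff
    by (auto simp: l_distr r_distr a_ac)
qed

lemma derivation_smult_closed:
  assumes D: "D \<in> carrier (derivations R constants)" and r: "r \<in> carrier R"
  shows "r \<odot>\<^bsub>derivations R constants\<^esub> D \<in> carrier (derivations R constants)"
proof -
  note c = derivation_closed[OF D]
  show ?thesis
    using D c r unfolding in_derivations_iff
    by (auto simp: r_distr m_lcomm m_assoc)
qed

end

text \<open>A module of finite type over a transitive Lie algebroid with a chosen splitting.\<close>

locale split_algebroid_module = series_lie_algebroid R n G \<alpha> + lie_algebroid_module R constants G \<alpha> M \<rho>
  for R :: "'k::field_char_0 mseries ring" (structure) and n :: nat
    and G :: "('k mseries, 'g) lie_module" and \<alpha> :: "'g \<Rightarrow> 'k mseries \<Rightarrow> 'k mseries"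
    and M :: "('k mseries, 'm) module" and \<rho> :: "'g \<Rightarrow> 'm \<Rightarrow> 'm" +
  fixes \<phi> :: "('k mseries \<Rightarrow> 'k mseries) \<Rightarrow> 'g"
  assumes finite_type_M: "Defs.finite_type R M"
    and splitting: "splitting R constants G \<alpha> \<phi>"
begin

sublocale M: ring_module R M
  using module_M by (simp add: ring_module_iff)

abbreviation T where
  "T \<equiv> derivations R constants"

lemma \<phi>_lin: "\<phi> \<in> lin_maps R T G" and \<phi>_lie: "\<phi> \<in> lie_homs T G"
  and \<phi>_anchor: "D \<in> carrier T \<Longrightarrow> \<alpha> (\<phi> D) = D"
  using splitting by (auto simp: splitting_def)

lemma \<phi>_closed [simp]: "D \<in> carrier T \<Longrightarrow> \<phi> D \<in> carrier G"
  by (rule lin_mapsD(1)[OF \<phi>_lin])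

lemma \<rho>_closed [simp]: "x \<in> carrier G \<Longrightarrow> m \<in> carrier M \<Longrightarrow> \<rho> x m \<in> carrier M"
  using lin_mapsD(1)[OF action_linear, of x] by auto

lemma \<rho>_add_right: "x \<in> carrier G \<Longrightarrow> m \<in> carrier M \<Longrightarrow> m' \<in> carrier M \<Longrightarrow>
    \<rho> x (m \<oplus>\<^bsub>M\<^esub> m') = \<rho> x m \<oplus>\<^bsub>M\<^esub> \<rho> x m'"
  using lin_mapsD(1)[OF action_linear, of x] by (auto dest: lin_mapsD(2))

lemma \<rho>_add_left: "x \<in> carrier G \<Longrightarrow> y \<in> carrier G \<Longrightarrow> m \<in> carrier M \<Longrightarrow>
    \<rho> (x \<oplus>\<^bsub>G\<^esub> y) m = \<rho> x m \<oplus>\<^bsub>M\<^esub> \<rho> y m"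
  using lin_mapsD(2)[OF action_linear, of x y] by simp

lemma \<rho>_smult_left: "r \<in> carrier R \<Longrightarrow> x \<in> carrier G \<Longrightarrow> m \<in> carrier M \<Longrightarrow>
    \<rho> (r \<odot>\<^bsub>G\<^esub> x) m = r \<odot>\<^bsub>M\<^esub> \<rho> x m"
  using lin_mapsD(3)[OF action_linear, of r x] by simp

lemma \<rho>_bracket: "x \<in> carrier G \<Longrightarrow> y \<in> carrier G \<Longrightarrow> m \<in> carrier M \<Longrightarrow>
    \<rho> (br x y) m = \<rho> x (\<rho> y m) \<ominus>\<^bsub>M\<^esub> \<rho> y (\<rho> x m)"
  using action_lie by (simp add: lie_homs_def)

lemma \<rho>_zero_left: "m \<in> carrier M \<Longrightarrow> \<rho> \<zero>\<^bsub>G\<^esub> m = \<zero>\<^bsub>M\<^esub>"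
  using \<rho>_smult_left[of "\<zero>" "\<zero>\<^bsub>G\<^esub>" m] by simp

lemma \<rho>_lincomb:
  assumes "finite I" "e \<in> I \<rightarrow> carrier G" "v \<in> I \<rightarrow> carrier R" "m \<in> carrier M"
  shows "\<rho> (G.lincomb I e v) m = M.lincomb I (\<lambda>i. \<rho> (e i) m) v"
  using assms
proof (induction I)
  case empty
  then show ?case by (simp add: G.lincomb_def M.lincomb_def \<rho>_zero_left)
next
  case (insert i I)
  have "(\<lambda>i. \<rho> (e i) m) \<in> insert i I \<rightarrow> carrier M" using insert.prems by (auto simp: Pi_iff)
  then show ?case using insert
    by (simp add: G.lincomb_insert M.lincomb_insert \<rho>_add_left \<rho>_smult_left Pi_iff)
qed

text \<open>The lifts of the partial derivatives given by the splitting.\<close>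

definition lift :: "nat \<Rightarrow> 'g" where
  "lift i = \<phi> (pderiv i)"

lemma lift_closed [simp]: "lift i \<in> carrier G"
  by (simp add: lift_def pderiv_derivation)

text \<open>By linearity \<open>\<phi>\<close> is determined by these lifts. The partial sums \<open>E\<close> of the expansion of \<open>D\<close> are
  again derivations.\<close>

lemma \<phi>_expand:
  assumes D: "D \<in> carrier T"
  shows "\<phi> D = G.lincomb {..<n} lift (\<lambda>i. D (series_var i))"
proof -
  have lG: "lift \<in> I \<rightarrow> carrier G" for I by simp
  have DR: "(\<lambda>i. D (series_var i)) \<in> {..<n} \<rightarrow> carrier R" using derivation_closed[OF D] by auto
  define E where "E J = (\<lambda>f\<in>carrier R. \<Oplus>i\<in>J. D (series_var i) \<otimes> series_deriv i f)" for J
  have "E J \<in> carrier T \<and> \<phi> (E J) = G.lincomb J lift (\<lambda>i. D (series_var i))"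
    if "finite J" "J \<subseteq> {..<n}" for J
    using that
  proof (induction J)
    case empty
    have "E {} = \<zero> \<odot>\<^bsub>T\<^esub> pderiv 0" by (auto simp: E_def pderiv_def fun_eq_iff)
    then show ?case
      using lin_mapsD(3)[OF \<phi>_lin R.zero_closed pderiv_derivation[of 0]]
        derivation_smult_closed[OF pderiv_derivation R.zero_closed] pderiv_derivation[of 0]
      by (simp add: G.lincomb_def del: derivations_simps)
  next
    case (insert i J)
    have i: "D (series_var i) \<in> carrier R" using insert.prems derivation_closed[OF D] by simp
    have J: "(\<lambda>i. D (series_var i)) \<in> insert i J \<rightarrow> carrier R" using insert.prems DR by blast
    have s: "D (series_var i) \<odot>\<^bsub>T\<^esub> pderiv i \<in> carrier T"
      by (rule derivation_smult_closed[OF pderiv_derivation i])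
    have EJ: "E J \<in> carrier T" "\<phi> (E J) = G.lincomb J lift (\<lambda>i. D (series_var i))" using insert by auto
    have "E (insert i J) = (D (series_var i) \<odot>\<^bsub>T\<^esub> pderiv i) \<oplus>\<^bsub>T\<^esub> E J"
    proof
      fix f
      show "E (insert i J) f = ((D (series_var i) \<odot>\<^bsub>T\<^esub> pderiv i) \<oplus>\<^bsub>T\<^esub> E J) f"
        using insert.hyps J
        by (cases "f \<in> carrier R") (auto simp: E_def pderiv_def R.finsum_insert Pi_iff)
    qed
    then show ?case
      using derivation_add_closed[OF s EJ(1)] lin_mapsD(2)[OF \<phi>_lin s EJ(1)]
        lin_mapsD(3)[OF \<phi>_lin i pderiv_derivation] EJ(2) insert.hyps J
        G.lincomb_insert[of J i lift "\<lambda>i. D (series_var i)"]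
      by (simp add: lift_def[symmetric] del: derivations_simps)
  qed
  from this[of "{..<n}"] have "\<phi> (E {..<n}) = G.lincomb {..<n} lift (\<lambda>i. D (series_var i))" by simp
  moreover have "E {..<n} = D"
  proof (rule PiE_ext)
    show "E {..<n} \<in> carrier R \<rightarrow>\<^sub>E carrier R" using DR by (auto simp: E_def Pi_iff)
    show "D \<in> carrier R \<rightarrow>\<^sub>E carrier R" using D by (simp add: in_derivations_iff)
  qed (simp add: E_def derivation_expand[OF D, symmetric])
  ultimately show ?thesis by simp
qed

lemma lift_commute: "br (lift i) (lift j) = \<zero>\<^bsub>G\<^esub>"
proof -
  have "lie_bracket T (pderiv i) (pderiv j) = \<zero> \<odot>\<^bsub>T\<^esub> pderiv 0"
    by (auto simp: pderiv_def fun_eq_iff series_deriv_commute[of i j] a_minus_def R.r_neg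
        simp del: minus_coeff plus_coeff)
  moreover have "\<phi> (lie_bracket T (pderiv i) (pderiv j)) = br (lift i) (lift j)"
    using \<phi>_lie pderiv_derivation[of i] pderiv_derivation[of j] unfolding lie_homs_def lift_def by blast
  moreover have "\<phi> (\<zero> \<odot>\<^bsub>T\<^esub> pderiv 0) = \<zero>\<^bsub>G\<^esub>"
    using lin_mapsD(3)[OF \<phi>_lin R.zero_closed pderiv_derivation[of 0]] pderiv_derivation[of 0]
    by (simp del: derivations_simps)
  ultimately show ?thesis by simp
qed

sublocale lifts: algebroid_lifts R n G \<alpha> lift
  by unfold_locales (simp_all add: \<phi>_anchor pderiv_derivation lift_def)

text \<open>The adjoint action of the lifts on the kernel is a flat connection, as is their action on
  \<open>M\<close>.\<close>

sublocale ad: flat_connection R n kerG "\<lambda>i. br (lift i)"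
proof
  fix i j x assume "i < n" "j < n" and "x \<in> carrier kerG"
  then have x: "x \<in> carrier G" by (simp add: ker_subset)
  have c: "br (lift a) x \<in> carrier G" "br (lift a) (br (lift b) x) \<in> carrier G" for a b
    using x L.bracket_closed by auto
  have "br (lift i) (br (lift j) x) \<oplus>\<^bsub>G\<^esub> br (lift j) (br x (lift i)) \<oplus>\<^bsub>G\<^esub> br x (br (lift i) (lift j)) = \<zero>\<^bsub>G\<^esub>"
    using x by (intro L.jacobi) auto
  moreover have "br (lift j) (br x (lift i)) = \<ominus>\<^bsub>G\<^esub> br (lift j) (br (lift i) x)"
    using br_antisym[OF x lift_closed] br_minus_right[OF lift_closed c(1)] by simp
  ultimately have "br (lift i) (br (lift j) x) \<ominus>\<^bsub>G\<^esub> br (lift j) (br (lift i) x) = \<zero>\<^bsub>G\<^esub>"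
    using x c by (simp add: lift_commute br_zero_right a_minus_def)
  then show "br (lift i) (br (lift j) x) = br (lift j) (br (lift i) x)"
    using c by (simp add: G.M.diff_eq_zero_iff)
qed

abbreviation nabla :: "nat \<Rightarrow> 'm \<Rightarrow> 'm" where
  "nabla i \<equiv> \<rho> (lift i)"

sublocale flat: flat_connection R n M nabla
proof unfold_locales
  fix i assume i: "i < n"
  fix r m assume r: "r \<in> carrier R" and m: "m \<in> carrier M"
  show "nabla i (r \<odot>\<^bsub>M\<^esub> m) = series_deriv i r \<odot>\<^bsub>M\<^esub> m \<oplus>\<^bsub>M\<^esub> r \<odot>\<^bsub>M\<^esub> nabla i m"
    using action_leibniz[OF lift_closed[of i] r m] lifts.lift_anchor_apply[OF i r] by simp
next
  fix i j m assume "i < n" "j < n" and m: "m \<in> carrier M"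
  have "nabla i (nabla j m) \<ominus>\<^bsub>M\<^esub> nabla j (nabla i m) = \<zero>\<^bsub>M\<^esub>"
    using \<rho>_bracket[OF lift_closed lift_closed m, of i j] m by (simp add: lift_commute \<rho>_zero_left)
  then show "nabla i (nabla j m) = nabla j (nabla i m)"
    using m by (simp add: M.M.diff_eq_zero_iff)
qed (auto simp: \<rho>_add_right finite_type_M)

abbreviation H :: "'m set" where
  "H \<equiv> flat.hor"

lemma H_closed: "h \<in> H \<Longrightarrow> h \<in> carrier M"
  using flat.hor_subset by blast

lemma \<rho>_\<phi>:
  assumes D: "D \<in> carrier T" and m: "m \<in> carrier M"
  shows "\<rho> (\<phi> D) m = M.lincomb {..<n} (\<lambda>i. nabla i m) (\<lambda>i. D (series_var i))"
  unfolding \<phi>_expand[OF D]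
proof (rule \<rho>_lincomb)
  show "(\<lambda>i. D (series_var i)) \<in> {..<n} \<rightarrow> carrier R"
    by (intro Pi_I derivation_closed[OF D]) simp
qed (use m in simp_all)

lemma \<rho>_\<phi>_hor:
  assumes "D \<in> carrier T" "m \<in> H"
  shows "\<rho> (\<phi> D) m = \<zero>\<^bsub>M\<^esub>"
proof -
  have m: "m \<in> carrier M" "\<And>i. i < n \<Longrightarrow> nabla i m = \<zero>\<^bsub>M\<^esub>"
    using assms(2) by (simp_all add: flat.hor_def)
  have "M.lincomb {..<n} (\<lambda>i. nabla i m) (\<lambda>i. D (series_var i)) = \<zero>\<^bsub>M\<^esub>"
    unfolding M.lincomb_def
    by (intro M.M.add.finprod_one_eqI) (simp add: m(2) derivation_closed[OF assms(1)])
  then show ?thesis using \<rho>_\<phi>[OF assms(1) m(1)] by simp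
qed

lemma invariants_eq: "invariants R constants M \<rho> \<phi> = H"
proof
  show "H \<subseteq> invariants R constants M \<rho> \<phi>"
    using \<rho>_\<phi>_hor flat.hor_subset by (auto simp: invariants_def)
  show "invariants R constants M \<rho> \<phi> \<subseteq> H"
  proof
    fix m assume m: "m \<in> invariants R constants M \<rho> \<phi>"
    then have "nabla i m = \<zero>\<^bsub>M\<^esub>" for i
      using pderiv_derivation[of i] unfolding invariants_def lift_def by blast
    then show "m \<in> H" using m by (simp add: invariants_def flat.hor_def)
  qed
qed

theorem span_invariants: "span_mod R M (invariants R constants M \<rho> \<phi>) = carrier M"
proof -
  have "carrier M = span_mod R M (carrier M \<inter> H)"
    by (rule flat.stable_submodule_span_hor[OF M.carrier_is_submodule]) auto
  moreover have "carrier M \<inter> H = H" using flat.hor_subset by blast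
  ultimately show ?thesis by (simp add: invariants_eq)
qed

subsection \<open>Trivialisation\<close>

abbreviation k where
  "k \<equiv> scalars R constants"

abbreviation W where
  "W \<equiv> reduction R M"

lemma W_eq: "W = quot_module M flat.mN"
  by (simp add: reduction_def max_ideal_eq flat.mN_def)

abbreviation cls :: "'m \<Rightarrow> 'm set" where
  "cls m \<equiv> flat.mN +>\<^bsub>M\<^esub> m"

lemmas cls_facts = M.coset_eq_iff[OF flat.mN_submodule] M.coset_mem_iff[OF flat.mN_submodule]
  M.quot_add[OF flat.mN_submodule, folded W_eq] M.quot_smult[OF flat.mN_submodule, folded W_eq]
  M.carrier_quot_module[OF flat.mN_submodule, folded W_eq]

lemma hor_cls_inj:
  assumes h: "h \<in> H" and h': "h' \<in> H" and eq: "cls h = cls h'"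
  shows "h = h'"
proof -
  have c: "h \<in> carrier M" "h' \<in> carrier M" using h h' flat.hor_subset by auto
  have "h \<ominus>\<^bsub>M\<^esub> h' \<in> flat.mN" using eq c by (simp add: cls_facts)
  moreover have "h \<ominus>\<^bsub>M\<^esub> h' \<in> H" unfolding a_minus_def by (intro flat.hor_add flat.hor_minus h h')
  ultimately have "h \<ominus>\<^bsub>M\<^esub> h' = \<zero>\<^bsub>M\<^esub>" by (intro flat.hor_in_mN)
  then show ?thesis using c by (simp add: M.M.diff_eq_zero_iff)
qed

lemma hor_cls_surj:
  assumes m: "m \<in> carrier M"
  shows "\<exists>h\<in>H. cls h = cls m"
proof -
  obtain u where u: "u \<in> flat.mN" "m \<oplus>\<^bsub>M\<^esub> u \<in> H" using flat.hor_lift[OF m] by blast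
  have uM: "u \<in> carrier M" using u flat.mN_subset by blast
  have "(m \<oplus>\<^bsub>M\<^esub> u) \<ominus>\<^bsub>M\<^esub> m = u"
    using m uM by (simp add: a_minus_def M.M.a_comm[of m u] M.M.a_assoc M.M.r_neg)
  then have "cls (m \<oplus>\<^bsub>M\<^esub> u) = cls m" using u m uM by (simp add: cls_facts)
  then show ?thesis using u by blast
qed

text \<open>The horizontal representative of a class in \<open>M / \<mm> M\<close>.\<close>

definition hrep :: "'m set \<Rightarrow> 'm" where
  "hrep w = (THE h. h \<in> H \<and> cls h = w)"

lemma hrep_cls: "h \<in> H \<Longrightarrow> hrep (cls h) = h"
  unfolding hrep_def by (rule the_equality) (auto intro: hor_cls_inj)

lemma hrep_ex: "w \<in> carrier W \<Longrightarrow> \<exists>h\<in>H. w = cls h"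
proof -
  assume "w \<in> carrier W"
  then obtain m where "m \<in> carrier M" "w = cls m" by (auto simp: cls_facts)
  then show ?thesis using hor_cls_surj[of m] by metis
qed

lemma hrep_hor: "w \<in> carrier W \<Longrightarrow> hrep w \<in> H"
  using hrep_ex hrep_cls by fastforce

lemma hrep_closed [simp]: "w \<in> carrier W \<Longrightarrow> hrep w \<in> carrier M"
  using hrep_hor flat.hor_subset by blast

lemma hrep_in: "w \<in> carrier W \<Longrightarrow> hrep w \<in> w"
proof -
  assume "w \<in> carrier W"
  then obtain h where h: "h \<in> H" "w = cls h" using hrep_ex by blast
  have "h \<ominus>\<^bsub>M\<^esub> h \<in> flat.mN" using h M.submodule_zero[OF flat.mN_submodule]
    by (simp add: a_minus_def M.M.r_neg H_closed)
  then show ?thesis using h by (simp add: hrep_cls cls_facts H_closed)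
qed

lemma hrep_add:
  assumes "w \<in> carrier W" "w' \<in> carrier W"
  shows "hrep (w \<oplus>\<^bsub>W\<^esub> w') = hrep w \<oplus>\<^bsub>M\<^esub> hrep w'"
proof -
  obtain h h' where h: "h \<in> H" "w = cls h" "h' \<in> H" "w' = cls h'" using hrep_ex assms by blast
  then have "w \<oplus>\<^bsub>W\<^esub> w' = cls (h \<oplus>\<^bsub>M\<^esub> h')" by (simp add: cls_facts H_closed)
  then show ?thesis using h by (simp add: hrep_cls flat.hor_add)
qed

lemma hrep_smult:
  assumes "w \<in> carrier W"
  shows "hrep (const_series c \<odot>\<^bsub>W\<^esub> w) = const_series c \<odot>\<^bsub>M\<^esub> hrep w"
proof -
  obtain h where h: "h \<in> H" "w = cls h" using hrep_ex assms by blast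
  then have "const_series c \<odot>\<^bsub>W\<^esub> w = cls (const_series c \<odot>\<^bsub>M\<^esub> h)" by (simp add: cls_facts H_closed)
  then show ?thesis using h by (simp add: hrep_cls flat.hor_const_smult)
qed

lemma module_W: "module R W"
  unfolding W_eq by (rule M.module_quot[OF flat.mN_submodule])

sublocale tens: tensor_modules k "self_module R" W
proof (rule tensor_modules.intro)
  show "ring_module k (self_module R)" using module_scalars[OF module_self] by (simp add: ring_module_iff)
  show "ring_module k W" using module_scalars[OF module_W] by (simp add: ring_module_iff)
qed

abbreviation TW where "TW \<equiv> tensor k (self_module R) W"
abbreviation tw where "tw \<equiv> pure_tensor k (self_module R) W"

text \<open>The map \<open>r \<otimes> w \<mapsto> r h(w)\<close>, where \<open>h(w)\<close> is the horizontal representative of \<open>w\<close>. For a horizontal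
  basis \<open>h\<^sub>i\<close>, each tensor is a sum \<open>\<Sum>\<^sub>i v\<^sub>i \<otimes> (h\<^sub>i mod \<mm> M)\<close>, which is written \<open>\<tau> v\<close> below and goes to
  \<open>\<Sum>\<^sub>i v\<^sub>i h\<^sub>i\<close>.\<close>

theorem trivialisation:
  "\<exists>\<Psi>\<in>lin_maps k TW M. bij_betw \<Psi> (carrier TW) (carrier M) \<and>
    (\<forall>r\<in>carrier R. \<forall>w\<in>carrier W. \<Psi> (tw r w) = r \<odot>\<^bsub>M\<^esub> hrep w)"
proof -
  have kM: "module k M" by (rule module_scalars[OF M.module_axioms])
  have TWm: "module k TW" by (rule tens.module_tensor)
  interpret TW: module k TW by (rule TWm)
  have "\<exists>\<Psi>\<in>lin_maps k TW M. \<forall>r\<in>carrier (self_module R). \<forall>w\<in>carrier W. \<Psi> (tw r w) = r \<odot>\<^bsub>M\<^esub> hrep w"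
    by (rule tens.tensor_lift[OF kM])
      (auto simp: M.smult_l_distr M.smult_r_distr M.smult_assoc1[symmetric] hrep_add hrep_smult R.m_comm)
  then obtain \<Psi> where \<Psi>: "\<Psi> \<in> lin_maps k TW M"
    "\<And>r w. r \<in> carrier R \<Longrightarrow> w \<in> carrier W \<Longrightarrow> \<Psi> (tw r w) = r \<odot>\<^bsub>M\<^esub> hrep w" by auto
  obtain I :: "'m set" and h :: "'m \<Rightarrow> 'm" where b: "M.basis I h" and h: "h \<in> I \<rightarrow> H"
    using flat.hor_basis_exists by blast
  have I: "finite I" "h \<in> I \<rightarrow> carrier M" using b by (auto simp: M.basis_def)
  have cW: "cls (h i) \<in> carrier W" if "i \<in> I" for i using I that by (auto simp: cls_facts)
  have twc: "tw r w \<in> carrier TW" if "r \<in> carrier R" "w \<in> carrier W" for r w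
    using tens.ptensor_closed[of r w] that by simp
  define \<tau> where "\<tau> v = finsum TW (\<lambda>i. tw (v i) (cls (h i))) I" for v
  have tv: "(\<lambda>i. tw (v i) (cls (h i))) \<in> I \<rightarrow> carrier TW" if "v \<in> I \<rightarrow> carrier R" for v
    using that by (intro Pi_I twc cW) auto
  have \<tau>c: "\<tau> v \<in> carrier TW" if "v \<in> I \<rightarrow> carrier R" for v
    unfolding \<tau>_def by (rule TW.M.finsum_closed[OF tv[OF that]])
  have \<Psi>\<tau>: "\<Psi> (\<tau> v) = M.lincomb I h v" if v: "v \<in> I \<rightarrow> carrier R" for v
  proof -
    have "\<Psi> (\<tau> v) = (\<Oplus>\<^bsub>M\<^esub>i\<in>I. \<Psi> (tw (v i) (cls (h i))))"
      unfolding \<tau>_def by (rule lin_maps_finsum[OF TWm kM \<Psi>(1) I(1) tv[OF v]])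
    also have "\<dots> = M.lincomb I h v"
      unfolding M.lincomb_def using v cW I h by (intro M.M.finsum_cong') (auto simp: \<Psi>(2) hrep_cls Pi_iff)
    finally show ?thesis .
  qed
  have pure: "\<exists>v\<in>I \<rightarrow> carrier R. tw r w = \<tau> v" if r: "r \<in> carrier R" and w: "w \<in> carrier W" for r w
  proof -
    obtain g where g: "g \<in> H" "w = cls g" using hrep_ex[OF w] by blast
    obtain v where v: "v \<in> I \<rightarrow> carrier R" "g = M.lincomb I h v"
      using g b flat.hor_subset unfolding M.basis_def by blast
    define c where "c i = v i 0" for i
    have vc: "v i = const_series (c i)" if "i \<in> I" for i
      unfolding c_def by (rule flat.hor_coords_const[OF b h v(1) _ that]) (use g v in auto)
    \<comment> \<open>\<open>m \<mapsto> r \<otimes> (m mod \<mm> M)\<close> is linear over \<open>k\<close>\<close>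
    have lin: "(\<lambda>m. tw r (cls m)) \<in> lin_maps k M TW"
      unfolding lin_maps_def
    proof (intro CollectI conjI ballI Pi_I)
      fix m assume m: "m \<in> carrier M"
      then show "tw r (cls m) \<in> carrier TW" using r by (intro twc) (auto simp: cls_facts)
      {
        fix m' assume m': "m' \<in> carrier M"
        show "tw r (cls (m \<oplus>\<^bsub>M\<^esub> m')) = tw r (cls m) \<oplus>\<^bsub>TW\<^esub> tw r (cls m')"
          using m m' r by (subst tens.ptensor_add_right[symmetric]) (auto simp: cls_facts)
      next
        fix s assume s: "s \<in> carrier k"
        then have "s \<in> carrier R" by auto
        then show "tw r (cls (s \<odot>\<^bsub>M\<^esub> m)) = s \<odot>\<^bsub>TW\<^esub> tw r (cls m)"
          using m r s by (subst tens.ptensor_smult_right[symmetric]) (auto simp: cls_facts)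
      }
    qed
    have "tw r w = finsum TW (\<lambda>i. tw r (cls (v i \<odot>\<^bsub>M\<^esub> h i))) I"
      unfolding g(2) v(2) M.lincomb_def using v I
      by (intro lin_maps_finsum[OF kM TWm lin]) (auto simp: Pi_iff)
    also have "\<dots> = \<tau> (\<lambda>i. const_series (c i) \<otimes> r)"
      unfolding \<tau>_def
    proof (rule TW.M.finsum_cong'[OF refl])
      show "(\<lambda>i. tw (const_series (c i) \<otimes> r) (cls (h i))) \<in> I \<rightarrow> carrier TW"
        using r by (intro tv) auto
      fix i assume i: "i \<in> I"
      have hi: "h i \<in> carrier M" using I i by auto
      have "tw r (cls (v i \<odot>\<^bsub>M\<^esub> h i)) = const_series (c i) \<odot>\<^bsub>TW\<^esub> tw r (cls (h i))"
        using lin_mapsD(3)[OF lin _ hi, of "const_series (c i)"] vc[OF i] by simp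
      also have "\<dots> = tw (const_series (c i) \<otimes> r) (cls (h i))"
        using tens.ptensor_smult_left[of "const_series (c i)" r "cls (h i)"] r cW[OF i] by simp
      finally show "tw r (cls (v i \<odot>\<^bsub>M\<^esub> h i)) = tw (const_series (c i) \<otimes> r) (cls (h i))" .
    qed
    finally have "tw r w = \<tau> (\<lambda>i. const_series (c i) \<otimes> r)" .
    moreover have "(\<lambda>i. const_series (c i) \<otimes> r) \<in> I \<rightarrow> carrier R" using r by auto
    ultimately show ?thesis by blast
  qed
  have all: "\<exists>v\<in>I \<rightarrow> carrier R. X = \<tau> v" if X: "X \<in> carrier TW" for X
  proof (rule tens.tensor_induct[OF X])
    have "tw \<zero> w = \<zero>\<^bsub>TW\<^esub>" if w: "w \<in> carrier W" for w
    proof -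
      have "\<zero> \<in> carrier k" by (simp add: zero_eq)
      then have "tw (\<zero> \<otimes> \<zero>) w = \<zero>\<^bsub>k\<^esub> \<odot>\<^bsub>TW\<^esub> tw \<zero> w"
        using tens.ptensor_smult_left[of "\<zero>" "\<zero>" w] w by simp
      also have "\<dots> = \<zero>\<^bsub>TW\<^esub>" using w by (intro TW.smult_l_null twc) simp_all
      finally show ?thesis by simp
    qed
    then have "\<zero>\<^bsub>TW\<^esub> = \<tau> (\<lambda>i. \<zero>)"
      unfolding \<tau>_def using cW by (intro TW.M.add.finprod_one_eqI[symmetric]) auto
    then show "\<exists>v\<in>I \<rightarrow> carrier R. \<zero>\<^bsub>TW\<^esub> = \<tau> v" by (intro bexI[of _ "\<lambda>i. \<zero>"]) auto
  next
    fix r w assume "r \<in> carrier (self_module R)" "w \<in> carrier W"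
    then show "\<exists>v\<in>I \<rightarrow> carrier R. tw r w = \<tau> v" using pure by simp
  next
    fix X Y assume "\<exists>v\<in>I \<rightarrow> carrier R. X = \<tau> v" "\<exists>v\<in>I \<rightarrow> carrier R. Y = \<tau> v"
    then obtain v v' where v: "v \<in> I \<rightarrow> carrier R" "X = \<tau> v" "v' \<in> I \<rightarrow> carrier R" "Y = \<tau> v'" by blast
    have "X \<oplus>\<^bsub>TW\<^esub> Y = finsum TW (\<lambda>i. tw (v i) (cls (h i)) \<oplus>\<^bsub>TW\<^esub> tw (v' i) (cls (h i))) I"
      unfolding v(2,4) \<tau>_def by (rule TW.M.finsum_addf[OF tv[OF v(1)] tv[OF v(3)], symmetric])
    also have "\<dots> = \<tau> (\<lambda>i. v i \<oplus> v' i)"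
      unfolding \<tau>_def
    proof (rule TW.M.finsum_cong'[OF refl])
      show "(\<lambda>i. tw (v i \<oplus> v' i) (cls (h i))) \<in> I \<rightarrow> carrier TW"
        using v by (intro tv) auto
      fix i assume "i \<in> I"
      then show "tw (v i) (cls (h i)) \<oplus>\<^bsub>TW\<^esub> tw (v' i) (cls (h i)) = tw (v i \<oplus> v' i) (cls (h i))"
        using tens.ptensor_add_left[of "v i" "v' i" "cls (h i)"] v cW by auto
    qed
    finally have "X \<oplus>\<^bsub>TW\<^esub> Y = \<tau> (\<lambda>i. v i \<oplus> v' i)" .
    moreover have "(\<lambda>i. v i \<oplus> v' i) \<in> I \<rightarrow> carrier R" using v by auto
    ultimately show "\<exists>u\<in>I \<rightarrow> carrier R. X \<oplus>\<^bsub>TW\<^esub> Y = \<tau> u" by blast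
  qed
  have "bij_betw \<Psi> (carrier TW) (carrier M)"
    unfolding bij_betw_def
  proof
    show "inj_on \<Psi> (carrier TW)"
    proof (rule inj_onI)
      fix X Y assume "X \<in> carrier TW" "Y \<in> carrier TW" and eq: "\<Psi> X = \<Psi> Y"
      then obtain v v' where v: "v \<in> I \<rightarrow> carrier R" "X = \<tau> v" "v' \<in> I \<rightarrow> carrier R" "Y = \<tau> v'"
        using all by blast
      then have "M.lincomb I h v = M.lincomb I h v'" using eq by (simp add: \<Psi>\<tau>)
      then have "v i = v' i" if "i \<in> I" for i using M.basis_unique[OF b v(1,3) _ that] by blast
      then show "X = Y"
        unfolding v(2,4) \<tau>_def by (intro TW.M.finsum_cong' tv[OF v(3)]) simp_all
    qed
    show "\<Psi> ` carrier TW = carrier M"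
    proof
      show "\<Psi> ` carrier TW \<subseteq> carrier M" using lin_mapsD(1)[OF \<Psi>(1)] by blast
      show "carrier M \<subseteq> \<Psi> ` carrier TW"
      proof
        fix m assume "m \<in> carrier M"
        then obtain v where v: "v \<in> I \<rightarrow> carrier R" "m = M.lincomb I h v"
          using b unfolding M.basis_def by blast
        then have "m = \<Psi> (\<tau> v)" by (simp add: \<Psi>\<tau>)
        then show "m \<in> \<Psi> ` carrier TW" using \<tau>c[OF v(1)] by blast
      qed
    qed
  qed
  then show ?thesis using \<Psi> by blast
qed

end

section \<open>Local systems\<close>

context split_algebroid_module
begin

abbreviation fM :: "'m \<Rightarrow> ('k mseries set \<times> 'm \<Rightarrow> 'k mseries) set" where
  "fM \<equiv> fib M"

text \<open>The action of the fibre Lie algebra on the fibre of \<open>M\<close>.\<close>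

abbreviation fibact where
  "fibact \<equiv> fibre_bilin R kerG M M \<rho>"

lemmas fM_lin = fib_linear[OF M.module_axioms]

lemma fM_eq_iff: "m \<in> carrier M \<Longrightarrow> m' \<in> carrier M \<Longrightarrow> fM m = fM m' \<longleftrightarrow> m \<ominus>\<^bsub>M\<^esub> m' \<in> flat.mN"
  unfolding flat.mN_def by (rule fib_eq_iff[OF M.module_axioms])

lemma fM_hor_inj: "h \<in> H \<Longrightarrow> h' \<in> H \<Longrightarrow> fM h = fM h' \<Longrightarrow> h = h'"
  using fM_eq_iff hor_cls_inj H_closed by (simp add: cls_facts)

lemma fM_hor_surj:
  assumes "X \<in> carrier (fibre R M)"
  shows "\<exists>h\<in>H. X = fM h"
proof -
  obtain m where m: "m \<in> carrier M" "X = fM m" using fib_surj[OF M.module_axioms assms] by blast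
  obtain h where "h \<in> H" "cls h = cls m" using hor_cls_surj[OF m(1)] by blast
  then show ?thesis using m H_closed by (intro bexI[of _ h]) (simp_all add: fM_eq_iff[symmetric] cls_facts)
qed

text \<open>\<open>R\<close> acts on the fibre through the residue field.\<close>

lemma fibre_smult:
  assumes r: "r \<in> carrier R" and m: "m \<in> carrier M"
  shows "fM (r \<odot>\<^bsub>M\<^esub> m) = fM (const_series (r 0) \<odot>\<^bsub>M\<^esub> m)"
proof -
  have "r \<ominus> const_series (r 0) \<in> max_id" using r by (simp add: max_id_def const_coeff)
  then have "(r \<ominus> const_series (r 0)) \<odot>\<^bsub>M\<^esub> m \<in> flat.mN"
    unfolding flat.mN_def by (rule M.ideal_times_mem[OF _ m])
  then have "r \<odot>\<^bsub>M\<^esub> m \<ominus>\<^bsub>M\<^esub> const_series (r 0) \<odot>\<^bsub>M\<^esub> m \<in> flat.mN"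
    using r m by (simp add: a_minus_def M.smult_l_distr M.smult_l_minus)
  then show ?thesis using r m by (simp add: fM_eq_iff)
qed

lemma \<rho>_ker_linear: "x \<in> ker \<Longrightarrow> \<rho> x \<in> lin_maps R M M"
  using action_leibniz[of x] ker_subset[of x] by (auto simp: lin_maps_def \<rho>_add_right ker_def)

lemma \<rho>_left_linear: "m \<in> carrier M \<Longrightarrow> (\<lambda>x. \<rho> x m) \<in> lin_maps R kerG M"
  using ker_subset by (auto simp: lin_maps_def \<rho>_add_left \<rho>_smult_left)

lemma fibact_fib: "x \<in> ker \<Longrightarrow> m \<in> carrier M \<Longrightarrow> fibact (fib kerG x) (fM m) = fM (\<rho> x m)"
  by (rule fibre_bilin_eq[OF module_kerG M.module_axioms M.module_axioms])
    (simp_all add: \<rho>_ker_linear \<rho>_left_linear)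

lemma carrier_fibre_lie: "carrier (fibre_lie R L) = carrier (fibre R L)"
  by (simp add: fibre_lie_def module.defs)

text \<open>Stable submodules of \<open>M\<close> and stable subspaces of the fibre.\<close>

abbreviation stableM :: "'m set \<Rightarrow> bool" where
  "stableM \<equiv> stable_submodule R G M \<rho>"

abbreviation stableF where
  "stableF \<equiv> stable_submodule k (fibre_lie R kerG) (fibre R M) fibact"

lemma stableM_span:
  assumes "stableM L"
  shows "L = span_mod R M (L \<inter> H)"
  by (rule flat.stable_submodule_span_hor) (use assms in \<open>auto simp: stable_submodule_def\<close>)

lemma stable_image:
  assumes L: "stableM L"
  shows "stableF (fM ` L)"
  unfolding stable_submodule_def
proof
  have Ls: "submodule L R M" using L by (simp add: stable_submodule_def)
  have LM: "L \<subseteq> carrier M" by (rule M.submoduleE(1)[OF Ls])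
  interpret F: module k "fibre R M" by (rule module_scalars[OF module_fibre[OF M.module_axioms]])
  note lin = lin_mapsD[OF fM_lin]
  show "submodule (fM ` L) k (fibre R M)"
  proof (rule F.submoduleI)
    show "fM ` L \<subseteq> carrier (fibre R M)" using LM lin(1) by blast
    show "\<zero>\<^bsub>fibre R M\<^esub> \<in> fM ` L"
      using lin_maps_zero[OF M.module_axioms module_fibre[OF M.module_axioms] fM_lin]
        M.submodule_zero[OF Ls] by (metis image_eqI)
  next
    fix X assume "X \<in> fM ` L"
    then obtain m where m: "m \<in> L" "X = fM m" by blast
    then have "\<ominus>\<^bsub>fibre R M\<^esub> X = fM (\<ominus>\<^bsub>M\<^esub> m)"
      using lin_maps_minus[OF M.module_axioms module_fibre[OF M.module_axioms] fM_lin, of m] LM by auto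
    then show "\<ominus>\<^bsub>fibre R M\<^esub> X \<in> fM ` L" using M.submoduleE(3)[OF Ls m(1)] by blast
  next
    fix X Y assume "X \<in> fM ` L" "Y \<in> fM ` L"
    then obtain m m' where m: "m \<in> L" "X = fM m" "m' \<in> L" "Y = fM m'" by blast
    then have "X \<oplus>\<^bsub>fibre R M\<^esub> Y = fM (m \<oplus>\<^bsub>M\<^esub> m')" using lin(2)[of m m'] LM by auto
    then show "X \<oplus>\<^bsub>fibre R M\<^esub> Y \<in> fM ` L" using M.submoduleE(5)[OF Ls m(1,3)] by blast
  next
    fix s X assume s: "s \<in> carrier k" and "X \<in> fM ` L"
    then obtain m where m: "m \<in> L" "X = fM m" by blast
    have sR: "s \<in> carrier R" using s by auto
    then have "s \<odot>\<^bsub>fibre R M\<^esub> X = fM (s \<odot>\<^bsub>M\<^esub> m)" using lin(3)[of s m] m LM by auto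
    then show "s \<odot>\<^bsub>fibre R M\<^esub> X \<in> fM ` L" using M.submoduleE(4)[OF Ls sR m(1)] by blast
  qed
  show "\<forall>X\<in>carrier (fibre_lie R kerG). \<forall>Y\<in>fM ` L. fibact X Y \<in> fM ` L"
  proof (intro ballI)
    fix X Y assume X: "X \<in> carrier (fibre_lie R kerG)" and "Y \<in> fM ` L"
    then obtain m where m: "m \<in> L" "Y = fM m" by blast
    obtain x where x: "x \<in> ker" "X = fib kerG x"
      using fib_surj[OF module_kerG X[unfolded carrier_fibre_lie]] unfolding kerG_simps by blast
    have "fibact X Y = fM (\<rho> x m)" unfolding x m using x m LM by (intro fibact_fib) auto
    moreover have "\<rho> x m \<in> L" using L ker_subset[OF x(1)] m(1) by (simp add: stable_submodule_def)
    ultimately show "fibact X Y \<in> fM ` L" by blast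
  qed
qed

text \<open>In the fibre of \<open>M\<close>, \<open>\<Sum>\<^sub>i r\<^sub>i h\<^sub>i\<close> agrees with the horizontal element \<open>\<Sum>\<^sub>i r\<^sub>i(0) h\<^sub>i\<close>.\<close>

lemma span_hor_fibre:
  assumes sub: "submodule L R M" and m: "m \<in> span_mod R M (L \<inter> H)"
  shows "\<exists>h\<in>L \<inter> H. fM m = fM h"
proof -
  have LM: "L \<subseteq> carrier M" by (rule M.submoduleE(1)[OF sub])
  let ?P = "{m \<in> carrier M. \<exists>h\<in>L \<inter> H. fM m = fM h}"
  note lin = lin_mapsD[OF fM_lin]
  note minus = lin_maps_minus[OF M.module_axioms module_fibre[OF M.module_axioms] fM_lin]
  have "submodule ?P R M"
  proof (rule M.submoduleI)
    show "\<zero>\<^bsub>M\<^esub> \<in> ?P" using M.submodule_zero[OF sub] flat.hor_zero by auto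
  next
    fix a assume "a \<in> ?P"
    then obtain h where a: "a \<in> carrier M" and h: "h \<in> L" "h \<in> H" "fM a = fM h" by blast
    have "fM (\<ominus>\<^bsub>M\<^esub> a) = fM (\<ominus>\<^bsub>M\<^esub> h)" using a h H_closed by (simp add: minus)
    then show "\<ominus>\<^bsub>M\<^esub> a \<in> ?P" using a M.submoduleE(3)[OF sub h(1)] flat.hor_minus[OF h(2)] by auto
  next
    fix a b assume "a \<in> ?P" "b \<in> ?P"
    then obtain h h' where a: "a \<in> carrier M" "b \<in> carrier M"
      and h: "h \<in> L" "h \<in> H" "fM a = fM h" "h' \<in> L" "h' \<in> H" "fM b = fM h'" by blast
    have "fM (a \<oplus>\<^bsub>M\<^esub> b) = fM (h \<oplus>\<^bsub>M\<^esub> h')" using a h H_closed by (simp add: lin(2))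
    then show "a \<oplus>\<^bsub>M\<^esub> b \<in> ?P"
      using a M.submoduleE(5)[OF sub h(1,4)] flat.hor_add[OF h(2,5)] by auto
  next
    fix r a assume r: "r \<in> carrier R" and "a \<in> ?P"
    then obtain h where a: "a \<in> carrier M" and h: "h \<in> L" "h \<in> H" "fM a = fM h" by blast
    have "fM (r \<odot>\<^bsub>M\<^esub> a) = fM (r \<odot>\<^bsub>M\<^esub> h)" using a h H_closed r by (simp add: lin(3))
    also have "\<dots> = fM (const_series (r 0) \<odot>\<^bsub>M\<^esub> h)" using h H_closed r by (intro fibre_smult) auto
    finally show "r \<odot>\<^bsub>M\<^esub> a \<in> ?P"
      using a r M.submoduleE(4)[OF sub const_closed h(1)] flat.hor_const_smult[OF h(2)] by auto
  qed auto
  moreover have "L \<inter> H \<subseteq> ?P" using LM by auto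
  ultimately have "span_mod R M (L \<inter> H) \<subseteq> ?P" by (rule M.span_mod_least)
  then show ?thesis using m by blast
qed

lemma stable_image_subset:
  assumes L: "stableM L" and L': "stableM L'" and sub: "fM ` L \<subseteq> fM ` L'"
  shows "L \<subseteq> L'"
proof -
  have s': "submodule L' R M" using L' by (simp add: stable_submodule_def)
  have "L \<inter> H \<subseteq> L'"
  proof
    fix h assume h: "h \<in> L \<inter> H"
    then obtain m where m: "m \<in> L'" "fM h = fM m" using sub by blast
    then obtain h' where "h' \<in> L' \<inter> H" "fM m = fM h'"
      using span_hor_fibre[OF s'] stableM_span[OF L'] by blast
    then show "h \<in> L'" using m h fM_hor_inj[of h h'] by simp
  qed
  then have "span_mod R M (L \<inter> H) \<subseteq> L'" by (rule M.span_mod_least[OF s'])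
  then show ?thesis using stableM_span[OF L] by simp
qed

text \<open>The submodule generated by the horizontal elements over a subspace of the fibre.\<close>

definition hor_over :: "('k mseries set \<times> 'm \<Rightarrow> 'k mseries) set set \<Rightarrow> 'm set" where
  "hor_over U = span_mod R M {h \<in> H. fM h \<in> U}"

lemma hor_over_submodule: "submodule (hor_over U) R M"
  unfolding hor_over_def by (rule M.span_mod_submodule) (use H_closed in auto)

lemma hor_over_mem: "h \<in> H \<Longrightarrow> fM h \<in> U \<Longrightarrow> h \<in> hor_over U"
  unfolding hor_over_def by (rule subsetD[OF M.span_mod_base]) simp

lemma hor_over_induct:
  assumes P: "submodule P R M" and gen: "\<And>h. h \<in> H \<Longrightarrow> fM h \<in> U \<Longrightarrow> h \<in> P"
  shows "hor_over U \<subseteq> P"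
  unfolding hor_over_def by (rule M.span_mod_least[OF P]) (use gen in auto)

text \<open>Subspaces of the fibre over the constants are submodules over \<open>R\<close>, as \<open>r\<close> acts like \<open>r(0)\<close>.\<close>

lemma stableF_submodule:
  assumes U: "stableF U"
  shows "submodule U R (fibre R M)"
proof -
  interpret F: module R "fibre R M" by (rule module_fibre[OF M.module_axioms])
  interpret Fk: module k "fibre R M" by (rule module_scalars[OF module_fibre[OF M.module_axioms]])
  have Uk: "submodule U k (fibre R M)" using U by (simp add: stable_submodule_def)
  note E = Fk.submoduleE[OF Uk]
  show ?thesis
  proof (rule F.submoduleI)
    show "U \<subseteq> carrier (fibre R M)" by (rule E(1))
    show "\<zero>\<^bsub>fibre R M\<^esub> \<in> U" using subgroup.one_closed[OF submodule.axioms(1)[OF Uk]] by simp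
    fix r X assume r: "r \<in> carrier R" and X: "X \<in> U"
    then obtain h where h: "h \<in> H" "X = fM h" using E(1) fM_hor_surj by blast
    have "r \<odot>\<^bsub>fibre R M\<^esub> X = const_series (r 0) \<odot>\<^bsub>fibre R M\<^esub> X"
      using fibre_smult[OF r H_closed[OF h(1)]] lin_mapsD(3)[OF fM_lin _ H_closed[OF h(1)]] r h by simp
    then show "r \<odot>\<^bsub>fibre R M\<^esub> X \<in> U" using E(4)[OF _ X, of "const_series (r 0)"] by simp
  qed (use E in auto)
qed

lemma image_hor_over:
  assumes U: "stableF U"
  shows "fM ` hor_over U = U"
proof
  interpret F: ring_module R "fibre R M" using module_fibre[OF M.module_axioms] by (simp add: ring_module_iff)
  note Us = stableF_submodule[OF U]
  note lin = lin_mapsD[OF fM_lin]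
  note z = lin_maps_zero[OF M.module_axioms F.module_axioms fM_lin]
  note minus = lin_maps_minus[OF M.module_axioms F.module_axioms fM_lin]
  have "submodule {m \<in> carrier M. fM m \<in> U} R M"
    by (rule M.submoduleI) (auto simp: z minus lin F.submodule_zero[OF Us] F.submoduleE(3,4,5)[OF Us])
  then have "hor_over U \<subseteq> {m \<in> carrier M. fM m \<in> U}"
    by (rule hor_over_induct) (simp add: H_closed)
  then show "fM ` hor_over U \<subseteq> U" by blast
  show "U \<subseteq> fM ` hor_over U"
  proof
    fix X assume X: "X \<in> U"
    then obtain h where "h \<in> H" "X = fM h" using F.submoduleE(1)[OF Us] fM_hor_surj by blast
    then show "X \<in> fM ` hor_over U" using hor_over_mem[of h U] X by blast
  qed
qed

lemma \<rho>_ad_hor: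
  assumes y: "y \<in> ad.hor" and h: "h \<in> H"
  shows "\<rho> y h \<in> H"
proof -
  have yk: "y \<in> ker" and y0: "\<And>i. i < n \<Longrightarrow> br (lift i) y = \<zero>\<^bsub>G\<^esub>" using y by (auto simp: ad.hor_def)
  have yG: "y \<in> carrier G" by (rule ker_subset[OF yk])
  have hM: "h \<in> carrier M" and h0: "\<And>i. i < n \<Longrightarrow> nabla i h = \<zero>\<^bsub>M\<^esub>"
    using h by (auto simp: flat.hor_def)
  have "\<rho> y \<zero>\<^bsub>M\<^esub> = \<zero>\<^bsub>M\<^esub>" by (rule lin_maps_zero[OF M.module_axioms M.module_axioms \<rho>_ker_linear[OF yk]])
  then have "nabla i (\<rho> y h) \<ominus>\<^bsub>M\<^esub> \<zero>\<^bsub>M\<^esub> = \<zero>\<^bsub>M\<^esub>" if "i < n" for i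
    using \<rho>_bracket[OF lift_closed yG hM, of i] y0[OF that] h0[OF that] hM by (simp add: \<rho>_zero_left)
  then have "nabla i (\<rho> y h) = \<zero>\<^bsub>M\<^esub>" if "i < n" for i
    using that yG hM by (simp add: M.M.diff_eq_zero_iff)
  then show ?thesis using yG hM by (simp add: flat.hor_def)
qed

lemma hor_over_stable:
  assumes U: "stableF U"
  shows "stableM (hor_over U)"
  unfolding stable_submodule_def
proof (intro conjI hor_over_submodule ballI)
  let ?L = "hor_over U"
  note Ls = hor_over_submodule[of U]
  note E = M.submoduleE[OF Ls]
  have LM: "m \<in> carrier M" if "m \<in> ?L" for m using E(1) that by blast
  \<comment> \<open>the kernel is generated by its horizontal elements, which act on horizontal elements\<close>
  have hor_step: "\<rho> y m \<in> ?L" if y: "y \<in> ad.hor" and m: "m \<in> ?L" for y m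
  proof -
    have yk: "y \<in> ker" using y by (simp add: ad.hor_def)
    note lin = lin_mapsD[OF \<rho>_ker_linear[OF yk]]
    have "submodule {m \<in> carrier M. \<rho> y m \<in> ?L} R M"
      by (rule M.submoduleI)
        (auto simp: lin E(3,4,5) M.submodule_zero[OF Ls]
          lin_maps_zero[OF M.module_axioms M.module_axioms \<rho>_ker_linear[OF yk]]
          lin_maps_minus[OF M.module_axioms M.module_axioms \<rho>_ker_linear[OF yk]])
    moreover have "h \<in> {m \<in> carrier M. \<rho> y m \<in> ?L}" if h: "h \<in> H" "fM h \<in> U" for h
    proof -
      have "fib kerG y \<in> carrier (fibre_lie R kerG)"
        using lin_mapsD(1)[OF fib_linear[OF module_kerG], of y] yk by (simp add: carrier_fibre_lie)
      then have "fibact (fib kerG y) (fM h) \<in> U" using U h by (simp add: stable_submodule_def)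
      then have "fM (\<rho> y h) \<in> U" using fibact_fib[OF yk H_closed[OF h(1)]] by simp
      then show ?thesis using hor_over_mem[OF \<rho>_ad_hor[OF y h(1)]] H_closed[OF h(1)] by simp
    qed
    ultimately have "?L \<subseteq> {m \<in> carrier M. \<rho> y m \<in> ?L}" by (rule hor_over_induct)
    then show ?thesis using m by blast
  qed
  have ker_step: "\<rho> y m \<in> ?L" if y: "y \<in> ker" and m: "m \<in> ?L" for y m
  proof -
    note lin = lin_mapsD[OF \<rho>_left_linear[OF LM[OF m]]]
    have kr: "ring_module R kerG" using module_kerG by (simp add: ring_module_iff)
    have "submodule {y \<in> carrier kerG. \<rho> y m \<in> ?L} R kerG"
      by (rule module.submoduleI[OF module_kerG])
        (auto simp: lin E(3,4,5) M.submodule_zero[OF Ls]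
          lin_maps_zero[OF module_kerG M.module_axioms \<rho>_left_linear[OF LM[OF m]]]
          lin_maps_minus[OF module_kerG M.module_axioms \<rho>_left_linear[OF LM[OF m]]]
          simp del: kerG_simps)
    moreover have "carrier kerG \<inter> ad.hor \<subseteq> {y \<in> carrier kerG. \<rho> y m \<in> ?L}" using hor_step m by blast
    ultimately have "span_mod R kerG (carrier kerG \<inter> ad.hor) \<subseteq> {y \<in> carrier kerG. \<rho> y m \<in> ?L}"
      by (rule ring_module.span_mod_least[OF kr])
    moreover have "carrier kerG = span_mod R kerG (carrier kerG \<inter> ad.hor)"
      by (rule ad.stable_submodule_span_hor[OF module.carrier_is_submodule[OF module_kerG]]) (auto intro: br_ker)
    ultimately show ?thesis using y by auto
  qed
  have nabla_step: "nabla i m \<in> ?L" if i: "i < n" and m: "m \<in> ?L" for i m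
  proof -
    have "submodule {m \<in> carrier M. m \<in> ?L \<and> nabla i m \<in> ?L} R M"
    proof (rule M.submoduleI)
      have "nabla i \<zero>\<^bsub>M\<^esub> = \<zero>\<^bsub>M\<^esub>" using flat.hor_zero i by (simp add: flat.hor_def)
      then show "\<zero>\<^bsub>M\<^esub> \<in> {m \<in> carrier M. m \<in> ?L \<and> nabla i m \<in> ?L}" by (simp add: M.submodule_zero[OF Ls])
    next
      fix m assume m: "m \<in> {m \<in> carrier M. m \<in> ?L \<and> nabla i m \<in> ?L}"
      have "nabla i (\<ominus>\<^bsub>M\<^esub> m) \<oplus>\<^bsub>M\<^esub> nabla i m = nabla i (\<ominus>\<^bsub>M\<^esub> m \<oplus>\<^bsub>M\<^esub> m)"
        using m by (simp add: \<rho>_add_right)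
      also have "\<dots> = \<zero>\<^bsub>M\<^esub>" using m flat.hor_zero i by (simp add: M.M.l_neg flat.hor_def)
      finally have "nabla i (\<ominus>\<^bsub>M\<^esub> m) = \<ominus>\<^bsub>M\<^esub> nabla i m"
        using m M.M.minus_equality[of "nabla i (\<ominus>\<^bsub>M\<^esub> m)" "nabla i m"] by simp
      then show "\<ominus>\<^bsub>M\<^esub> m \<in> {m \<in> carrier M. m \<in> ?L \<and> nabla i m \<in> ?L}" using m E(3) by simp
    next
      fix r m assume "r \<in> carrier R" "m \<in> {m \<in> carrier M. m \<in> ?L \<and> nabla i m \<in> ?L}"
      then show "r \<odot>\<^bsub>M\<^esub> m \<in> {m \<in> carrier M. m \<in> ?L \<and> nabla i m \<in> ?L}"
        using i E(4,5) by (simp add: flat.nab_leibniz)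
    qed (use E(5) in \<open>auto simp: \<rho>_add_right\<close>)
    moreover have "h \<in> {m \<in> carrier M. m \<in> ?L \<and> nabla i m \<in> ?L}" if "h \<in> H" "fM h \<in> U" for h
      using hor_over_mem[OF that] that i M.submodule_zero[OF Ls] by (simp add: flat.hor_def)
    ultimately have "?L \<subseteq> {m \<in> carrier M. m \<in> ?L \<and> nabla i m \<in> ?L}" by (rule hor_over_induct)
    then show ?thesis using m by blast
  qed
  fix x m assume x: "x \<in> carrier G" and m: "m \<in> ?L"
  have mM: "m \<in> carrier M" by (rule LM[OF m])
  let ?D = "\<alpha> x"
  have D: "?D \<in> carrier T" by (rule anchor_derivation[OF x])
  have p: "lifts.proj x \<in> ker" by (rule lifts.proj_ker[OF x])
  have \<phi>G: "\<phi> ?D \<in> carrier G" using D by simp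
  have "lifts.proj x = x \<ominus>\<^bsub>G\<^esub> \<phi> ?D" by (simp add: lifts.proj_def \<phi>_expand[OF D])
  then have "x = lifts.proj x \<oplus>\<^bsub>G\<^esub> \<phi> ?D"
    using x \<phi>G by (simp add: a_minus_def G.M.a_assoc G.M.l_neg)
  then have "\<rho> x m = \<rho> (lifts.proj x) m \<oplus>\<^bsub>M\<^esub> \<rho> (\<phi> ?D) m"
    using \<rho>_add_left[OF ker_subset[OF p] \<phi>G mM] by simp
  moreover have "\<rho> (\<phi> ?D) m \<in> ?L"
    unfolding \<rho>_\<phi>[OF D mM]
    by (rule M.lincomb_in_submodule[OF Ls]) (use nabla_step m derivation_closed[OF D] in auto)
  ultimately show "\<rho> x m \<in> ?L" using E(5)[OF ker_step[OF p m]] by simp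
qed

text \<open>Chains of stable submodules correspond to chains of the same length on the other side.\<close>

theorem is_local_system: "local_system R constants G \<alpha> M \<rho>"
proof -
  have "(\<exists>N. (\<forall>i\<le>l. stableM (N i)) \<and> (\<forall>i<l. N i \<subset> N (Suc i))) \<longleftrightarrow>
      (\<exists>N. (\<forall>i\<le>l. stableF (N i)) \<and> (\<forall>i<l. N i \<subset> N (Suc i)))" for l
  proof
    assume "\<exists>N. (\<forall>i\<le>l. stableM (N i)) \<and> (\<forall>i<l. N i \<subset> N (Suc i))"
    then obtain N where N: "\<And>i. i \<le> l \<Longrightarrow> stableM (N i)" "\<And>i. i < l \<Longrightarrow> N i \<subset> N (Suc i)" by blast
    have "fM ` N i \<subset> fM ` N (Suc i)" if "i < l" for i
    proof
      show "fM ` N i \<subseteq> fM ` N (Suc i)" using N(2)[OF that] by blast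
      show "fM ` N i \<noteq> fM ` N (Suc i)"
        using stable_image_subset[of "N (Suc i)" "N i"] N(1)[of i] N(1)[of "Suc i"] N(2)[OF that] that by auto
    qed
    then show "\<exists>N. (\<forall>i\<le>l. stableF (N i)) \<and> (\<forall>i<l. N i \<subset> N (Suc i))"
      using N(1) stable_image by (intro exI[of _ "\<lambda>i. fM ` N i"]) auto
  next
    assume "\<exists>N. (\<forall>i\<le>l. stableF (N i)) \<and> (\<forall>i<l. N i \<subset> N (Suc i))"
    then obtain N where N: "\<And>i. i \<le> l \<Longrightarrow> stableF (N i)" "\<And>i. i < l \<Longrightarrow> N i \<subset> N (Suc i)" by blast
    have "hor_over (N i) \<subset> hor_over (N (Suc i))" if i: "i < l" for i
    proof
      have im: "fM ` hor_over (N i) = N i" "fM ` hor_over (N (Suc i)) = N (Suc i)"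
        using N(1) i by (auto intro!: image_hor_over)
      show "hor_over (N i) \<subseteq> hor_over (N (Suc i))"
        using N(2)[OF i] by (intro hor_over_induct hor_over_submodule hor_over_mem) auto
      show "hor_over (N i) \<noteq> hor_over (N (Suc i))"
      proof
        assume "hor_over (N i) = hor_over (N (Suc i))"
        then have "fM ` hor_over (N i) = fM ` hor_over (N (Suc i))" by (rule arg_cong)
        then have "N i = N (Suc i)" unfolding im .
        then show False using N(2)[OF i] by blast
      qed
    qed
    then show "\<exists>N. (\<forall>i\<le>l. stableM (N i)) \<and> (\<forall>i<l. N i \<subset> N (Suc i))"
      using N(1) hor_over_stable by (intro exI[of _ "\<lambda>i. hor_over (N i)"]) auto
  qed
  then have "rep_length R G M \<rho> = rep_length k (fibre_lie R kerG) (fibre R M) fibact"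
    by (simp add: rep_length_def)
  with finite_type_M show ?thesis unfolding local_system_def by (rule conjI)
qed

end

theorem proposition2p24:
  fixes R :: "'k::field_char_0 mseries ring" and K :: "'k mseries set" and n :: nat
    and G :: "('k mseries, 'g) lie_module" and \<alpha> :: "'g \<Rightarrow> 'k mseries \<Rightarrow> 'k mseries"
    and M :: "('k mseries, 'm) module" and \<rho> :: "'g \<Rightarrow> 'm \<Rightarrow> 'm"
  assumes R: "((\<forall>p::'k poly. Polynomial.degree p > 0 \<longrightarrow> (\<exists>x. poly p x = 0)) \<and> R = formal_series_ring n) \<or>
      (\<exists>\<iota>. field_embedding \<iota> \<and> (range \<iota> = UNIV \<or> range \<iota> = \<real>) \<and> R = convergent_series_ring \<iota> n)"
    and K: "K = range const_series"
    and G: "lie_algebroid R K G \<alpha>"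
    and transitive: "transitive R K G \<alpha>"
    and M: "lie_algebroid_module R K G \<alpha> M \<rho>"
    and finite_type: "finite_type R M"
  shows "is_split R K G \<alpha> \<and>
    (\<forall>\<phi>. splitting R K G \<alpha> \<phi> \<longrightarrow>
      span_mod R M (invariants R K M \<rho> \<phi>) = carrier M \<and>
      (let k = scalars R K; W = reduction R M;
           T = tensor k (self_module R) W; t = pure_tensor k (self_module R) W
       in \<exists>\<Psi> \<in> lin_maps k T M.
        bij_betw \<Psi> (carrier T) (carrier M) \<and>
        (\<forall>r\<in>carrier R. \<forall>s\<in>carrier R. \<forall>w\<in>carrier W. \<Psi> (t (r \<otimes>\<^bsub>R\<^esub> s) w) = r \<odot>\<^bsub>M\<^esub> \<Psi> (t s w)) \<and>
        (\<forall>w\<in>carrier W. \<Psi> (t \<one>\<^bsub>R\<^esub> w) \<in> w) \<and>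
        (\<forall>\<delta>\<in>carrier (derivations R K). \<forall>r\<in>carrier R. \<forall>w\<in>carrier W.
          \<rho> (\<phi> \<delta>) (\<Psi> (t r w)) = \<Psi> (t (\<delta> r) w)))) \<and>
    local_system R K G \<alpha> M \<rho>"
proof -
  have psr: "power_series_ring R n"
    using R formal_power_series_ring convergent_power_series_ring by blast
  interpret series_lie_algebroid R n G \<alpha>
    by (intro series_lie_algebroid.intro series_lie_algebroid_axioms.intro psr G[unfolded K] transitive[unfolded K])
  have sm: "split_algebroid_module R n G \<alpha> M \<rho> \<phi>" if "splitting R K G \<alpha> \<phi>" for \<phi>
    by (intro split_algebroid_module.intro split_algebroid_module_axioms.intro
        series_lie_algebroid_axioms M[unfolded K] assms(6) that[unfolded K])
  have split: "is_split R K G \<alpha>" unfolding K by (rule transitive_split)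
  then obtain \<phi>\<^sub>0 where "splitting R K G \<alpha> \<phi>\<^sub>0" by (auto simp: is_split_def)
  then have "local_system R K G \<alpha> M \<rho>"
    unfolding K by (intro split_algebroid_module.is_local_system[of R n G \<alpha> M \<rho> \<phi>\<^sub>0] sm) (simp add: K)
  moreover have "span_mod R M (invariants R K M \<rho> \<phi>) = carrier M \<and>
      (let k = scalars R K; W = reduction R M;
           T = tensor k (self_module R) W; t = pure_tensor k (self_module R) W
       in \<exists>\<Psi> \<in> lin_maps k T M.
        bij_betw \<Psi> (carrier T) (carrier M) \<and>
        (\<forall>r\<in>carrier R. \<forall>s\<in>carrier R. \<forall>w\<in>carrier W. \<Psi> (t (r \<otimes>\<^bsub>R\<^esub> s) w) = r \<odot>\<^bsub>M\<^esub> \<Psi> (t s w)) \<and>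
        (\<forall>w\<in>carrier W. \<Psi> (t \<one>\<^bsub>R\<^esub> w) \<in> w) \<and>
        (\<forall>\<delta>\<in>carrier (derivations R K). \<forall>r\<in>carrier R. \<forall>w\<in>carrier W.
          \<rho> (\<phi> \<delta>) (\<Psi> (t r w)) = \<Psi> (t (\<delta> r) w)))" if \<phi>: "splitting R K G \<alpha> \<phi>" for \<phi>
  proof -
    interpret S: split_algebroid_module R n G \<alpha> M \<rho> \<phi> by (rule sm[OF \<phi>])
    obtain \<Psi> where \<Psi>: "\<Psi> \<in> lin_maps S.k S.TW M" "bij_betw \<Psi> (carrier S.TW) (carrier M)"
        "\<And>r w. r \<in> carrier R \<Longrightarrow> w \<in> carrier (reduction R M) \<Longrightarrow> \<Psi> (S.tw r w) = r \<odot>\<^bsub>M\<^esub> S.hrep w"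
      using S.trivialisation by blast
    have act: "\<rho> (\<phi> \<delta>) (r \<odot>\<^bsub>M\<^esub> S.hrep w) = \<delta> r \<odot>\<^bsub>M\<^esub> S.hrep w"
      if \<delta>: "\<delta> \<in> carrier (derivations R constants)" and r: "r \<in> carrier R"
        and w: "w \<in> carrier (reduction R M)" for \<delta> r w
      using S.action_leibniz[OF S.\<phi>_closed[OF \<delta>] r S.hrep_closed[OF w]] S.\<phi>_anchor[OF \<delta>]
        S.\<rho>_\<phi>_hor[OF \<delta> S.hrep_hor[OF w]] derivation_closed[OF \<delta> r] r S.hrep_closed[OF w] by simp
    have "\<Psi> (S.tw (r \<otimes>\<^bsub>R\<^esub> s) w) = r \<odot>\<^bsub>M\<^esub> \<Psi> (S.tw s w)"
      if "r \<in> carrier R" "s \<in> carrier R" "w \<in> carrier (reduction R M)" for r s w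
      using that by (simp add: \<Psi>(3) S.M.smult_assoc1)
    moreover have "\<Psi> (S.tw \<one>\<^bsub>R\<^esub> w) \<in> w" if "w \<in> carrier (reduction R M)" for w
      using that S.hrep_in[OF that] by (simp add: \<Psi>(3))
    moreover have "\<rho> (\<phi> \<delta>) (\<Psi> (S.tw r w)) = \<Psi> (S.tw (\<delta> r) w)"
      if "\<delta> \<in> carrier (derivations R constants)" "r \<in> carrier R" "w \<in> carrier (reduction R M)" for \<delta> r w
      using that act derivation_closed by (simp add: \<Psi>(3))
    ultimately show ?thesis
      unfolding K Let_def using S.span_invariants \<Psi>(1,2) by blast
  qed
  ultimately show ?thesis using split by blast
qed

end
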